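(* Let $(A,\mathfrak a)$ be a unital good pair over $\Bbbk$, and let $n\ge 1$, $d\ge 0$ be integers. Then $T^A_{\mathfrak a}(n,d)$ is the subalgebra of $S^A(n,d)$ generated by $S^{\mathfrak a}(n,d)$ and the elements of the form $$\sum_{e=0}^{d-1}1^{\otimes d-1-e}\otimes\xi\otimes1^{\otimes e},$$ where $\xi\in M_n(A)$ and $1:=1_{M_n(A)}$.
   Context: $\Bbbk$ is a commutative domain of characteristic $0$. Superalgebras are $\mathbb Z/2$-graded associative (not necessarily unital) $\Bbbk$-algebras $A=A_{\bar 0}\oplus A_{\bar 1}$; $\bar a$ denotes the parity of a homogeneous element $a$; tensor products of superalgebras carry the product $(x\otimes y)(z\otimes w)=(-1)^{\bar y\bar z}xz\otimes yw$. A good pair $(A,\mathfrak a)$ consists of a superalgebra $A$ with $A_{\bar 0},A_{\bar 1}$ free over $\Bbbk$ and a subalgebra $\mathfrak a\subseteq A_{\bar 0}$ such that $\mathfrak a$ and $A/\mathfrak a$ are free $\Bbbk$-modules; it is a unital good pair if $A$ and $\mathfrak a$ are unital with $1_{\mathfrak a}=1_A$. An $(A,\mathfrak a)$-basis is a $\Bbbk$-basis $B=B_{\mathfrak a}\sqcup B_{\mathfrak c}\sqcup B_{\bar 1}$ of $A$, where $B_{\mathfrak a}$, $B_{\mathfrak c}$, $B_{\bar 1}$ are bases of $\mathfrak a$, of a chosen $\Bbbk$-module complement $\mathfrak c$ of $\mathfrak a$ in $A_{\bar 0}$, and of $A_{\bar 1}$, respectively; one such basis is fixed. For $a\in A$ put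 $\xi^a_{r,s}:=aE_{r,s}\in M_n(A)$ ($E_{r,s}$ the matrix units; $M_n(A)$ is a superalgebra via parities of entries). Write $[1,n]=\{1,\dots,n\}$. The symmetric group $\mathfrak S_d$ acts on the right on words by $(x_1\cdots x_d)\sigma=x_{\sigma 1}\cdots x_{\sigma d}$, diagonally on tuples of words, and on $M_n(A)^{\otimes d}$ by superalgebra automorphisms $(\xi^{a_1}_{r_1,s_1}\otimes\cdots\otimes\xi^{a_d}_{r_d,s_d})^\sigma=(-1)^{\langle\sigma;\boldsymbol a\rangle}\xi^{a_{\sigma1}}_{r_{\sigma1},s_{\sigma1}}\otimes\cdots\otimes\xi^{a_{\sigma d}}_{r_{\sigma d},s_{\sigma d}}$ for homogeneous $a_i$, where $\langle\sigma;\boldsymbol a\rangle=\#\{(k,l): k<l,\ \sigma^{-1}k>\sigma^{-1}l,\ a_k,a_l \text{ odd}\}$. Define $S^A(n,d):=(M_n(A)^{\otimes d})^{\mathfrak S_d}$; likewise $S^{\mathfrak a}(n,d):=(M_n(\mathfrak a)^{\otimes d})^{\mathfrak S_d}\subseteq S^A(n,d)$. $\mathrm{Tri}^B(n,d)$ is the set of triples $(\boldsymbol b,\boldsymbol r,\boldsymbol s)\in B^d\times[1,n]^d\times[1,n]^d$ such that for $k\ne l$ the equality $(b_k,r_k,s_k)=(b_l,r_l,s_l)$ holds only if $b_k$ is even. For such a triple let $\xi^{\boldsymbol b}_{\boldsymbol r,\boldsymbol s}:=\sum_\sigma(\xi^{b_1}_{r_1,s_1}\otimes\cdots\otimes\xi^{b_d}_{r_d,s_d})^\sigma\in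 S^A(n,d)$, with $\sigma$ over representatives of the cosets $\mathfrak S_{\boldsymbol b,\boldsymbol r,\boldsymbol s}\backslash\mathfrak S_d$, where $\mathfrak S_{\boldsymbol b,\boldsymbol r,\boldsymbol s}$ is the stabilizer of the triple. Let $[\boldsymbol b,\boldsymbol r,\boldsymbol s]^b_{r,s}:=\#\{k: (b_k,r_k,s_k)=(b,r,s)\}$, $[\boldsymbol b,\boldsymbol r,\boldsymbol s]^!_{\mathfrak c}:=\prod_{b\in B_{\mathfrak c},\,r,s\in[1,n]}[\boldsymbol b,\boldsymbol r,\boldsymbol s]^b_{r,s}!$, and $\eta^{\boldsymbol b}_{\boldsymbol r,\boldsymbol s}:=[\boldsymbol b,\boldsymbol r,\boldsymbol s]^!_{\mathfrak c}\,\xi^{\boldsymbol b}_{\boldsymbol r,\boldsymbol s}$. Finally $T^A_{\mathfrak a}(n,d)$ is the $\Bbbk$-span of all $\eta^{\boldsymbol b}_{\boldsymbol r,\boldsymbol s}$ with $(\boldsymbol b,\boldsymbol r,\boldsymbol s)\in\mathrm{Tri}^B(n,d)$. *)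

theory Defs
  imports
    "HOL-Analysis.Finite_Cartesian_Product"
    "HOL-Library.Poly_Mapping"
    "HOL-Library.Z2"
    "HOL-Combinatorics.Permutations"
    "HOL-Algebra.Module"
begin

section \<open>Superalgebras and good pairs\<close>

text \<open>
  The grading is indexed by the two-element field \<^typ>\<open>bit\<close>. The multiplication is a parameter
  rather than the class operation because the product of the type \<^typ>\<open>'a^'n^'n\<close> of matrices
  is not the one of a type class. Two theories define a locale called \<open>module\<close>; the one
  used here is that of \<^theory>\<open>HOL.Modules\<close>.
\<close>

locale superalgebra = Modules.module scl
  for scl :: "'k::comm_ring_1 \<Rightarrow> 'v::ab_group_add \<Rightarrow> 'v" +
  fixes mul :: "'v \<Rightarrow> 'v \<Rightarrow> 'v"
    and gr :: "bit \<Rightarrow> 'v set"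
  assumes mul_assoc: "mul (mul x y) z = mul x (mul y z)"
    and mul_add_left: "mul (x + y) z = mul x z + mul y z"
    and mul_add_right: "mul x (y + z) = mul x y + mul x z"
    and mul_scale_left: "mul (scl c x) y = scl c (mul x y)"
    and mul_scale_right: "mul x (scl c y) = scl c (mul x y)"
    and gr_subspace: "subspace (gr i)"
    and gr_direct_sum: "\<exists>!p. fst p \<in> gr 0 \<and> snd p \<in> gr 1 \<and> x = fst p + snd p"
    and gr_mul: "x \<in> gr i \<Longrightarrow> y \<in> gr j \<Longrightarrow> mul x y \<in> gr (i + j)"

definition is_basis :: "('k::comm_ring_1 \<Rightarrow> 'v::ab_group_add \<Rightarrow> 'v) \<Rightarrow> 'v set \<Rightarrow> 'v set \<Rightarrow> bool" where
  "is_basis scl B U \<longleftrightarrow> \<not> module.dependent scl B \<and> module.span scl B = U"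

definition is_free :: "('k::comm_ring_1 \<Rightarrow> 'v::ab_group_add \<Rightarrow> 'v) \<Rightarrow> 'v set \<Rightarrow> bool" where
  "is_free scl U \<longleftrightarrow> (\<exists>B. is_basis scl B U)"

text \<open>
  Freeness of the quotient of the whole module by the submodule \<open>U\<close>, written out for a set
  \<open>C\<close> of representatives of the elements of a basis of the quotient.
\<close>

definition is_free_quotient :: "('k::comm_ring_1 \<Rightarrow> 'v::ab_group_add \<Rightarrow> 'v) \<Rightarrow> 'v set \<Rightarrow> bool" where
  "is_free_quotient scl U \<longleftrightarrow>
     (\<exists>C. module.span scl (U \<union> C) = UNIV \<and>
        (\<forall>F u. finite F \<and> F \<subseteq> C \<and> (\<Sum>v\<in>F. scl (u v) v) \<in> U \<longrightarrow> (\<forall>v\<in>F. u v = 0)))"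

locale good_pair = superalgebra scl "(*)" gr
  for scl :: "'k::comm_ring_1 \<Rightarrow> 'a::ring \<Rightarrow> 'a"
    and gr :: "bit \<Rightarrow> 'a set" +
  fixes \<aa> :: "'a set"
  assumes free_gr: "is_free scl (gr i)"
    and sub_even: "\<aa> \<subseteq> gr 0"
    and sub_subspace: "subspace \<aa>"
    and sub_mult: "x \<in> \<aa> \<Longrightarrow> y \<in> \<aa> \<Longrightarrow> x * y \<in> \<aa>"
    and free_sub: "is_free scl \<aa>"
    and free_quotient: "is_free_quotient scl \<aa>"

text \<open>
  The sort \<open>{ring, monoid_mult}\<close> is that of rings with unit; unlike \<^class>\<open>ring_1\<close> it does
  not exclude the zero ring.
\<close>

locale unital_good_pair = good_pair scl gr \<aa>
  for scl :: "'k::comm_ring_1 \<Rightarrow> 'a::{ring,monoid_mult} \<Rightarrow> 'a"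
    and gr :: "bit \<Rightarrow> 'a set"
    and \<aa> :: "'a set" +
  assumes one_sub: "1 \<in> \<aa>"

definition pair_basis ::
  "('k::comm_ring_1 \<Rightarrow> 'v::ab_group_add \<Rightarrow> 'v) \<Rightarrow> (bit \<Rightarrow> 'v set) \<Rightarrow> 'v set \<Rightarrow> 'v set \<Rightarrow>
    'v set \<Rightarrow> 'v set \<Rightarrow> 'v set \<Rightarrow> bool" where
  "pair_basis scl gr \<aa> \<cc> Ba Bc B1 \<longleftrightarrow>
     module.subspace scl \<cc> \<and> \<aa> \<inter> \<cc> = {0} \<and> {x + y |x y. x \<in> \<aa> \<and> y \<in> \<cc>} = gr 0 \<and>
     is_basis scl Ba \<aa> \<and> is_basis scl Bc \<cc> \<and> is_basis scl B1 (gr 1)"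


section \<open>Tensor powers of a superalgebra\<close>

text \<open>
  The \<open>d\<close>-th tensor power is the quotient of the free module on the \<open>d\<close>-tuples (lists of
  length \<open>d\<close>) by the multilinearity relations. Its elements are equivalence classes of finitely
  supported functions on tuples, and linear maps are given on tuples, extended linearly and passed
  to the classes.
\<close>

definition free_scale :: "'k::comm_ring_1 \<Rightarrow> ('x \<Rightarrow>\<^sub>0 'k) \<Rightarrow> ('x \<Rightarrow>\<^sub>0 'k)" where
  "free_scale c p = Poly_Mapping.map ((*) c) p"

definition lin_ext :: "('x \<Rightarrow> ('y \<Rightarrow>\<^sub>0 'k)) \<Rightarrow> ('x \<Rightarrow>\<^sub>0 'k::comm_ring_1) \<Rightarrow> ('y \<Rightarrow>\<^sub>0 'k)" where
  "lin_ext f p = (\<Sum>x\<in>Poly_Mapping.keys p. free_scale (Poly_Mapping.lookup p x) (f x))"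

definition free_tuples :: "nat \<Rightarrow> ('v list \<Rightarrow>\<^sub>0 'k::comm_ring_1) set" where
  "free_tuples d = {p. \<forall>vs\<in>Poly_Mapping.keys p. length vs = d}"

definition multilinear_relations ::
  "('k::comm_ring_1 \<Rightarrow> 'v::ab_group_add \<Rightarrow> 'v) \<Rightarrow> nat \<Rightarrow> ('v list \<Rightarrow>\<^sub>0 'k) set" where
  "multilinear_relations scl d = module.span free_scale
     ({Poly_Mapping.single (us @ (x + y) # ws) 1 - Poly_Mapping.single (us @ x # ws) 1
         - Poly_Mapping.single (us @ y # ws) 1 |us x y ws. length (us @ x # ws) = d}
      \<union> {Poly_Mapping.single (us @ scl c x # ws) 1 - Poly_Mapping.single (us @ x # ws) c
         |us c x ws. length (us @ x # ws) = d})"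

definition tensor_rel ::
  "('k::comm_ring_1 \<Rightarrow> 'v::ab_group_add \<Rightarrow> 'v) \<Rightarrow> nat \<Rightarrow> (('v list \<Rightarrow>\<^sub>0 'k) \<times> ('v list \<Rightarrow>\<^sub>0 'k)) set" where
  "tensor_rel scl d =
     {(p, q). p \<in> free_tuples d \<and> q \<in> free_tuples d \<and> p - q \<in> multilinear_relations scl d}"

definition tensor_class ::
  "('k::comm_ring_1 \<Rightarrow> 'v::ab_group_add \<Rightarrow> 'v) \<Rightarrow> nat \<Rightarrow> ('v list \<Rightarrow>\<^sub>0 'k) \<Rightarrow> ('v list \<Rightarrow>\<^sub>0 'k) set" where
  "tensor_class scl d p = tensor_rel scl d `` {p}"

definition pure_tensor ::
  "('k::comm_ring_1 \<Rightarrow> 'v::ab_group_add \<Rightarrow> 'v) \<Rightarrow> 'v list \<Rightarrow> ('v list \<Rightarrow>\<^sub>0 'k) set" where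
  "pure_tensor scl vs = tensor_class scl (length vs) (Poly_Mapping.single vs 1)"

definition homogeneous_part :: "(bit \<Rightarrow> 'v::ab_group_add set) \<Rightarrow> bit \<Rightarrow> 'v \<Rightarrow> 'v" where
  "homogeneous_part gr i x = (THE y. y \<in> gr i \<and> x - y \<in> gr (i + 1))"

text \<open>
  Signs only make sense for tuples of homogeneous elements, so a tuple is first expanded as the sum,
  over all parity patterns \<open>e\<close>, of the tuples of its homogeneous parts.
\<close>

definition homogeneous_parts :: "(bit \<Rightarrow> 'v::ab_group_add set) \<Rightarrow> bit list \<Rightarrow> 'v list \<Rightarrow> 'v list" where
  "homogeneous_parts gr e vs = map2 (homogeneous_part gr) e vs"

text \<open>
  Iterating \<open>(x \<otimes> y)(z \<otimes> w) = (-1)\<^bsup>|y||z|\<^esup> xz \<otimes> yw\<close>, the \<open>i\<close>-th factor on the right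
  (parity \<open>f ! i\<close>) has to pass every \<open>j\<close>-th factor on the left (parity \<open>e ! j\<close>) with \<open>i < j\<close>.
\<close>

definition koszul_sign :: "bit list \<Rightarrow> bit list \<Rightarrow> 'k::comm_ring_1" where
  "koszul_sign e f = (-1) ^ card {(i, j). i < j \<and> j < length e \<and> e ! j = 1 \<and> f ! i = 1}"

definition tuple_mult ::
  "('v::ab_group_add \<Rightarrow> 'v \<Rightarrow> 'v) \<Rightarrow> (bit \<Rightarrow> 'v set) \<Rightarrow> 'v list \<Rightarrow> 'v list \<Rightarrow> ('v list \<Rightarrow>\<^sub>0 'k::comm_ring_1)" where
  "tuple_mult mul gr xs ys =
     (\<Sum>e\<in>{e. length e = length xs}. \<Sum>f\<in>{f. length f = length ys}.
        Poly_Mapping.single (map2 mul (homogeneous_parts gr e xs) (homogeneous_parts gr f ys))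
          (koszul_sign e f))"

definition tensor_power ::
  "('k::comm_ring_1 \<Rightarrow> 'v::ab_group_add \<Rightarrow> 'v) \<Rightarrow> ('v \<Rightarrow> 'v \<Rightarrow> 'v) \<Rightarrow> 'v \<Rightarrow> (bit \<Rightarrow> 'v set) \<Rightarrow> nat \<Rightarrow>
    ('k, ('v list \<Rightarrow>\<^sub>0 'k) set) module" where
  "tensor_power scl mul u gr d =
     \<lparr>carrier = free_tuples d // tensor_rel scl d,
      mult = (\<lambda>X Y. \<Union>x\<in>X. \<Union>y\<in>Y.
        tensor_class scl d (lin_ext (\<lambda>xs. lin_ext (tuple_mult mul gr xs) y) x)),
      one = pure_tensor scl (replicate d u),
      zero = tensor_class scl d 0,
      add = (\<lambda>X Y. \<Union>x\<in>X. \<Union>y\<in>Y. tensor_class scl d (x + y)),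
      smult = (\<lambda>c X. \<Union>x\<in>X. tensor_class scl d (free_scale c x))\<rparr>"

text \<open>
  Positions are numbered from \<open>0\<close>. In \<open>permute_sign\<close> the inverse of \<open>\<sigma>\<close> is written with
  \<^const>\<open>inv_into\<close> since \<open>inv\<close> denotes the inverse in a group record here. The right
  action sends \<open>v\<^sub>0 \<otimes> v\<^sub>1 \<otimes> \<dots>\<close> to plus or minus \<open>v\<^bsub>\<sigma> 0\<^esub> \<otimes> v\<^bsub>\<sigma> 1\<^esub> \<otimes> \<dots>\<close>,
  so that acting by \<open>\<sigma>\<close> and then by \<open>\<tau>\<close> is acting by \<open>\<sigma> \<circ> \<tau>\<close>.
\<close>

definition permute_sign :: "(nat \<Rightarrow> nat) \<Rightarrow> bit list \<Rightarrow> 'k::comm_ring_1" where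
  "permute_sign \<sigma> e = (-1) ^ card {(k, l). k < l \<and> l < length e \<and>
     inv_into UNIV \<sigma> k > inv_into UNIV \<sigma> l \<and> e ! k = 1 \<and> e ! l = 1}"

definition tuple_permute ::
  "(bit \<Rightarrow> 'v::ab_group_add set) \<Rightarrow> (nat \<Rightarrow> nat) \<Rightarrow> 'v list \<Rightarrow> ('v list \<Rightarrow>\<^sub>0 'k::comm_ring_1)" where
  "tuple_permute gr \<sigma> vs =
     (\<Sum>e\<in>{e. length e = length vs}.
        Poly_Mapping.single (permute_list \<sigma> (homogeneous_parts gr e vs)) (permute_sign \<sigma> e))"

definition tensor_permute ::
  "('k::comm_ring_1 \<Rightarrow> 'v::ab_group_add \<Rightarrow> 'v) \<Rightarrow> (bit \<Rightarrow> 'v set) \<Rightarrow> nat \<Rightarrow> (nat \<Rightarrow> nat) \<Rightarrow>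
    ('v list \<Rightarrow>\<^sub>0 'k) set \<Rightarrow> ('v list \<Rightarrow>\<^sub>0 'k) set" where
  "tensor_permute scl gr d \<sigma> X = (\<Union>x\<in>X. tensor_class scl d (lin_ext (tuple_permute gr \<sigma>) x))"


section \<open>Submodules and subalgebras\<close>

text \<open>All scalars of the type \<^typ>\<open>'k\<close> are allowed; subalgebras need not contain \<open>\<one>\<close>.\<close>

definition is_submodule :: "('k, 't, 'm) module_scheme \<Rightarrow> 't set \<Rightarrow> bool" where
  "is_submodule M C \<longleftrightarrow> C \<subseteq> carrier M \<and> \<zero>\<^bsub>M\<^esub> \<in> C \<and>
     (\<forall>x\<in>C. \<forall>y\<in>C. x \<oplus>\<^bsub>M\<^esub> y \<in> C) \<and> (\<forall>c. \<forall>x\<in>C. c \<odot>\<^bsub>M\<^esub> x \<in> C)"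

definition is_subalgebra :: "('k, 't, 'm) module_scheme \<Rightarrow> 't set \<Rightarrow> bool" where
  "is_subalgebra M C \<longleftrightarrow> is_submodule M C \<and> (\<forall>x\<in>C. \<forall>y\<in>C. x \<otimes>\<^bsub>M\<^esub> y \<in> C)"

definition module_span :: "('k, 't, 'm) module_scheme \<Rightarrow> 't set \<Rightarrow> 't set" where
  "module_span M X = \<Inter>{C. is_submodule M C \<and> X \<subseteq> C}"

definition generated_subalgebra :: "('k, 't, 'm) module_scheme \<Rightarrow> 't set \<Rightarrow> 't set" where
  "generated_subalgebra M X = \<Inter>{C. is_subalgebra M C \<and> X \<subseteq> C}"


section \<open>Matrix superalgebras\<close>

definition mat_scale :: "('k \<Rightarrow> 'a \<Rightarrow> 'a) \<Rightarrow> 'k \<Rightarrow> 'a^'n^'n \<Rightarrow> 'a^'n^'n" where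
  "mat_scale scl c X = (\<chi> r s. scl c (X $ r $ s))"

text \<open>
  The library's \<^const>\<open>matrix_matrix_mult\<close> has the same right-hand side, but its sort excludes the
  zero ring.
\<close>

definition mat_mul :: "('a::ring)^'n^'n \<Rightarrow> 'a^'n^'n \<Rightarrow> 'a^'n^'n" where
  "mat_mul X Y = (\<chi> r s. \<Sum>t\<in>UNIV. X $ r $ t * Y $ t $ s)"

definition mat_over :: "'a set \<Rightarrow> ('a^'n^'n) set" where
  "mat_over U = {X. \<forall>r s. X $ r $ s \<in> U}"

definition mat_gr :: "(bit \<Rightarrow> 'a set) \<Rightarrow> bit \<Rightarrow> ('a^'n^'n) set" where
  "mat_gr gr i = mat_over (gr i)"

definition \<xi>_unit :: "'a::zero \<Rightarrow> 'n \<Rightarrow> 'n \<Rightarrow> 'a^'n^'n" where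
  "\<xi>_unit a r s = (\<chi> i j. if i = r \<and> j = s then a else 0)"

definition mat_tensor ::
  "('k::comm_ring_1 \<Rightarrow> 'a::{ring,monoid_mult} \<Rightarrow> 'a) \<Rightarrow> (bit \<Rightarrow> 'a set) \<Rightarrow> nat \<Rightarrow>
    ('k, (('a^'n^'n) list \<Rightarrow>\<^sub>0 'k) set) module" where
  "mat_tensor scl gr d = tensor_power (mat_scale scl) mat_mul (mat 1) (mat_gr gr) d"


section \<open>Generalized Schur algebras\<close>

definition invariants ::
  "('k::comm_ring_1 \<Rightarrow> 'a::{ring,monoid_mult} \<Rightarrow> 'a) \<Rightarrow> (bit \<Rightarrow> 'a set) \<Rightarrow> nat \<Rightarrow>
    (('a^'n^'n) list \<Rightarrow>\<^sub>0 'k) set set" where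
  "invariants scl gr d =
     {X \<in> carrier (mat_tensor scl gr d). \<forall>\<sigma>. \<sigma> permutes {..<d} \<longrightarrow>
        tensor_permute (mat_scale scl) (mat_gr gr) d \<sigma> X = X}"

definition S_alg ::
  "('k::comm_ring_1 \<Rightarrow> 'a::{ring,monoid_mult} \<Rightarrow> 'a) \<Rightarrow> (bit \<Rightarrow> 'a set) \<Rightarrow> nat \<Rightarrow>
    ('k, (('a^'n^'n) list \<Rightarrow>\<^sub>0 'k) set) module" where
  "S_alg scl gr d = (mat_tensor scl gr d)\<lparr>carrier := invariants scl gr d\<rparr>"

text \<open>
  Since \<open>\<aa>\<close> is a direct summand of the algebra, the tensor power of the matrices over \<open>\<aa>\<close>
  embeds in the tensor power of all matrices; it is identified with its image there.
\<close>

definition S_sub ::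
  "('k::comm_ring_1 \<Rightarrow> 'a::{ring,monoid_mult} \<Rightarrow> 'a) \<Rightarrow> (bit \<Rightarrow> 'a set) \<Rightarrow> 'a set \<Rightarrow> nat \<Rightarrow>
    (('a^'n^'n) list \<Rightarrow>\<^sub>0 'k) set set" where
  "S_sub scl gr \<aa> d = invariants scl gr d \<inter>
     module_span (mat_tensor scl gr d)
       {pure_tensor (mat_scale scl) vs |vs. length vs = d \<and> set vs \<subseteq> mat_over \<aa>}"

definition Tri ::
  "(bit \<Rightarrow> 'a set) \<Rightarrow> 'a set \<Rightarrow> nat \<Rightarrow> ('a list \<times> 'n list \<times> 'n list) set" where
  "Tri gr B d = {(b, r, s). length b = d \<and> length r = d \<and> length s = d \<and> set b \<subseteq> B \<and>
     (\<forall>k<d. \<forall>l<d. k \<noteq> l \<and> (b ! k, r ! k, s ! k) = (b ! l, r ! l, s ! l) \<longrightarrow> b ! k \<in> gr 0)}"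

definition tri_stabilizer :: "'a list \<Rightarrow> 'n list \<Rightarrow> 'n list \<Rightarrow> nat \<Rightarrow> (nat \<Rightarrow> nat) set" where
  "tri_stabilizer b r s d = {\<tau>. \<tau> permutes {..<d} \<and>
     permute_list \<tau> b = b \<and> permute_list \<tau> r = r \<and> permute_list \<tau> s = s}"

definition tri_cosets :: "'a list \<Rightarrow> 'n list \<Rightarrow> 'n list \<Rightarrow> nat \<Rightarrow> (nat \<Rightarrow> nat) set set" where
  "tri_cosets b r s d = {(\<lambda>\<tau>. \<tau> \<circ> \<sigma>) ` tri_stabilizer b r s d |\<sigma>. \<sigma> permutes {..<d}}"

definition \<xi>_elem ::
  "('k::comm_ring_1 \<Rightarrow> 'a::{ring,monoid_mult} \<Rightarrow> 'a) \<Rightarrow> (bit \<Rightarrow> 'a set) \<Rightarrow> nat \<Rightarrow>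
    'a list \<Rightarrow> 'n list \<Rightarrow> 'n list \<Rightarrow> (('a^'n^'n) list \<Rightarrow>\<^sub>0 'k) set" where
  "\<xi>_elem scl gr d b r s =
     (\<Oplus>\<^bsub>mat_tensor scl gr d\<^esub>K\<in>tri_cosets b r s d.
        tensor_permute (mat_scale scl) (mat_gr gr) d (SOME \<sigma>. \<sigma> \<in> K)
          (pure_tensor (mat_scale scl) (map (\<lambda>i. \<xi>_unit (b ! i) (r ! i) (s ! i)) [0..<d])))"

definition tri_count :: "'a list \<Rightarrow> 'n list \<Rightarrow> 'n list \<Rightarrow> 'a \<Rightarrow> 'n \<Rightarrow> 'n \<Rightarrow> nat" where
  "tri_count bs rs ss b r s = card {k. k < length bs \<and> (bs ! k, rs ! k, ss ! k) = (b, r, s)}"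

text \<open>
  \<open>Bc\<close> may be infinite; the factors with \<open>b\<close> outside \<open>bs\<close> are \<open>0! = 1\<close>, so the product is
  restricted to the finitely many \<open>b\<close> that occur.
\<close>

definition tri_fact :: "'a set \<Rightarrow> 'a list \<Rightarrow> 'n::finite list \<Rightarrow> 'n list \<Rightarrow> nat" where
  "tri_fact Bc bs rs ss = (\<Prod>b\<in>Bc \<inter> set bs. \<Prod>r\<in>UNIV. \<Prod>s\<in>UNIV. fact (tri_count bs rs ss b r s))"

definition \<eta>_elem ::
  "('k::comm_ring_1 \<Rightarrow> 'a::{ring,monoid_mult} \<Rightarrow> 'a) \<Rightarrow> (bit \<Rightarrow> 'a set) \<Rightarrow> 'a set \<Rightarrow> nat \<Rightarrow>
    'a list \<Rightarrow> 'n list \<Rightarrow> 'n list \<Rightarrow> (('a^'n^'n) list \<Rightarrow>\<^sub>0 'k) set" where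
  "\<eta>_elem scl gr Bc d b r s =
     of_nat (tri_fact Bc b r s) \<odot>\<^bsub>mat_tensor scl gr d\<^esub> \<xi>_elem scl gr d b r s"

definition T_alg ::
  "('k::comm_ring_1 \<Rightarrow> 'a::{ring,monoid_mult} \<Rightarrow> 'a) \<Rightarrow> (bit \<Rightarrow> 'a set) \<Rightarrow>
    'a set \<Rightarrow> 'a set \<Rightarrow> 'a set \<Rightarrow> nat \<Rightarrow> (('a^'n^'n) list \<Rightarrow>\<^sub>0 'k) set set" where
  "T_alg scl gr Ba Bc B1 d = module_span (mat_tensor scl gr d)
     {\<eta>_elem scl gr Bc d b r s |b r s. (b, r, s) \<in> Tri gr (Ba \<union> Bc \<union> B1) d}"

definition insertion_sum ::
  "('k::comm_ring_1 \<Rightarrow> 'a::{ring,monoid_mult} \<Rightarrow> 'a) \<Rightarrow> (bit \<Rightarrow> 'a set) \<Rightarrow> nat \<Rightarrow>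
    'a^'n^'n \<Rightarrow> (('a^'n^'n) list \<Rightarrow>\<^sub>0 'k) set" where
  "insertion_sum scl gr d X =
     (\<Oplus>\<^bsub>mat_tensor scl gr d\<^esub>e\<in>{..<d}.
        pure_tensor (mat_scale scl) (replicate (d - 1 - e) (mat 1) @ [X] @ replicate e (mat 1)))"

end

theory Submission
  imports Defs "HOL-Combinatorics.Multiset_Permutations"
begin

text \<open>Put \<open>V = M\<^sub>n(A)\<close> and \<open>V\<^sub>a = M\<^sub>n(\<aa>)\<close>. Let \<open>U\<^sub>m\<close> be the set of the tensors in
  \<open>V\<^sub>a\<^bsup>\<otimes>m\<^esup> \<otimes> V\<^bsup>\<otimes>(d-m)\<^esup>\<close> that are invariant under the symmetric group of the first \<open>m\<close> slots. Up
  to sign, an \<open>\<eta>\<close> whose word has \<open>m\<close> letters from the basis of \<open>V\<^sub>a\<close> is the transfer to the full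
  symmetric group of an element of \<open>U\<^sub>m\<close>. As tensor powers are torsion free, this may be checked
  after multiplication by an integer, and then it is an identity between full symmetrisations of
  words. So the span of the \<open>\<eta>\<close> is the sum of the transfers of the \<open>U\<^sub>m\<close>.

  Multiplication by an invariant commutes with transfer. Hence this sum is stable under left
  multiplication by \<open>U\<^sub>d\<close> and by the sum \<open>D(v)\<close> of all insertions of \<open>v\<close> into \<open>1 \<otimes> \<dots> \<otimes> 1\<close>: the
  insertions into slots beyond \<open>m\<close> preserve \<open>U\<^sub>m\<close>, and the others together are a transfer from
  \<open>m - 1\<close> to \<open>m\<close> slots.

  Conversely, multiplying the transfer of \<open>1\<^bsup>\<otimes>m\<^esup> \<otimes> v\<^sub>1 \<otimes> \<dots>\<close> by \<open>D(v)\<close> gives the transfer of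
  \<open>1\<^bsup>\<otimes>(m-1)\<^esup> \<otimes> v \<otimes> v\<^sub>1 \<otimes> \<dots>\<close> up to terms that still begin with \<open>m\<close> units. This generates all
  transfers of tensors beginning with units. Multiplying these by the orbit sums in \<open>U\<^sub>d\<close> of the
  words over \<open>V\<^sub>a\<close> extended by a formal letter for the unit generates the remaining ones, by
  induction on the number of letters that are not formal units.\<close>

section \<open>Koszul and permutation signs\<close>

text \<open>Products of two \<open>eta\<close> are never computed, since a product formula would
  entangle signs with multiplicities. Instead, every submodule that is closed under products and
  contains the generators is shown to contain \<open>eta_span\<close>, before
  \<open>eta_span\<close> is known to be closed itself. Applied to the left multipliers of
  \<open>eta_span\<close> this gives closure, so that stability under left multiplication by the
  generators suffices; applied to an arbitrary subalgebra it gives minimality.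

  The letters over \<open>\<aa>\<close> are singled out because they are even: the symmetric group
  of the first \<open>m\<close> slots rearranges them without signs, and invariance just means that
  coefficients are constant along rearrangements. The transfer treats all other letters as if they
  were pairwise distinct, which is the origin of the factor \<open>tri_fact Bc\<close> in
  \<open>\<eta>_elem\<close>.

  Classes of the tensor power are replaced by normal forms with respect to a homogeneous basis,
  whose coordinates make the cancellation of integers possible. Matrices enter only at the
  end.\<close>

declare add_bit_eq_xor [simp del]

abbreviation pinv :: "('a \<Rightarrow> 'b) \<Rightarrow> 'b \<Rightarrow> 'a" where
  "pinv f \<equiv> inv_into UNIV f"

text \<open>The sign is bimultiplicative in the parities. With signs written as products of it over
  pairs of slots, instead of powers with a cardinality as exponent, each sign identity can be
  checked pair by pair.\<close>

definition swap_sign :: "bit \<Rightarrow> bit \<Rightarrow> 'k::comm_ring_1" where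
  "swap_sign a b = (if a = 1 \<and> b = 1 then -1 else 1)"

lemma swap_sign_commute: "swap_sign a b = swap_sign b a"
  by (simp add: swap_sign_def)

lemma swap_sign_add_left: "swap_sign (a + b) c = swap_sign a c * swap_sign b c"
  by (cases a; cases b) (auto simp: swap_sign_def)

lemma swap_sign_add_right: "swap_sign a (b + c) = swap_sign a b * swap_sign a c"
  by (cases b; cases c) (auto simp: swap_sign_def)

definition pairs :: "nat \<Rightarrow> (nat \<times> nat) set" where
  "pairs d = {(i, j). i < j \<and> j < d}"

lemma finite_pairs [simp]: "finite (pairs d)"
  by (rule finite_subset[of _ "{..<d} \<times> {..<d}"]) (auto simp: pairs_def)

lemma minus_one_power_card:
  assumes "finite A"
  shows "(-1::'k::comm_ring_1) ^ card {x \<in> A. P x} = (\<Prod>x\<in>A. if P x then -1 else 1)"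
  using assms by (simp add: prod.If_cases Collect_conj_eq Int_commute)

lemma koszul_sign_prod:
  "koszul_sign e f = (\<Prod>(i, j)\<in>pairs (length e). swap_sign (e ! j) (f ! i))"
proof -
  have "{(i, j). i < j \<and> j < length e \<and> e ! j = 1 \<and> f ! i = 1} =
      {x \<in> pairs (length e). e ! snd x = 1 \<and> f ! fst x = 1}"
    by (auto simp: pairs_def)
  then show ?thesis
    unfolding koszul_sign_def
    by (simp add: minus_one_power_card swap_sign_def split_def)
qed

lemma permute_sign_prod:
  "permute_sign \<sigma> e = (\<Prod>(k, l)\<in>pairs (length e).
     if pinv \<sigma> k > pinv \<sigma> l then swap_sign (e ! k) (e ! l) else 1)"
proof -
  have "{(k, l). k < l \<and> l < length e \<and> pinv \<sigma> k > pinv \<sigma> l \<and> e ! k = 1 \<and> e ! l = 1} =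
      {x \<in> pairs (length e). pinv \<sigma> (fst x) > pinv \<sigma> (snd x) \<and> e ! fst x = 1 \<and> e ! snd x = 1}"
    by (auto simp: pairs_def)
  then show ?thesis
    unfolding permute_sign_def
    by (simp add: minus_one_power_card swap_sign_def split_def if_distrib cong: if_cong)
       (rule prod.cong, auto)
qed

text \<open>A permutation acts on two-element sets of slots. The map \<open>?s\<close> sorts the
  image pair, and the symmetry of \<open>h\<close> makes the sorting harmless.\<close>

lemma prod_pairs_permute:
  fixes h :: "nat \<Rightarrow> nat \<Rightarrow> 'k::comm_monoid_mult"
  assumes \<sigma>: "\<sigma> permutes {..<d}" and sym: "\<And>i j. i \<noteq> j \<Longrightarrow> h i j = h j i"
  shows "(\<Prod>(i, j)\<in>pairs d. h (\<sigma> i) (\<sigma> j)) = (\<Prod>(i, j)\<in>pairs d. h i j)"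
proof -
  let ?s = "\<lambda>\<tau> (i, j). (min (\<tau> i) (\<tau> j), max (\<tau> i) (\<tau> j))"
  have inv: "pinv \<sigma> permutes {..<d}" using \<sigma> by (rule permutes_inv)
  have lt: "\<tau> i < d" if "\<tau> permutes {..<d}" "i < d" for \<tau> i
    using permutes_in_image[OF that(1), of i] that(2) by simp
  have ne: "\<tau> i \<noteq> \<tau> j" if "\<tau> permutes {..<d}" "i < j" for \<tau> i j
    using permutes_inj[OF that(1)] that(2) by (auto dest: injD)
  have ii: "pinv \<sigma> (\<sigma> i) = i" "\<sigma> (pinv \<sigma> i) = i" for i
    using permutes_inverses[OF \<sigma>] by auto
  have mem: "?s \<tau> p \<in> pairs d" if "\<tau> permutes {..<d}" "p \<in> pairs d" for \<tau> p
  proof -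
    obtain i j where [simp]: "p = (i, j)" by (cases p)
    have ij: "i < j" "j < d" using that(2) by (simp_all add: pairs_def)
    then have "\<tau> i < d" "\<tau> j < d" "\<tau> i \<noteq> \<tau> j"
      using lt[OF that(1)] ne[OF that(1)] by auto
    then show ?thesis by (simp add: pairs_def min_def max_def)
  qed
  show ?thesis
  proof (rule prod.reindex_bij_witness[where i = "?s (pinv \<sigma>)" and j = "?s \<sigma>"])
    fix p assume p: "p \<in> pairs d"
    show "?s (pinv \<sigma>) (?s \<sigma> p) = p"
      using p by (auto simp: pairs_def min_def max_def ii)
    show "?s \<sigma> (?s (pinv \<sigma>) p) = p"
      using p by (auto simp: pairs_def min_def max_def ii)
    show "?s \<sigma> p \<in> pairs d" by (rule mem[OF \<sigma> p])
    show "?s (pinv \<sigma>) p \<in> pairs d" by (rule mem[OF inv p])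
    show "(case ?s \<sigma> p of (i, j) \<Rightarrow> h i j) = (case p of (i, j) \<Rightarrow> h (\<sigma> i) (\<sigma> j))"
    proof -
      obtain i j where [simp]: "p = (i, j)" by (cases p)
      have "i < j" using p by (simp add: pairs_def)
      from ne[OF \<sigma> this] show ?thesis
        by (cases "\<sigma> i \<le> \<sigma> j") (simp_all add: min_def max_def sym)
    qed
  qed
qed

lemma koszul_sign_add_left:
  assumes "length e = length e'"
  shows "koszul_sign (map2 (+) e e') f = koszul_sign e f * koszul_sign e' f"
  unfolding koszul_sign_prod using assms
  by (auto simp: prod.distrib[symmetric] swap_sign_add_left pairs_def intro!: prod.cong)

lemma koszul_sign_add_right:
  assumes "length e = length f" "length f = length f'"
  shows "koszul_sign e (map2 (+) f f') = koszul_sign e f * koszul_sign e f'"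
  unfolding koszul_sign_prod using assms
  by (auto simp: prod.distrib[symmetric] swap_sign_add_right pairs_def intro!: prod.cong)

text \<open>A pair is out of order for the composite exactly when just one of the two stages
  reverses it; a pair reversed twice contributes a square, which is 1. This cocycle identity makes
  the signed action a right action.\<close>

lemma permute_sign_compose:
  assumes \<sigma>: "\<sigma> permutes {..<length e}" and \<tau>: "\<tau> permutes {..<length e}"
  shows "permute_sign (\<sigma> \<circ> \<tau>) e = permute_sign \<sigma> e * permute_sign \<tau> (permute_list \<sigma> e)"
proof -
  \<comment> \<open>The comparison by \<open>\<noteq>\<close> says that \<open>\<tau>\<close>
    reverses the pair without assuming \<open>k < l\<close>, so \<open>h\<close> is symmetric and
    its product can be reindexed by the inverse of \<open>\<sigma>\<close>.\<close>
  define h where "h k l = (if (k < l) \<noteq> (pinv \<tau> k < pinv \<tau> l) then swap_sign (e ! \<sigma> k) (e ! \<sigma> l) else 1 :: 'a)"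
    for k l
  have inj: "pinv \<tau> k = pinv \<tau> l \<longleftrightarrow> k = l" "pinv \<sigma> k = pinv \<sigma> l \<longleftrightarrow> k = l" for k l
    using permutes_inj[OF permutes_inv[OF \<tau>]] permutes_inj[OF permutes_inv[OF \<sigma>]] by (auto dest: injD)
  have "permute_sign \<tau> (permute_list \<sigma> e) = (\<Prod>(k, l)\<in>pairs (length e). h k l)"
    unfolding permute_sign_prod length_permute_list
  proof (rule prod.cong[OF refl], clarify)
    fix k l assume "(k, l) \<in> pairs (length e)"
    then have "k < l" "l < length e" by (simp_all add: pairs_def)
    moreover from this have "pinv \<tau> k \<noteq> pinv \<tau> l" by (auto simp: inj)
    ultimately show "(if pinv \<tau> l < pinv \<tau> k then swap_sign (permute_list \<sigma> e ! k) (permute_list \<sigma> e ! l) else 1) = h k l"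
      by (auto simp: h_def permute_list_nth[OF \<sigma>])
  qed
  also have "\<dots> = (\<Prod>(k, l)\<in>pairs (length e). h (pinv \<sigma> k) (pinv \<sigma> l))"
  proof (rule prod_pairs_permute[symmetric, OF permutes_inv[OF \<sigma>]])
    fix k l :: nat assume "k \<noteq> l"
    then have "pinv \<tau> k < pinv \<tau> l \<longleftrightarrow> \<not> pinv \<tau> l < pinv \<tau> k" "k < l \<longleftrightarrow> \<not> l < k"
      using inj(1)[of k l] by linarith+
    then show "h k l = h l k"
      unfolding h_def swap_sign_commute[of "e ! \<sigma> k"] by simp
  qed
  finally have *: "permute_sign \<tau> (permute_list \<sigma> e) =
    (\<Prod>(k, l)\<in>pairs (length e). h (pinv \<sigma> k) (pinv \<sigma> l))" .
  have sq: "swap_sign a b * swap_sign a b = (1::'a)" for a b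
    by (simp add: swap_sign_def)
  have ic: "pinv (\<sigma> \<circ> \<tau>) = pinv \<tau> \<circ> pinv \<sigma>"
    using \<sigma> \<tau> by (simp add: o_inv_distrib permutes_bij)
  show ?thesis
    unfolding * permute_sign_prod[of "\<sigma> \<circ> \<tau>"] permute_sign_prod[of \<sigma>] prod.distrib[symmetric]
  proof (rule prod.cong[OF refl], clarify)
    fix k l assume "(k, l) \<in> pairs (length e)"
    then have "k < l" by (simp add: pairs_def)
    then have "pinv \<sigma> k \<noteq> pinv \<sigma> l" "pinv \<tau> (pinv \<sigma> k) \<noteq> pinv \<tau> (pinv \<sigma> l)" by (auto simp: inj)
    then show "(if pinv (\<sigma> \<circ> \<tau>) l < pinv (\<sigma> \<circ> \<tau>) k then swap_sign (e ! k) (e ! l) else 1) =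
       (if pinv \<sigma> l < pinv \<sigma> k then swap_sign (e ! k) (e ! l) else 1) * h (pinv \<sigma> k) (pinv \<sigma> l)"
      by (auto simp: h_def ic permutes_inverses[OF \<sigma>] sq)
  qed
qed

text \<open>For a pair reversed by \<open>\<sigma>\<close>, expanding the sums of parities gives two
  cross terms: one cancels the old Koszul factor, the other is the new one. This identity makes the
  action multiplicative.\<close>

lemma permute_sign_add:
  assumes \<sigma>: "\<sigma> permutes {..<length e}" and len: "length f = length e"
  shows "permute_sign \<sigma> (map2 (+) e f) * koszul_sign e f =
    koszul_sign (permute_list \<sigma> e) (permute_list \<sigma> f) * permute_sign \<sigma> e * (permute_sign \<sigma> f :: 'k::comm_ring_1)"
proof -
  \<comment> \<open>The Koszul factor of the original slots \<open>k\<close> and \<open>l\<close>,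
    in the order in which \<open>\<sigma>\<close> leaves them.\<close>
  define H where "H k l = (if pinv \<sigma> k < pinv \<sigma> l then swap_sign (e ! l) (f ! k) else swap_sign (e ! k) (f ! l) :: 'k)"
    for k l
  have inj: "pinv \<sigma> k = pinv \<sigma> l \<longleftrightarrow> k = l" for k l
    using permutes_inj[OF permutes_inv[OF \<sigma>]] by (auto dest: injD)
  have "koszul_sign (permute_list \<sigma> e) (permute_list \<sigma> f) = (\<Prod>(i, j)\<in>pairs (length e). H (\<sigma> i) (\<sigma> j))"
    unfolding koszul_sign_prod length_permute_list using \<sigma> len
    by (intro prod.cong) (auto simp: pairs_def H_def permute_list_nth permutes_inverses)
  also have "\<dots> = (\<Prod>(i, j)\<in>pairs (length e). H i j)"
  proof (rule prod_pairs_permute[OF \<sigma>])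
    fix k l :: nat assume "k \<noteq> l"
    then have "pinv \<sigma> k < pinv \<sigma> l \<longleftrightarrow> \<not> pinv \<sigma> l < pinv \<sigma> k"
      using inj[of k l] by linarith
    then show "H k l = H l k"
      by (simp add: H_def)
  qed
  finally have *: "koszul_sign (permute_list \<sigma> e) (permute_list \<sigma> f) = (\<Prod>(i, j)\<in>pairs (length e). H i j)" .
  have sq: "swap_sign a b * swap_sign a b = (1::'k)" "swap_sign a b * (swap_sign a b * c) = (c::'k)" for a b c
    by (simp_all add: swap_sign_def)
  have "permute_sign \<sigma> (map2 (+) e f) * koszul_sign e f =
     (\<Prod>x\<in>pairs (length e). (case x of (k, l) \<Rightarrow> if pinv \<sigma> l < pinv \<sigma> k then swap_sign (map2 (+) e f ! k) (map2 (+) e f ! l) else (1::'k)) *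
         (case x of (i, j) \<Rightarrow> swap_sign (e ! j) (f ! i)))"
    by (simp add: permute_sign_prod koszul_sign_prod prod.distrib len)
  also have "\<dots> = (\<Prod>x\<in>pairs (length e). (case x of (i, j) \<Rightarrow> H i j) *
       (case x of (k, l) \<Rightarrow> if pinv \<sigma> l < pinv \<sigma> k then swap_sign (e ! k) (e ! l) else 1) *
       (case x of (k, l) \<Rightarrow> if pinv \<sigma> l < pinv \<sigma> k then swap_sign (f ! k) (f ! l) else 1))"
  proof (rule prod.cong[OF refl])
    fix x assume x: "x \<in> pairs (length e)"
    obtain k l where [simp]: "x = (k, l)" by (cases x)
    have "k < l" "l < length e" using x by (auto simp: pairs_def)
    then have "pinv \<sigma> k \<noteq> pinv \<sigma> l" "k < length e" by (auto simp: inj)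
    with \<open>l < length e\<close> show "(case x of (k, l) \<Rightarrow> if pinv \<sigma> l < pinv \<sigma> k then swap_sign (map2 (+) e f ! k) (map2 (+) e f ! l) else 1) *
         (case x of (i, j) \<Rightarrow> swap_sign (e ! j) (f ! i)) =
       (case x of (i, j) \<Rightarrow> H i j) *
       (case x of (k, l) \<Rightarrow> if pinv \<sigma> l < pinv \<sigma> k then swap_sign (e ! k) (e ! l) else 1) *
       (case x of (k, l) \<Rightarrow> if pinv \<sigma> l < pinv \<sigma> k then swap_sign (f ! k) (f ! l) else 1)"
      by (auto simp: H_def len swap_sign_add_left swap_sign_add_right sq swap_sign_commute mult_ac)
  qed
  also have "\<dots> = koszul_sign (permute_list \<sigma> e) (permute_list \<sigma> f) * permute_sign \<sigma> e * permute_sign \<sigma> f"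
    by (simp add: * permute_sign_prod prod.distrib len)
  finally show ?thesis .
qed

text \<open>Composition with a permutation taking \<open>ys\<close> to \<open>zs\<close> maps one
  fibre bijectively onto the other, so all rearrangements of \<open>xs\<close> have fibres of the
  same size. This size is the order of the group divided by the multinomial number of
  rearrangements.\<close>

lemma card_permute_list_fibre:
  assumes "mset ys = mset xs"
  shows "card {\<sigma>. \<sigma> permutes {..<length xs} \<and> permute_list \<sigma> xs = ys} =
    (\<Prod>x\<in>set xs. fact (count (mset xs) x))"
proof -
  let ?d = "length xs"
  define F where "F zs = {\<sigma>. \<sigma> permutes {..<?d} \<and> permute_list \<sigma> xs = zs}" for zs
  let ?P = "permutations_of_multiset (mset xs)"
  have fin: "finite {\<sigma>. \<sigma> permutes {..<?d}}" by (rule finite_permutations) simp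
  have eq: "card (F zs) = card (F ys)" if zs: "mset zs = mset xs" for zs
  proof -
    obtain \<pi> where \<pi>: "\<pi> permutes {..<length ys}" "permute_list \<pi> ys = zs"
      using mset_eq_permutation zs assms by metis
    have len: "length ys = ?d" "length zs = ?d" using assms zs mset_eq_length by metis+
    have [simp]: "\<pi> permutes {..<?d}" using \<pi> len by simp
    have *: "permute_list (pinv \<pi>) zs = ys"
    proof -
      have "permute_list (pinv \<pi>) zs = permute_list (\<pi> \<circ> pinv \<pi>) ys"
        unfolding \<pi>(2)[symmetric] by (rule permute_list_compose[symmetric]) (use \<pi> in \<open>auto intro: permutes_inv\<close>)
      also have "\<dots> = ys" using permutes_inv_o[OF \<pi>(1)] by simp
      finally show ?thesis .
    qed
    have "bij_betw (\<lambda>\<sigma>. \<sigma> \<circ> \<pi>) (F ys) (F zs)"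
    proof (rule bij_betw_byWitness[where f' = "\<lambda>\<sigma>. \<sigma> \<circ> pinv \<pi>"])
      show "\<forall>\<sigma>\<in>F ys. \<sigma> \<circ> \<pi> \<circ> pinv \<pi> = \<sigma>" "\<forall>\<sigma>\<in>F zs. \<sigma> \<circ> pinv \<pi> \<circ> \<pi> = \<sigma>"
        using permutes_inv_o[OF \<pi>(1)] by (simp_all add: comp_assoc)
      show "(\<lambda>\<sigma>. \<sigma> \<circ> \<pi>) ` F ys \<subseteq> F zs"
        using \<pi>(2) by (auto simp: F_def permute_list_compose intro: permutes_compose)
      show "(\<lambda>\<sigma>. \<sigma> \<circ> pinv \<pi>) ` F zs \<subseteq> F ys"
        using * by (auto simp: F_def permute_list_compose permutes_inv intro: permutes_compose)
    qed
    then show ?thesis by (simp add: bij_betw_same_card)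
  qed
  have "fact ?d = card {\<sigma>. \<sigma> permutes {..<?d}}" using card_permutations[of "{..<?d}" ?d] by simp
  also have "{\<sigma>. \<sigma> permutes {..<?d}} = (\<Union>zs\<in>?P. F zs)"
    by (auto simp: F_def permutations_of_multiset_def)
  also have "card \<dots> = (\<Sum>zs\<in>?P. card (F zs))"
    by (rule card_UN_disjoint) (auto simp: F_def intro: finite_subset[OF _ fin])
  also have "\<dots> = (\<Sum>zs\<in>?P. card (F ys))"
    by (rule sum.cong) (auto intro: eq simp: permutations_of_multiset_def)
  finally have 1: "card ?P * card (F ys) = fact ?d" by simp
  have "card ?P * (\<Prod>x\<in>set xs. fact (count (mset xs) x)) = fact ?d"
    using card_permutations_of_multiset(1)[of "mset xs"] card_permutations_of_multiset(2)[of "mset xs"]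
    by simp
  with 1 have "card ?P * card (F ys) = card ?P * (\<Prod>x\<in>set xs. fact (count (mset xs) x))" by simp
  moreover have "card ?P \<noteq> 0" by simp
  ultimately show ?thesis unfolding F_def using mult_left_cancel by blast
qed


section \<open>Multilinear maps on the free module of tuples\<close>

lemma lookup_free_scale [simp]:
  "Poly_Mapping.lookup (free_scale c p) x = c * Poly_Mapping.lookup p x"
  by (simp add: free_scale_def Poly_Mapping.map.rep_eq when_def)

interpretation free: Modules.module "free_scale :: 'k::comm_ring_1 \<Rightarrow> ('x \<Rightarrow>\<^sub>0 'k) \<Rightarrow> ('x \<Rightarrow>\<^sub>0 'k)"
  by unfold_locales (auto intro!: poly_mapping_eqI simp: lookup_add algebra_simps)

lemma free_scale_single [simp]: "free_scale c (Poly_Mapping.single x b) = Poly_Mapping.single x (c * b)"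
  by (rule poly_mapping_eqI) (simp add: lookup_single when_def)

lemma lin_ext_superset:
  assumes "finite S" "Poly_Mapping.keys p \<subseteq> S"
  shows "lin_ext f p = (\<Sum>x\<in>S. free_scale (Poly_Mapping.lookup p x) (f x))"
  unfolding lin_ext_def using assms
  by (intro sum.mono_neutral_left) (auto simp: in_keys_iff)

lemma lin_ext_add: "lin_ext f (p + q) = lin_ext f p + lin_ext f q"
proof -
  let ?S = "Poly_Mapping.keys p \<union> Poly_Mapping.keys q"
  have "Poly_Mapping.keys (p + q) \<subseteq> ?S" by (rule Poly_Mapping.keys_add)
  then show ?thesis
    by (simp add: lin_ext_superset[of ?S] lookup_add free.scale_left_distrib sum.distrib)
qed

lemma lin_ext_scale: "lin_ext f (free_scale c p) = free_scale c (lin_ext f p)"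
proof -
  have "Poly_Mapping.keys (free_scale c p) \<subseteq> Poly_Mapping.keys p" by (auto simp: in_keys_iff)
  then show ?thesis
    by (simp add: lin_ext_superset[of "Poly_Mapping.keys p"] free.scale_sum_right)
qed

lemma module_hom_lin_ext: "module_hom free_scale free_scale (lin_ext f)"
  by unfold_locales (auto simp: lin_ext_add lin_ext_scale)

lemmas lin_ext_diff = module_hom.diff[OF module_hom_lin_ext]

lemma lin_ext_single [simp]: "lin_ext f (Poly_Mapping.single x c) = free_scale c (f x)"
  by (cases "c = 0") (simp_all add: lin_ext_def)

lemma lin_ext_hom:
  assumes "module_hom free_scale free_scale g"
  shows "g (lin_ext f p) = lin_ext (\<lambda>x. g (f x)) p"
  by (simp add: lin_ext_def module_hom.sum[OF assms] module_hom.scale[OF assms])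

lemma lin_ext_fun_add: "lin_ext (\<lambda>x. f x + g x) p = lin_ext f p + lin_ext g p"
  by (simp add: lin_ext_def free.scale_right_distrib sum.distrib)

lemma lin_ext_fun_scale: "lin_ext (\<lambda>x. free_scale c (f x)) p = free_scale c (lin_ext f p)"
  by (simp add: lin_ext_def free.scale_sum_right mult.commute)

lemma lin_ext_cong: "(\<And>x. x \<in> Poly_Mapping.keys p \<Longrightarrow> f x = g x) \<Longrightarrow> lin_ext f p = lin_ext g p"
  by (simp add: lin_ext_def)

lemma lin_ext_single_id: "lin_ext (\<lambda>x. Poly_Mapping.single x 1) p = p"
  by (rule poly_mapping_eqI)
     (auto simp: lin_ext_def lookup_sum lookup_single when_def sum.delta' in_keys_iff cong: if_cong)

text \<open>Only tuples of length \<open>d\<close> are constrained, because the length of a list is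
  not part of its type.\<close>

definition multilinear ::
  "('k::comm_ring_1 \<Rightarrow> 'v::ab_group_add \<Rightarrow> 'v) \<Rightarrow> nat \<Rightarrow> ('v list \<Rightarrow> ('y \<Rightarrow>\<^sub>0 'k)) \<Rightarrow> bool" where
  "multilinear scl d f \<longleftrightarrow>
     (\<forall>us x y ws. length (us @ x # ws) = d \<longrightarrow> f (us @ (x + y) # ws) = f (us @ x # ws) + f (us @ y # ws)) \<and>
     (\<forall>us c x ws. length (us @ x # ws) = d \<longrightarrow> f (us @ scl c x # ws) = free_scale c (f (us @ x # ws)))"

lemma multilinear_add:
  "multilinear scl d f \<Longrightarrow> length (us @ x # ws) = d \<Longrightarrow> f (us @ (x + y) # ws) = f (us @ x # ws) + f (us @ y # ws)"
  unfolding multilinear_def by blast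

lemma multilinear_scale:
  "multilinear scl d f \<Longrightarrow> length (us @ x # ws) = d \<Longrightarrow> f (us @ scl c x # ws) = free_scale c (f (us @ x # ws))"
  unfolding multilinear_def by blast

lemma multilinear_cong:
  "(\<And>xs. length xs = d \<Longrightarrow> f xs = g xs) \<Longrightarrow> multilinear scl d f = multilinear scl d g"
  unfolding multilinear_def by (auto split: if_splits)

lemma multilinear_sum:
  "(\<And>i. i \<in> I \<Longrightarrow> multilinear scl d (f i)) \<Longrightarrow> multilinear scl d (\<lambda>xs. \<Sum>i\<in>I. f i xs)"
  unfolding multilinear_def by (auto simp: sum.distrib free.scale_sum_right intro!: sum.cong)

lemma multilinear_hom:
  "module_hom free_scale free_scale g \<Longrightarrow> multilinear scl d f \<Longrightarrow> multilinear scl d (\<lambda>xs. g (f xs))"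
  unfolding multilinear_def by (auto simp: module_hom.add module_hom.scale)

lemma multilinear_lin_ext:
  assumes "\<And>x. x \<in> Poly_Mapping.keys p \<Longrightarrow> multilinear scl d (\<lambda>xs. f xs x)"
  shows "multilinear scl d (\<lambda>xs. lin_ext (f xs) p)"
  unfolding lin_ext_def using assms
  by (intro multilinear_sum multilinear_hom[OF free.module_hom_scale_self])

text \<open>The universal property of the tensor power: a multilinear map kills both kinds of
  generating relations, hence its linear extension is well defined on classes.\<close>

lemma lin_ext_relations:
  assumes f: "multilinear scl d f" and "p \<in> multilinear_relations scl d"
  shows "lin_ext f p = 0"
proof (rule module_hom.eq_0_on_span[OF module_hom_lin_ext[of f] _ assms(2)[unfolded multilinear_relations_def]])
  fix q
  assume "q \<in> {Poly_Mapping.single (us @ (x + y) # ws) 1 - Poly_Mapping.single (us @ x # ws) 1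
         - Poly_Mapping.single (us @ y # ws) 1 |us x y ws. length (us @ x # ws) = d}
      \<union> {Poly_Mapping.single (us @ scl c x # ws) 1 - Poly_Mapping.single (us @ x # ws) c
         |us c x ws. length (us @ x # ws) = d}"
  then show "lin_ext f q = 0"
  proof
    assume "q \<in> {Poly_Mapping.single (us @ (x + y) # ws) 1 - Poly_Mapping.single (us @ x # ws) 1
         - Poly_Mapping.single (us @ y # ws) 1 |us x y ws. length (us @ x # ws) = d}"
    then show ?thesis
      using multilinear_add[OF f] by (auto simp: lin_ext_diff)
  next
    assume "q \<in> {Poly_Mapping.single (us @ scl c x # ws) 1 - Poly_Mapping.single (us @ x # ws) c
         |us c x ws. length (us @ x # ws) = d}"
    then show ?thesis
      using multilinear_scale[OF f] by (auto simp: lin_ext_diff)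
  qed
qed

lemma list_split_at: "i < length xs \<Longrightarrow> xs = take i xs @ xs ! i # drop (Suc i) xs"
  by (simp add: id_take_nth_drop)

lemma multilinear_update_add:
  assumes "multilinear scl d f" "length xs = d" "i < d"
  shows "f (xs[i := x + y]) = f (xs[i := x]) + f (xs[i := y])"
  using multilinear_add[OF assms(1), of "take i xs" x "drop (Suc i) xs" y] assms
  by (simp add: upd_conv_take_nth_drop)

lemma multilinear_update_scale:
  assumes "multilinear scl d f" "length xs = d" "i < d"
  shows "f (xs[i := scl c x]) = free_scale c (f (xs[i := x]))"
  using multilinear_scale[OF assms(1), of "take i xs" x "drop (Suc i) xs" c] assms
  by (simp add: upd_conv_take_nth_drop)

lemma permute_list_update:
  assumes "\<sigma> permutes {..<length xs}" "i < length xs"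
  shows "permute_list \<sigma> (xs[i := x]) = (permute_list \<sigma> xs)[pinv \<sigma> i := x]"
proof (rule nth_equalityI)
  fix j assume "j < length (permute_list \<sigma> (xs[i := x]))"
  then have j: "j < length xs" by simp
  then have "\<sigma> j < length xs" using permutes_in_image[OF assms(1), of j] by simp
  moreover have "pinv \<sigma> i = j \<longleftrightarrow> \<sigma> j = i" using permutes_inv_eq[OF assms(1)] by blast
  ultimately show "permute_list \<sigma> (xs[i := x]) ! j = (permute_list \<sigma> xs)[pinv \<sigma> i := x] ! j"
    using assms j by (cases "\<sigma> j = i") (simp_all add: permute_list_nth)
qed simp

section \<open>Multilinear maps tested on generators of the slots\<close>

context superalgebra
begin

lemma multilinear_zero:
  assumes "multilinear scl d f" "length (us @ x # ws) = d"
  shows "f (us @ 0 # ws) = 0"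
  using multilinear_scale[OF assms, of 0] by simp

lemma multilinear_zero_mem:
  assumes "multilinear scl d f" "length xs = d" "0 \<in> set xs"
  shows "f xs = 0"
  using split_list[OF assms(3)] multilinear_zero[OF assms(1)] assms(2) by auto

lemma multilinear_map2:
  assumes f: "multilinear scl d f" and g: "\<And>a. a \<in> set as \<Longrightarrow> module_hom scl scl (g a)"
    and as: "length as = d"
  shows "multilinear scl d (\<lambda>xs. f (map2 g as xs))"
proof -
  have *: "\<exists>bs a cs. as = bs @ a # cs \<and> length bs = length us" if "length (us @ x # ws) = d" for us x and ws :: "'v list"
    using that as list_split_at[of "length us" as] by (metis add_Suc_right length_append length_take length_Cons less_add_Suc1 min.absorb4)
  show ?thesis unfolding multilinear_def
  proof (intro conjI allI impI)
    fix us :: "'v list" and x y ws assume len: "length (us @ x # ws) = d"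
    obtain bs a cs where as': "as = bs @ a # cs" "length bs = length us" using *[OF len] by blast
    then have "g a (x + y) = g a x + g a y" using g[of a] by (simp add: module_hom.add)
    then show "f (map2 g as (us @ (x + y) # ws)) = f (map2 g as (us @ x # ws)) + f (map2 g as (us @ y # ws))"
      using multilinear_add[OF f] as' len as by simp
  next
    fix us :: "'v list" and c x ws assume len: "length (us @ x # ws) = d"
    obtain bs a cs where as': "as = bs @ a # cs" "length bs = length us" using *[OF len] by blast
    then have "g a (scl c x) = scl c (g a x)" using g[of a] by (simp add: module_hom.scale)
    then show "f (map2 g as (us @ scl c x # ws)) = free_scale c (f (map2 g as (us @ x # ws)))"
      using multilinear_scale[OF f] as' len as by simp
  qed
qed

lemma multilinear_permute_list:
  assumes f: "multilinear scl d f" and \<sigma>: "\<sigma> permutes {..<d}"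
  shows "multilinear scl d (\<lambda>xs. f (permute_list \<sigma> xs))"
proof -
  have *: "permute_list \<sigma> (us @ x # ws) = (permute_list \<sigma> (us @ z # ws))[pinv \<sigma> (length us) := x]"
    if "length (us @ z # ws) = d" for us x z and ws :: "'v list"
    using permute_list_update[of \<sigma> "us @ z # ws" "length us" x] that \<sigma> by simp
  have i: "pinv \<sigma> (length us) < d" if "length (us @ x # ws) = d" for us x and ws :: "'v list"
    using permutes_in_image[OF permutes_inv[OF \<sigma>], of "length us"] that by simp
  show ?thesis unfolding multilinear_def
  proof (intro conjI allI impI)
    fix us :: "'v list" and x y ws assume len: "length (us @ x # ws) = d"
    show "f (permute_list \<sigma> (us @ (x + y) # ws)) = f (permute_list \<sigma> (us @ x # ws)) + f (permute_list \<sigma> (us @ y # ws))"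
      using multilinear_update_add[OF f, of "permute_list \<sigma> (us @ x # ws)" "pinv \<sigma> (length us)" x y]
      *[OF len, of "x + y"] *[OF len, of y] *[OF len, of x] len i[OF len] by simp
  next
    fix us :: "'v list" and c x ws assume len: "length (us @ x # ws) = d"
    show "f (permute_list \<sigma> (us @ scl c x # ws)) = free_scale c (f (permute_list \<sigma> (us @ x # ws)))"
      using multilinear_update_scale[OF f, of "permute_list \<sigma> (us @ x # ws)" "pinv \<sigma> (length us)" c x]
      *[OF len, of "scl c x"] *[OF len, of x] len i[OF len] by simp
  qed
qed

text \<open>Span induction carried out slot by slot: after \<open>k\<close> rounds the first
  \<open>k\<close> slots may range over spans while the others still hold generators. The generators
  may depend on the slot, as tensors with restricted initial slots require.\<close>

lemma tuple_span_induct: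
  assumes len: "length xs = d" and span: "\<And>i. i < d \<Longrightarrow> xs ! i \<in> span (T i)"
    and zero: "\<And>us ws. length us + length ws + 1 = d \<Longrightarrow> P (us @ 0 # ws)"
    and add: "\<And>us x y ws. length us + length ws + 1 = d \<Longrightarrow> P (us @ x # ws) \<Longrightarrow> P (us @ y # ws) \<Longrightarrow> P (us @ (x + y) # ws)"
    and scale: "\<And>us c x ws. length us + length ws + 1 = d \<Longrightarrow> P (us @ x # ws) \<Longrightarrow> P (us @ scl c x # ws)"
    and base: "\<And>ys. length ys = d \<Longrightarrow> (\<And>i. i < d \<Longrightarrow> ys ! i \<in> T i) \<Longrightarrow> P ys"
  shows "P xs"
proof -
  have "\<forall>xs. length xs = d \<longrightarrow> (\<forall>i<d. xs ! i \<in> (if i < k then span (T i) else T i)) \<longrightarrow> P xs"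
    if "k \<le> d" for k
    using that
  proof (induction k)
    case 0
    then show ?case using base by simp
  next
    case (Suc k)
    show ?case
    proof (intro allI impI)
      fix xs assume xs: "length xs = d" "\<forall>i<d. xs ! i \<in> (if i < Suc k then span (T i) else T i)"
      let ?u = "take k xs" and ?w = "drop (Suc k) xs"
      have len: "length ?u + length ?w + 1 = d" using Suc.prems xs by simp
      have eq: "xs = ?u @ xs ! k # ?w" using Suc.prems xs by (intro list_split_at) simp
      have "xs ! k \<in> span (T k)" using xs Suc.prems by (metis Suc_le_lessD lessI)
      then have "P (?u @ xs ! k # ?w)"
      proof (induction rule: span_induct_alt)
        case base
        then show ?case using zero[OF len] .
      next
        case (step c x y)
        have "P (?u @ x # ?w)"
        proof (rule Suc.IH[rule_format])
          show "k \<le> d" "length (?u @ x # ?w) = d" using len Suc.prems by auto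
          fix i assume "i < d"
          then show "(?u @ x # ?w) ! i \<in> (if i < k then span (T i) else T i)"
            using xs(2)[rule_format, of i] step(1) Suc.prems xs(1)
            by (cases i k rule: linorder_cases) (auto simp: nth_append nth_Cons')
        qed
        then show ?case using step(2) add[OF len] scale[OF len] by blast
      qed
      with eq show "P xs" by simp
    qed
  qed
  from this[of d] len span show ?thesis by simp
qed

lemma multilinear_in_span:
  assumes f: "multilinear scl d f" and "length xs = d" "\<And>i. i < d \<Longrightarrow> xs ! i \<in> span (T i)"
  shows "f xs \<in> free.span {f ys |ys. length ys = d \<and> (\<forall>i<d. ys ! i \<in> T i)}"
    (is "_ \<in> ?S")
proof (rule tuple_span_induct[OF assms(2,3)])
  fix us ws :: "'v list" assume len: "length us + length ws + 1 = d"
  show "f (us @ 0 # ws) \<in> ?S"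
    using multilinear_zero[OF f, of us 0 ws] len by (simp add: free.span_zero)
next
  fix us x y ws
  assume "length us + length ws + 1 = d"
    "f (us @ x # ws) \<in> ?S"
    "f (us @ y # ws) \<in> ?S"
  then show "f (us @ (x + y) # ws) \<in> ?S"
    using multilinear_add[OF f, of us x ws y] by (simp add: free.span_add)
next
  fix us c x ws
  assume "length us + length ws + 1 = d"
    "f (us @ x # ws) \<in> ?S"
  then show "f (us @ scl c x # ws) \<in> ?S"
    using multilinear_scale[OF f, of us x ws c] by (simp add: free.span_scale)
next
  fix ys assume "length ys = d" "\<And>i. i < d \<Longrightarrow> ys ! i \<in> T i"
  then show "f ys \<in> ?S"
    by (intro free.span_base) auto
qed

lemma multilinear_eqI:
  assumes f: "multilinear scl d f" and g: "multilinear scl d g"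
    and "length xs = d" "\<And>i. i < d \<Longrightarrow> xs ! i \<in> span (T i)"
    and "\<And>ys. length ys = d \<Longrightarrow> (\<And>i. i < d \<Longrightarrow> ys ! i \<in> T i) \<Longrightarrow> f ys = g ys"
  shows "f xs = g xs"
proof (rule tuple_span_induct[where P = "\<lambda>xs. f xs = g xs", OF assms(3,4)])
  fix us ws :: "'v list" assume "length us + length ws + 1 = d"
  then show "f (us @ 0 # ws) = g (us @ 0 # ws)"
    using multilinear_zero[OF f, of us 0 ws] multilinear_zero[OF g, of us 0 ws] by simp
next
  fix us x y ws
  assume "length us + length ws + 1 = d" "f (us @ x # ws) = g (us @ x # ws)" "f (us @ y # ws) = g (us @ y # ws)"
  then show "f (us @ (x + y) # ws) = g (us @ (x + y) # ws)"
    using multilinear_add[OF f, of us x ws y] multilinear_add[OF g, of us x ws y] by simp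
next
  fix us c x ws
  assume "length us + length ws + 1 = d" "f (us @ x # ws) = g (us @ x # ws)"
  then show "f (us @ scl c x # ws) = g (us @ scl c x # ws)"
    using multilinear_scale[OF f, of us x ws c] multilinear_scale[OF g, of us x ws c] by simp
next
  fix ys assume "length ys = d" "\<And>i. i < d \<Longrightarrow> ys ! i \<in> T i"
  then show "f ys = g ys" by (rule assms(5))
qed

end


section \<open>The tensor power of a superalgebra with a basis\<close>

context superalgebra
begin

lemma gr_0_Int_1: "x \<in> gr 0 \<Longrightarrow> x \<in> gr 1 \<Longrightarrow> x = 0"
proof -
  assume x: "x \<in> gr 0" "x \<in> gr 1"
  from gr_direct_sum[of x] obtain p where
    "\<And>q. fst q \<in> gr 0 \<and> snd q \<in> gr 1 \<and> x = fst q + snd q \<Longrightarrow> q = p" by (auto elim!: ex1E)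
  from this[of "(x, 0)"] this[of "(0, x)"] show "x = 0"
    using x subspace_0[OF gr_subspace] by auto
qed

lemma gr_Int: "i \<noteq> j \<Longrightarrow> x \<in> gr i \<Longrightarrow> x \<in> gr j \<Longrightarrow> x = 0"
  using gr_0_Int_1 by (cases i; cases j) auto

lemma homogeneous_part_eqI:
  assumes "y \<in> gr i" "x - y \<in> gr (i + 1)"
  shows "homogeneous_part gr i x = y"
  unfolding homogeneous_part_def
proof (rule the_equality)
  fix z assume z: "z \<in> gr i \<and> x - z \<in> gr (i + 1)"
  have "z - y \<in> gr i" using z assms subspace_diff[OF gr_subspace] by blast
  moreover have "(x - y) - (x - z) \<in> gr (i + 1)" using z assms subspace_diff[OF gr_subspace] by blast
  moreover have "i \<noteq> i + 1" by (cases i) auto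
  ultimately show "z = y" using gr_Int[of i "i + 1" "z - y"] by simp
qed (use assms in simp)

lemma homogeneous_part_mem:
  "homogeneous_part gr i x \<in> gr i" "x - homogeneous_part gr i x \<in> gr (i + 1)"
proof -
  obtain y z where yz: "y \<in> gr 0" "z \<in> gr 1" "x = y + z"
    using gr_direct_sum[of x] by (auto elim!: ex1E)
  have "\<exists>w. w \<in> gr i \<and> x - w \<in> gr (i + 1)"
    using yz by (cases i) (auto intro!: exI[of _ "if i = 0 then y else z"])
  then obtain w where "w \<in> gr i" "x - w \<in> gr (i + 1)" by blast
  with homogeneous_part_eqI[OF this]
  show "homogeneous_part gr i x \<in> gr i" "x - homogeneous_part gr i x \<in> gr (i + 1)" by simp_all
qed

lemma homogeneous_part_sum: "homogeneous_part gr 0 x + homogeneous_part gr 1 x = x"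
proof -
  have "homogeneous_part gr 1 x = x - homogeneous_part gr 0 x"
    by (rule homogeneous_part_eqI) (use homogeneous_part_mem[where i = 0 and x = x] in simp_all)
  then show ?thesis by simp
qed

lemma homogeneous_part_gr: "x \<in> gr j \<Longrightarrow> homogeneous_part gr i x = (if i = j then x else 0)"
  by (rule homogeneous_part_eqI; cases i; cases j) (auto simp: subspace_0[OF gr_subspace])

lemma module_hom_homogeneous_part: "module_hom scl scl (homogeneous_part gr i)"
proof
  fix x y c
  show "homogeneous_part gr i (x + y) = homogeneous_part gr i x + homogeneous_part gr i y"
  proof (rule homogeneous_part_eqI)
    have "(x - homogeneous_part gr i x) + (y - homogeneous_part gr i y) \<in> gr (i + 1)"
      by (intro subspace_add[OF gr_subspace] homogeneous_part_mem)
    then show "x + y - (homogeneous_part gr i x + homogeneous_part gr i y) \<in> gr (i + 1)"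
      by (simp add: algebra_simps)
  qed (intro subspace_add[OF gr_subspace] homogeneous_part_mem)
  show "homogeneous_part gr i (scl c x) = scl c (homogeneous_part gr i x)"
  proof (rule homogeneous_part_eqI)
    have "scl c (x - homogeneous_part gr i x) \<in> gr (i + 1)"
      by (intro subspace_scale[OF gr_subspace] homogeneous_part_mem)
    then show "scl c x - scl c (homogeneous_part gr i x) \<in> gr (i + 1)"
      by (simp add: scale_right_diff_distrib)
  qed (intro subspace_scale[OF gr_subspace] homogeneous_part_mem)
qed

definition homogeneous :: "bit list \<Rightarrow> 'v list \<Rightarrow> bool" where
  "homogeneous e xs \<longleftrightarrow> list_all2 (\<lambda>i x. x \<in> gr i) e xs"

lemma homogeneous_length: "homogeneous e xs \<Longrightarrow> length e = length xs"
  by (simp add: homogeneous_def list_all2_lengthD)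

lemma homogeneous_parts_same: "homogeneous e xs \<Longrightarrow> homogeneous_parts gr e xs = xs"
  by (auto simp: homogeneous_def homogeneous_parts_def list_all2_conv_all_nth homogeneous_part_gr intro!: nth_equalityI)

text \<open>A wrong parity in a single slot already makes that entry 0. Hence, on homogeneous
  tuples, only one term of the sums over parity patterns in \<open>tuple_mult\<close> and
  \<open>tuple_permute\<close> survives.\<close>

lemma homogeneous_parts_other:
  assumes "homogeneous e xs" "length e' = length e" "e' \<noteq> e"
  shows "0 \<in> set (homogeneous_parts gr e' xs)"
proof -
  obtain i where i: "i < length e" "e' ! i \<noteq> e ! i" using nth_equalityI[of e' e] assms(2,3) by auto
  have "xs ! i \<in> gr (e ! i)" and le: "length e = length xs"
    using assms(1) i(1) by (simp_all add: homogeneous_def list_all2_conv_all_nth)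
  then have z: "homogeneous_part gr (e' ! i) (xs ! i) = 0"
    using homogeneous_part_gr i(2) by metis
  have "homogeneous_parts gr e' xs ! i = 0" "i < length (homogeneous_parts gr e' xs)"
    using assms(2) i(1) le z by (simp_all add: homogeneous_parts_def)
  then show ?thesis by (metis nth_mem)
qed

lemma mul_0 [simp]: "mul 0 x = 0" "mul x 0 = 0"
  using mul_scale_left[of 0 x x] mul_scale_right[of x 0 x] by simp_all

lemma module_hom_mul_left: "module_hom scl scl (mul x)"
  by unfold_locales (simp_all add: mul_add_right mul_scale_right)

lemma module_hom_mul_right: "module_hom scl scl (\<lambda>x. mul x y)"
  by unfold_locales (simp_all add: mul_add_left mul_scale_left)

lemma zero_in_map2_mul:
  assumes "length xs = length ys" "0 \<in> set xs \<or> 0 \<in> set ys"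
  shows "0 \<in> set (map2 mul xs ys)"
proof -
  obtain i where "i < length xs" "xs ! i = 0 \<or> ys ! i = 0"
    using assms by (auto simp: in_set_conv_nth)
  then have "map2 mul xs ys ! i = 0" "i < length (map2 mul xs ys)" using assms(1) by auto
  then show ?thesis by (metis nth_mem)
qed

lemma homogeneous_map2_mul:
  "homogeneous e xs \<Longrightarrow> homogeneous f ys \<Longrightarrow> homogeneous (map2 (+) e f) (map2 mul xs ys)"
  by (auto simp: homogeneous_def list_all2_conv_all_nth gr_mul)

lemma homogeneous_permute_list:
  "homogeneous e xs \<Longrightarrow> \<sigma> permutes {..<length xs} \<Longrightarrow> homogeneous (permute_list \<sigma> e) (permute_list \<sigma> xs)"
  unfolding homogeneous_def by (metis list_all2_lengthD list_all2_permute_list_iff)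

end

text \<open>What the argument uses of the matrix superalgebra: a homogeneous basis, part of which
  spans an even subalgebra containing the unit. Matrix entries and positions are not visible at this
  level.\<close>

locale based_superalgebra = superalgebra scl mul gr
  for scl :: "'k::{idom,ring_char_0} \<Rightarrow> 'v::ab_group_add \<Rightarrow> 'v"
    and mul :: "'v \<Rightarrow> 'v \<Rightarrow> 'v"
    and gr :: "bit \<Rightarrow> 'v set" +
  fixes unit :: 'v and Ba Bc B1 :: "'v set" and d :: nat
  assumes unit_mul: "mul unit x = x" "mul x unit = x"
    and unit_mem: "unit \<in> span Ba"
    and Va_mul: "x \<in> span Ba \<Longrightarrow> y \<in> span Ba \<Longrightarrow> mul x y \<in> span Ba"
    and even: "Ba \<union> Bc \<subseteq> gr 0" and odd: "B1 \<subseteq> gr 1"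
    and disjoint: "Ba \<inter> Bc = {}"
    and independent: "independent (Ba \<union> Bc \<union> B1)"
    and spanning: "span (Ba \<union> Bc \<union> B1) = UNIV"
begin

abbreviation Va :: "'v set" where "Va \<equiv> span Ba"

abbreviation basis :: "'v set" where "basis \<equiv> Ba \<union> Bc \<union> B1"

lemma Va_even: "Va \<subseteq> gr 0"
  using even by (intro span_minimal gr_subspace) auto

lemma basis_homogeneous: "\<forall>i<length w. w ! i \<in> basis \<Longrightarrow> \<exists>e. homogeneous e w"
proof -
  assume w: "\<forall>i<length w. w ! i \<in> basis"
  have "homogeneous (map (\<lambda>x. if x \<in> gr 0 then 0 else 1) w) w"
    unfolding homogeneous_def list_all2_conv_all_nth using w even odd by auto
  then show ?thesis ..
qed

text \<open>A nonzero product of coordinates forces every letter of \<open>w\<close> into the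
  support of an entry of \<open>vs\<close>, and these supports are finite.\<close>

lemma finite_coordinates:
  "finite {w. length w = length vs \<and> prod_list (map2 (representation basis) vs w) \<noteq> 0}"
proof -
  let ?S = "\<Union>v\<in>set vs. {b. representation basis v b \<noteq> 0}"
  have "set w \<subseteq> ?S" if "length w = length vs" "prod_list (map2 (representation basis) vs w) \<noteq> 0" for w
  proof
    fix b assume "b \<in> set w"
    then obtain i where i: "i < length w" "w ! i = b" by (auto simp: in_set_conv_nth)
    then have "representation basis (vs ! i) b \<in> set (map2 (representation basis) vs w)"
      using that(1) i by (auto simp: set_zip intro!: rev_image_eqI[where x = "(vs ! i, w ! i)"])
    then have "representation basis (vs ! i) b \<noteq> 0" using that(2) by (metis prod_list_zero_iff)
    then show "b \<in> ?S" using i that(1) by auto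
  qed
  then have "{w. length w = length vs \<and> prod_list (map2 (representation basis) vs w) \<noteq> 0} \<subseteq>
      {w. set w \<subseteq> ?S \<and> length w = length vs}" by blast
  moreover have "finite ?S" using finite_representation by blast
  ultimately show ?thesis using finite_lists_length_eq finite_subset by blast
qed

text \<open>Elements of the tensor power are represented by their expansions in the basis words, so
  that equality of classes becomes equality.\<close>

lift_definition pt :: "'v list \<Rightarrow> ('v list \<Rightarrow>\<^sub>0 'k)" is
  "\<lambda>vs w. if length w = length vs then prod_list (map2 (representation basis) vs w) else 0"
  using finite_coordinates by (rule finite_subset[rotated]) auto

lemma pt_multilinear: "multilinear scl n pt"
proof -
  have rep: "representation basis (x + y) b = representation basis x b + representation basis y b"
    "representation basis (scl c x) b = c * representation basis x b" for x y b c
    using representation_add[OF independent] representation_scale[OF independent] spanning by auto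
  have *: "\<exists>bs a cs. w = bs @ a # cs \<and> length bs = length us" if "length w = length (us @ x # ws)" for us x and ws w :: "'v list"
    using that list_split_at[of "length us" w]
    by (metis add_Suc_right length_append length_take length_Cons less_add_Suc1 min.absorb4)
  show ?thesis unfolding multilinear_def
  proof (intro conjI allI impI poly_mapping_eqI)
    fix us :: "'v list" and x y ws w
    show "Poly_Mapping.lookup (pt (us @ (x + y) # ws)) w = Poly_Mapping.lookup (pt (us @ x # ws) + pt (us @ y # ws)) w"
    proof (cases "length w = length (us @ x # ws)")
      case True
      from *[OF this] obtain bs a cs where "w = bs @ a # cs" "length bs = length us" by blast
      then show ?thesis using True by (simp add: pt.rep_eq lookup_add rep algebra_simps)
    qed (simp add: pt.rep_eq lookup_add)
  next
    fix us :: "'v list" and x c ws w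
    show "Poly_Mapping.lookup (pt (us @ scl c x # ws)) w = Poly_Mapping.lookup (free_scale c (pt (us @ x # ws))) w"
    proof (cases "length w = length (us @ x # ws)")
      case True
      from *[OF this] obtain bs a cs where "w = bs @ a # cs" "length bs = length us" by blast
      then show ?thesis using True by (simp add: pt.rep_eq rep algebra_simps)
    qed (simp add: pt.rep_eq)
  qed
qed

lemma pt_basis:
  assumes "set w \<subseteq> basis"
  shows "pt w = Poly_Mapping.single w 1"
proof (rule poly_mapping_eqI)
  fix w'
  have rep: "representation basis b = (\<lambda>v. if v = b then 1 else 0)" if "b \<in> basis" for b
    using that by (rule representation_basis[OF independent])
  have "prod_list (map2 (representation basis) w w') = (if w = w' then 1 else 0)" if "length w = length w'"
    using that assms by (induction w w' rule: list_induct2) (auto simp: rep)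
  then show "Poly_Mapping.lookup (pt w) w' = Poly_Mapping.lookup (Poly_Mapping.single w 1) w'"
    by (auto simp: pt.rep_eq lookup_single when_def)
qed

lemma keys_pt: "w \<in> Poly_Mapping.keys (pt vs) \<Longrightarrow> length w = length vs \<and> set w \<subseteq> basis"
proof -
  assume "w \<in> Poly_Mapping.keys (pt vs)"
  then have *: "length w = length vs" "prod_list (map2 (representation basis) vs w) \<noteq> 0"
    by (auto simp: in_keys_iff pt.rep_eq split: if_splits)
  have "w ! i \<in> basis" if "i < length w" for i
  proof -
    have "representation basis (vs ! i) (w ! i) \<in> set (map2 (representation basis) vs w)"
      using that *(1) by (auto simp: set_zip intro!: rev_image_eqI[where x = "(vs ! i, w ! i)"])
    then have "representation basis (vs ! i) (w ! i) \<noteq> 0" using *(2) by (metis prod_list_zero_iff)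
    then show ?thesis using representation_ne_zero by blast
  qed
  then have "set w \<subseteq> basis" by (metis in_set_conv_nth subsetI)
  then show ?thesis using *(1) by simp
qed

section \<open>Normal forms modulo the multilinear relations\<close>

definition nform :: "('v list \<Rightarrow>\<^sub>0 'k) \<Rightarrow> ('v list \<Rightarrow>\<^sub>0 'k)" where
  "nform = lin_ext pt"

lemma nform_hom: "module_hom free_scale free_scale nform"
  unfolding nform_def by (rule module_hom_lin_ext)

lemma nform_single [simp]: "nform (Poly_Mapping.single vs c) = free_scale c (pt vs)"
  by (simp add: nform_def)

lemma subspace_free_tuples: "free.subspace (free_tuples d)"
proof (rule free.subspaceI)
  fix x y :: "'y list \<Rightarrow>\<^sub>0 'z::comm_ring_1" assume "x \<in> free_tuples d" "y \<in> free_tuples d"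
  then show "x + y \<in> free_tuples d"
    using Poly_Mapping.keys_add[of x y] by (auto simp: free_tuples_def)
qed (auto simp: free_tuples_def in_keys_iff)

lemma single_free_tuples [simp]: "length xs = d \<Longrightarrow> Poly_Mapping.single xs c \<in> free_tuples d"
  by (simp add: free_tuples_def)

lemma pt_free_tuples [simp]: "length xs = d \<Longrightarrow> pt xs \<in> free_tuples d"
  using keys_pt by (auto simp: free_tuples_def)

lemma nform_free_tuples: "p \<in> free_tuples d \<Longrightarrow> nform p \<in> free_tuples d"
  unfolding nform_def lin_ext_def
  by (intro free.subspace_sum[OF subspace_free_tuples] free.subspace_scale[OF subspace_free_tuples])
     (auto simp: free_tuples_def dest!: keys_pt)

lemma subspace_relations: "free.subspace (multilinear_relations scl d)"
  by (simp add: multilinear_relations_def)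

lemma nform_relation: "p \<in> multilinear_relations scl d \<Longrightarrow> nform p = 0"
  unfolding nform_def by (rule lin_ext_relations[OF pt_multilinear])

text \<open>The tuples that agree with their basis expansion modulo relations are closed under the
  linear operations in each slot and include the basis words, hence are all tuples of length
  \<open>d\<close>.\<close>

lemma single_minus_pt_relation:
  assumes "length xs = d"
  shows "Poly_Mapping.single xs 1 - pt xs \<in> multilinear_relations scl d"
proof -
  let ?R = "multilinear_relations scl d"
  note sub = subspace_relations
  have rel_add: "Poly_Mapping.single (us @ (x + y) # ws) 1 - Poly_Mapping.single (us @ x # ws) 1
         - Poly_Mapping.single (us @ y # ws) 1 \<in> ?R" if "length us + length ws + 1 = d" for us x y ws
    unfolding multilinear_relations_def
    by (rule free.span_base, rule UnI1) (use that in auto)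
  have rel_scale: "Poly_Mapping.single (us @ scl c x # ws) 1 - Poly_Mapping.single (us @ x # ws) c \<in> ?R"
    if "length us + length ws + 1 = d" for us c x ws
    unfolding multilinear_relations_def
    by (rule free.span_base, rule UnI2) (use that in auto)
  have "\<And>i. i < d \<Longrightarrow> xs ! i \<in> span ((\<lambda>_. basis) i)" using spanning by simp
  from assms this show ?thesis
  proof (rule tuple_span_induct[where P = "\<lambda>xs. Poly_Mapping.single xs 1 - pt xs \<in> ?R"])
    fix us ws :: "'v list" assume len: "length us + length ws + 1 = d"
    show "Poly_Mapping.single (us @ 0 # ws) 1 - pt (us @ 0 # ws) \<in> ?R"
      using multilinear_zero[OF pt_multilinear, of us 0 ws d] rel_scale[OF len, of 0 0] len by simp
  next
    fix us x y ws
    assume len: "length us + length ws + 1 = d"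
      and "Poly_Mapping.single (us @ x # ws) 1 - pt (us @ x # ws) \<in> ?R"
      and "Poly_Mapping.single (us @ y # ws) 1 - pt (us @ y # ws) \<in> ?R"
    then have "(Poly_Mapping.single (us @ (x + y) # ws) 1 - Poly_Mapping.single (us @ x # ws) 1
         - Poly_Mapping.single (us @ y # ws) 1) + ((Poly_Mapping.single (us @ x # ws) 1 - pt (us @ x # ws)) +
         (Poly_Mapping.single (us @ y # ws) 1 - pt (us @ y # ws))) \<in> ?R"
      by (intro free.subspace_add[OF sub] rel_add)
    then show "Poly_Mapping.single (us @ (x + y) # ws) 1 - pt (us @ (x + y) # ws) \<in> ?R"
      using multilinear_add[OF pt_multilinear[of d], of us x ws y] len by (simp add: algebra_simps)
  next
    fix us c x ws
    assume len: "length us + length ws + 1 = d"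
      and "Poly_Mapping.single (us @ x # ws) 1 - pt (us @ x # ws) \<in> ?R"
    then have "(Poly_Mapping.single (us @ scl c x # ws) 1 - Poly_Mapping.single (us @ x # ws) c) +
         free_scale c (Poly_Mapping.single (us @ x # ws) 1 - pt (us @ x # ws)) \<in> ?R"
      by (intro free.subspace_add[OF sub] free.subspace_scale[OF sub] rel_scale)
    then show "Poly_Mapping.single (us @ scl c x # ws) 1 - pt (us @ scl c x # ws) \<in> ?R"
      using multilinear_scale[OF pt_multilinear[of d], of us x ws c] len
      by (simp add: free.scale_right_diff_distrib)
  next
    fix ys assume "length ys = d" "\<And>i. i < d \<Longrightarrow> ys ! i \<in> basis"
    then have "set ys \<subseteq> basis" by (metis in_set_conv_nth subsetI)
    then show "Poly_Mapping.single ys 1 - pt ys \<in> ?R"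
      by (simp add: pt_basis free.subspace_0[OF sub])
  qed
qed

lemma minus_nform_relation:
  assumes "p \<in> free_tuples d"
  shows "p - nform p \<in> multilinear_relations scl d"
proof -
  have "p - nform p = lin_ext (\<lambda>xs. Poly_Mapping.single xs 1) p - lin_ext pt p"
    by (simp add: lin_ext_single_id nform_def)
  also have "\<dots> = (\<Sum>x\<in>Poly_Mapping.keys p. free_scale (Poly_Mapping.lookup p x) (Poly_Mapping.single x 1 - pt x))"
    by (simp add: lin_ext_def sum_subtractf free.scale_right_diff_distrib del: free_scale_single)
  also have "\<dots> \<in> multilinear_relations scl d"
    using assms by (intro free.subspace_sum[OF subspace_relations] free.subspace_scale[OF subspace_relations]
        single_minus_pt_relation) (auto simp: free_tuples_def)
  finally show ?thesis .
qed

text \<open>Reduction to normal form changes a representative only by relations, and relations have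
  normal form 0. So normal forms classify the elements of the tensor power.\<close>

lemma nform_eq_iff:
  assumes "p \<in> free_tuples d" "q \<in> free_tuples d"
  shows "nform p = nform q \<longleftrightarrow> p - q \<in> multilinear_relations scl d"
proof
  assume "nform p = nform q"
  then have "p - q = (p - nform p) - (q - nform q)" by simp
  also have "\<dots> \<in> multilinear_relations scl d"
    by (intro free.subspace_diff[OF subspace_relations] minus_nform_relation assms)
  finally show "p - q \<in> multilinear_relations scl d" .
next
  assume "p - q \<in> multilinear_relations scl d"
  then have "nform (p - q) = 0" by (rule nform_relation)
  then show "nform p = nform q" by (simp add: module_hom.diff[OF nform_hom])
qed

lemma nform_nform: "p \<in> free_tuples d \<Longrightarrow> nform (nform p) = nform p"
  using nform_relation[OF minus_nform_relation] by (simp add: module_hom.diff[OF nform_hom])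

section \<open>Product and permutation action on normal forms\<close>

definition tmul :: "('v list \<Rightarrow>\<^sub>0 'k) \<Rightarrow> ('v list \<Rightarrow>\<^sub>0 'k) \<Rightarrow> ('v list \<Rightarrow>\<^sub>0 'k)" where
  "tmul p q = nform (lin_ext (\<lambda>xs. lin_ext (tuple_mult mul gr xs) q) p)"

definition act :: "(nat \<Rightarrow> nat) \<Rightarrow> ('v list \<Rightarrow>\<^sub>0 'k) \<Rightarrow> ('v list \<Rightarrow>\<^sub>0 'k)" where
  "act \<sigma> p = nform (lin_ext (tuple_permute gr \<sigma>) p)"

lemma tmul_alt: "tmul p q = lin_ext (\<lambda>xs. lin_ext (\<lambda>ys. nform (tuple_mult mul gr xs ys)) q) p"
  unfolding tmul_def by (simp add: lin_ext_hom[OF nform_hom])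

lemma act_alt: "act \<sigma> p = lin_ext (\<lambda>xs. nform (tuple_permute gr \<sigma> xs)) p"
  unfolding act_def by (simp add: lin_ext_hom[OF nform_hom])

lemma tmul_hom_left: "module_hom free_scale free_scale (\<lambda>p. tmul p q)"
  unfolding tmul_alt by (rule module_hom_lin_ext)

lemma tmul_hom_right: "module_hom free_scale free_scale (tmul p)"
  by unfold_locales
     (simp_all add: tmul_alt lin_ext_add lin_ext_scale lin_ext_fun_add lin_ext_fun_scale)

lemma act_hom: "module_hom free_scale free_scale (act \<sigma>)"
  unfolding act_alt by (rule module_hom_lin_ext)

lemma nform_tuple_mult:
  "nform (tuple_mult mul gr xs ys) = (\<Sum>e\<in>{e. length e = length xs}. \<Sum>f\<in>{f. length f = length ys}.
     free_scale (koszul_sign e f) (pt (map2 mul (homogeneous_parts gr e xs) (homogeneous_parts gr f ys))))"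
  by (simp add: tuple_mult_def module_hom.sum[OF nform_hom])

lemma nform_tuple_permute:
  "nform (tuple_permute gr \<sigma> xs) = (\<Sum>e\<in>{e. length e = length xs}.
     free_scale (permute_sign \<sigma> e) (pt (permute_list \<sigma> (homogeneous_parts gr e xs))))"
  by (simp add: tuple_permute_def module_hom.sum[OF nform_hom])

lemma homogeneous_parts_multilinear:
  assumes "multilinear scl d f" "length e = d"
  shows "multilinear scl d (\<lambda>xs. f (homogeneous_parts gr e xs))"
  unfolding homogeneous_parts_def using assms
  by (intro multilinear_map2 module_hom_homogeneous_part) auto

lemma nform_tuple_mult_multilinear_left:
  assumes "length ys = d"
  shows "multilinear scl d (\<lambda>xs. nform (tuple_mult mul gr xs ys))"
proof -
  have "multilinear scl d (\<lambda>xs. \<Sum>e\<in>{e. length e = d}. \<Sum>f\<in>{f. length f = length ys}.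
     free_scale (koszul_sign e f) (pt (map2 mul (homogeneous_parts gr e xs) (homogeneous_parts gr f ys))))"
  proof (intro multilinear_sum multilinear_hom[OF free.module_hom_scale_self])
    fix e f :: "bit list" assume e: "e \<in> {e. length e = d}" and f: "f \<in> {f. length f = length ys}"
    have "multilinear scl d (\<lambda>xs. pt (map2 (\<lambda>y x. mul x y) (homogeneous_parts gr f ys) xs))"
      by (rule multilinear_map2[OF pt_multilinear module_hom_mul_right])
         (use f assms in \<open>simp add: homogeneous_parts_def\<close>)
    moreover have "map2 (\<lambda>y x. mul x y) (homogeneous_parts gr f ys) xs = map2 mul xs (homogeneous_parts gr f ys)" for xs
      by (subst zip_commute) (simp add: split_def)
    ultimately have "multilinear scl d (\<lambda>xs. pt (map2 mul xs (homogeneous_parts gr f ys)))" by simp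
    from homogeneous_parts_multilinear[OF this, of e] e
    show "multilinear scl d (\<lambda>xs. pt (map2 mul (homogeneous_parts gr e xs) (homogeneous_parts gr f ys)))" by simp
  qed
  then show ?thesis
    by (subst multilinear_cong) (auto simp: nform_tuple_mult)
qed

lemma nform_tuple_mult_multilinear_right:
  assumes "length xs = d"
  shows "multilinear scl d (\<lambda>ys. nform (tuple_mult mul gr xs ys))"
proof -
  have "multilinear scl d (\<lambda>ys. \<Sum>e\<in>{e. length e = length xs}. \<Sum>f\<in>{f. length f = d}.
     free_scale (koszul_sign e f) (pt (map2 mul (homogeneous_parts gr e xs) (homogeneous_parts gr f ys))))"
  proof (intro multilinear_sum multilinear_hom[OF free.module_hom_scale_self])
    fix e f :: "bit list" assume e: "e \<in> {e. length e = length xs}" and f: "f \<in> {f. length f = d}"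
    have "multilinear scl d (\<lambda>ys. pt (map2 mul (homogeneous_parts gr e xs) ys))"
      by (rule multilinear_map2[OF pt_multilinear module_hom_mul_left])
         (use e assms in \<open>simp add: homogeneous_parts_def\<close>)
    from homogeneous_parts_multilinear[OF this, of f] f
    show "multilinear scl d (\<lambda>ys. pt (map2 mul (homogeneous_parts gr e xs) (homogeneous_parts gr f ys)))" by simp
  qed
  then show ?thesis
    by (subst multilinear_cong) (auto simp: nform_tuple_mult)
qed

lemma nform_tuple_permute_multilinear:
  assumes "\<sigma> permutes {..<d}"
  shows "multilinear scl d (\<lambda>xs. nform (tuple_permute gr \<sigma> xs))"
proof -
  have "multilinear scl d (\<lambda>xs. \<Sum>e\<in>{e. length e = d}.
     free_scale (permute_sign \<sigma> e) (pt (permute_list \<sigma> (homogeneous_parts gr e xs))))"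
    using assms
    by (intro multilinear_sum multilinear_hom[OF free.module_hom_scale_self] homogeneous_parts_multilinear
        multilinear_permute_list pt_multilinear) auto
  then show ?thesis
    by (subst multilinear_cong) (auto simp: nform_tuple_permute)
qed

lemma tmul_relation_left:
  "p \<in> multilinear_relations scl d \<Longrightarrow> q \<in> free_tuples d \<Longrightarrow> tmul p q = 0"
  unfolding tmul_alt
  by (rule lin_ext_relations[OF multilinear_lin_ext])
     (auto simp: free_tuples_def intro: nform_tuple_mult_multilinear_left)

lemma tmul_relation_right:
  assumes "p \<in> free_tuples d" "q \<in> multilinear_relations scl d"
  shows "tmul p q = 0"
proof -
  have "tmul p q = lin_ext (\<lambda>xs. 0) p"
    unfolding tmul_alt using assms
    by (intro lin_ext_cong lin_ext_relations[OF nform_tuple_mult_multilinear_right]) (auto simp: free_tuples_def)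
  then show ?thesis by (simp add: lin_ext_def)
qed

lemma act_relation:
  "\<sigma> permutes {..<d} \<Longrightarrow> p \<in> multilinear_relations scl d \<Longrightarrow> act \<sigma> p = 0"
  unfolding act_alt by (rule lin_ext_relations[OF nform_tuple_permute_multilinear])

text \<open>The product annihilates relations on either side, so it sees only normal forms; this
  makes it well defined on classes.\<close>

lemma tmul_nform:
  assumes "p \<in> free_tuples d" "q \<in> free_tuples d"
  shows "tmul (nform p) (nform q) = tmul p q"
proof -
  have "tmul (p - nform p) q = 0" "tmul (nform p) (q - nform q) = 0"
    using assms by (auto intro: tmul_relation_left tmul_relation_right minus_nform_relation nform_free_tuples)
  then show ?thesis
    by (simp add: module_hom.diff[OF tmul_hom_left] module_hom.diff[OF tmul_hom_right])
qed

lemma act_nform: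
  assumes "\<sigma> permutes {..<d}" "p \<in> free_tuples d"
  shows "act \<sigma> (nform p) = act \<sigma> p"
  using act_relation[OF assms(1) minus_nform_relation[OF assms(2)]]
  by (simp add: module_hom.diff[OF act_hom])

lemma finite_bit_lists: "finite {e :: bit list. length e = n}"
  using finite_lists_length_eq[of "{0, 1} :: bit set" n]
  by (rule finite_subset[rotated]) (auto intro: bit.exhaust)

lemma tmul_pt:
  assumes e: "homogeneous e xs" and f: "homogeneous f ys" and len: "length xs = d" "length ys = d"
  shows "tmul (pt xs) (pt ys) = free_scale (koszul_sign e f) (pt (map2 mul xs ys))"
proof -
  let ?t = "\<lambda>e' f'. free_scale (koszul_sign e' f') (pt (map2 mul (homogeneous_parts gr e' xs) (homogeneous_parts gr f' ys)))"
  have le: "length e = length xs" "length f = length ys" using e f by (auto dest: homogeneous_length)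
  have z: "?t e' f' = 0" if "length e' = length xs" "length f' = length ys" "e' \<noteq> e \<or> f' \<noteq> f" for e' f' :: "bit list"
  proof -
    have "0 \<in> set (homogeneous_parts gr e' xs) \<or> 0 \<in> set (homogeneous_parts gr f' ys)"
      using that homogeneous_parts_other[OF e, of e'] homogeneous_parts_other[OF f, of f'] le by auto
    then have "0 \<in> set (map2 mul (homogeneous_parts gr e' xs) (homogeneous_parts gr f' ys))"
      using that len by (intro zero_in_map2_mul) (auto simp: homogeneous_parts_def)
    then show ?thesis using multilinear_zero_mem[OF pt_multilinear refl] by simp
  qed
  \<comment> \<open>\<open>pt xs\<close> is the normal form of the single tuple \<open>xs\<close>,
    so the product may be evaluated on the tuples themselves, whose parities are known.\<close>
  have "tmul (pt xs) (pt ys) = tmul (Poly_Mapping.single xs 1) (Poly_Mapping.single ys 1)"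
    using tmul_nform[of "Poly_Mapping.single xs 1" "Poly_Mapping.single ys 1"] len by simp
  also have "\<dots> = (\<Sum>e' | length (e' :: bit list) = length xs. \<Sum>f' | length (f' :: bit list) = length ys. ?t e' f')"
    by (simp add: tmul_alt nform_tuple_mult)
  also have "\<dots> = (\<Sum>e' | length (e' :: bit list) = length xs. if e' = e then ?t e f else 0)"
  proof (rule sum.cong[OF refl])
    fix e' assume e': "e' \<in> {e' :: bit list. length e' = length xs}"
    have "(\<Sum>f' | length (f' :: bit list) = length ys. ?t e' f') =
        (\<Sum>f' | length (f' :: bit list) = length ys. if f' = f then (if e' = e then ?t e f else 0) else 0)"
      using z e' by (intro sum.cong) (auto simp del: free_scale_single)
    then show "(\<Sum>f' | length (f' :: bit list) = length ys. ?t e' f') = (if e' = e then ?t e f else 0)"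
      using le by (simp add: finite_bit_lists)
  qed
  also have "\<dots> = ?t e f" using le by (simp add: finite_bit_lists)
  finally show ?thesis by (simp add: homogeneous_parts_same e f)
qed

lemma act_pt:
  assumes e: "homogeneous e xs" and len: "length xs = d" and \<sigma>: "\<sigma> permutes {..<d}"
  shows "act \<sigma> (pt xs) = free_scale (permute_sign \<sigma> e) (pt (permute_list \<sigma> xs))"
proof -
  let ?t = "\<lambda>e'. free_scale (permute_sign \<sigma> e') (pt (permute_list \<sigma> (homogeneous_parts gr e' xs)))"
  have le: "length e = length xs" using e by (rule homogeneous_length)
  have z: "?t e' = 0" if "length e' = length xs" "e' \<noteq> e" for e' :: "bit list"
  proof -
    have "0 \<in> set (homogeneous_parts gr e' xs)"
      using that homogeneous_parts_other[OF e, of e'] le by auto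
    then have "0 \<in> set (permute_list \<sigma> (homogeneous_parts gr e' xs))"
      using \<sigma> that len by (subst set_permute_list) (auto simp: homogeneous_parts_def)
    then show ?thesis using multilinear_zero_mem[OF pt_multilinear refl] by simp
  qed
  have "act \<sigma> (pt xs) = act \<sigma> (Poly_Mapping.single xs 1)"
    using act_nform[of \<sigma> "Poly_Mapping.single xs 1"] \<sigma> len by simp
  also have "\<dots> = (\<Sum>e' | length (e' :: bit list) = length xs. ?t e')"
    by (simp add: act_alt nform_tuple_permute)
  also have "\<dots> = (\<Sum>e' | length (e' :: bit list) = length xs. if e' = e then ?t e else 0)"
    using z by (intro sum.cong) auto
  also have "\<dots> = ?t e" using le by (simp add: finite_bit_lists)
  finally show ?thesis by (simp add: homogeneous_parts_same e)
qed

end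


section \<open>Transfer maps\<close>

context based_superalgebra
begin

lemmas act_zero [simp] = module_hom.zero[OF act_hom]
  and act_add = module_hom.add[OF act_hom]
  and act_scale = module_hom.scale[OF act_hom]
  and act_sum = module_hom.sum[OF act_hom]
  and tmul_zero_left [simp] = module_hom.zero[OF tmul_hom_left]
  and tmul_add_left = module_hom.add[OF tmul_hom_left]
  and tmul_scale_left = module_hom.scale[OF tmul_hom_left]
  and tmul_sum_left = module_hom.sum[OF tmul_hom_left]
  and tmul_add_right = module_hom.add[OF tmul_hom_right]
  and tmul_scale_right = module_hom.scale[OF tmul_hom_right]
  and tmul_sum_right = module_hom.sum[OF tmul_hom_right]

section \<open>Tensors with restricted initial slots\<close>

definition tensors :: "('v list \<Rightarrow>\<^sub>0 'k) set" where
  "tensors = free.span {pt xs |xs. length xs = d}"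

text \<open>The image of \<open>m\<close> factors \<open>Va\<close> followed by arbitrary factors,
  described as a span inside the full tensor power so that no tensor product of different modules is
  needed.\<close>

definition prefix :: "nat \<Rightarrow> ('v list \<Rightarrow>\<^sub>0 'k) set" where
  "prefix m = free.span {pt xs |xs. length xs = d \<and> (\<forall>i<d. i < m \<longrightarrow> xs ! i \<in> Va)}"

lemma prefix_0: "prefix 0 = tensors"
  by (simp add: prefix_def tensors_def)

lemma prefix_mono: "m' \<le> m \<Longrightarrow> prefix m \<subseteq> prefix m'"
  unfolding prefix_def by (rule free.span_mono) auto

lemma prefix_subset_tensors: "prefix m \<subseteq> tensors"
  using prefix_mono[of 0 m] by (simp add: prefix_0)

lemma subspace_prefix: "free.subspace (prefix m)"
  by (simp add: prefix_def)

lemma subspace_tensors: "free.subspace tensors"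
  by (simp add: tensors_def)

lemma pt_tensors [simp]: "length xs = d \<Longrightarrow> pt xs \<in> tensors"
  unfolding tensors_def by (rule free.span_base) auto

lemma pt_prefix: "length xs = d \<Longrightarrow> (\<And>i. i < d \<Longrightarrow> i < m \<Longrightarrow> xs ! i \<in> Va) \<Longrightarrow> pt xs \<in> prefix m"
  unfolding prefix_def by (rule free.span_base) auto

text \<open>Expanding each slot in its own generating set respects the restriction on the first
  \<open>m\<close> slots. Basis words are homogeneous, so linear statements about
  \<open>prefix m\<close> can be tested where signs are defined.\<close>

lemma prefix_basis:
  "prefix m = free.span {pt w |w. length w = d \<and> (\<forall>i<d. w ! i \<in> (if i < m then Ba else basis))}"
  (is "_ = free.span ?G")
proof
  show "prefix m \<subseteq> free.span ?G"
    unfolding prefix_def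
  proof (rule free.span_minimal[OF _ free.subspace_span], rule subsetI)
    fix p assume "p \<in> {pt xs |xs. length xs = d \<and> (\<forall>i<d. i < m \<longrightarrow> xs ! i \<in> Va)}"
    then obtain xs where p: "p = pt xs" and xs: "length xs = d" "\<forall>i<d. i < m \<longrightarrow> xs ! i \<in> Va" by blast
    have "xs ! i \<in> span ((\<lambda>i. if i < m then Ba else basis) i)" if "i < d" for i
      using xs that by (simp add: spanning)
    from multilinear_in_span[OF pt_multilinear xs(1) this]
    show "p \<in> free.span ?G" by (simp add: p)
  qed
  show "free.span ?G \<subseteq> prefix m"
    unfolding prefix_def by (rule free.span_mono) (auto intro: span_base)
qed

lemma prefix_induct:
  assumes "x \<in> prefix m" and sub: "free.subspace {x. P x}"
    and base: "\<And>e w. length w = d \<Longrightarrow> homogeneous e w \<Longrightarrow> (\<And>i. i < d \<Longrightarrow> i < m \<Longrightarrow> w ! i \<in> Va) \<Longrightarrow> P (pt w)"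
  shows "P x"
proof (rule free.span_induct[OF assms(1)[unfolded prefix_basis] sub])
  fix x assume "x \<in> {pt w |w. length w = d \<and> (\<forall>i<d. w ! i \<in> (if i < m then Ba else basis))}"
  then obtain w where w: "x = pt w" "length w = d" "\<forall>i<d. w ! i \<in> (if i < m then Ba else basis)" by blast
  then have "\<forall>i<length w. w ! i \<in> basis" by (metis UnI1)
  then obtain e where "homogeneous e w" using basis_homogeneous by blast
  moreover have "w ! i \<in> Va" if "i < d" "i < m" for i
    using w(3) that by (metis span_base)
  ultimately show "P x" using w base by blast
qed

lemma tensors_induct:
  assumes "x \<in> tensors" "free.subspace {x. P x}"
    and "\<And>e w. length w = d \<Longrightarrow> homogeneous e w \<Longrightarrow> P (pt w)"
  shows "P x"
  using prefix_induct[of x 0 P] assms by (simp add: prefix_0)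

lemma tensors_eqI:
  assumes "x \<in> tensors" "module_hom free_scale free_scale f" "module_hom free_scale free_scale g"
    and "\<And>e w. length w = d \<Longrightarrow> homogeneous e w \<Longrightarrow> f (pt w) = (g (pt w) :: 'y \<Rightarrow>\<^sub>0 'k)"
  shows "f x = g x"
proof (rule tensors_induct[OF assms(1)])
  show "free.subspace {x. f x = g x}"
    by (rule free.subspaceI)
       (auto simp: module_hom.zero[OF assms(2)] module_hom.zero[OF assms(3)]
         module_hom.add[OF assms(2)] module_hom.add[OF assms(3)]
         module_hom.scale[OF assms(2)] module_hom.scale[OF assms(3)])
qed (fact assms(4))

lemma tensors_free_tuples: "tensors \<subseteq> free_tuples d"
  unfolding tensors_def
  by (rule free.span_minimal[OF _ subspace_free_tuples]) (use pt_free_tuples in blast)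

lemma nform_tensors: "p \<in> free_tuples d \<Longrightarrow> nform p \<in> tensors"
  unfolding nform_def lin_ext_def
  by (intro free.subspace_sum[OF subspace_tensors] free.subspace_scale[OF subspace_tensors] pt_tensors)
     (auto simp: free_tuples_def)

lemma nform_pt: "length xs = d \<Longrightarrow> nform (pt xs) = pt xs"
  using nform_nform[of "Poly_Mapping.single xs 1"] by simp

lemma nform_id: "x \<in> tensors \<Longrightarrow> nform x = x"
  by (rule tensors_eqI[of x nform "\<lambda>x. x"]) (auto simp: nform_hom nform_pt intro: free.module_hom_ident)

lemma act_tensors: "\<sigma> permutes {..<d} \<Longrightarrow> x \<in> tensors \<Longrightarrow> act \<sigma> x \<in> tensors"
proof (rule tensors_induct[where P = "\<lambda>x. act \<sigma> x \<in> tensors"])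
  show "free.subspace {x. act \<sigma> x \<in> tensors}"
    by (rule module_hom.subspace_linear_preimage[OF act_hom subspace_tensors])
qed (simp_all add: act_pt free.subspace_scale[OF subspace_tensors])

lemma tmul_tensors: "x \<in> tensors \<Longrightarrow> y \<in> tensors \<Longrightarrow> tmul x y \<in> tensors"
proof (rule tensors_induct[where x = x and P = "\<lambda>x. tmul x y \<in> tensors"])
  fix e w assume w: "length w = d" "homogeneous e w" and "y \<in> tensors"
  then show "tmul (pt w) y \<in> tensors"
  proof (rule_tac tensors_induct[where x = y and P = "\<lambda>y. tmul (pt w) y \<in> tensors"])
    show "free.subspace {y. tmul (pt w) y \<in> tensors}"
      by (rule module_hom.subspace_linear_preimage[OF tmul_hom_right subspace_tensors])
  qed (use w in \<open>simp_all add: tmul_pt free.subspace_scale[OF subspace_tensors]\<close>)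
next
  show "free.subspace {x. tmul x y \<in> tensors}"
    by (rule module_hom.subspace_linear_preimage[OF tmul_hom_left subspace_tensors])
qed

section \<open>Compatibility of the action with the product\<close>

lemma act_act:
  assumes \<sigma>: "\<sigma> permutes {..<d}" and \<tau>: "\<tau> permutes {..<d}" and "x \<in> tensors"
  shows "act \<tau> (act \<sigma> x) = act (\<sigma> \<circ> \<tau>) x"
proof (rule tensors_eqI[OF assms(3)])
  show "module_hom free_scale free_scale (\<lambda>x. act \<tau> (act \<sigma> x))"
    by unfold_locales (simp_all add: act_add act_scale)
  fix e w assume w: "length w = d" "homogeneous e w"
  then have [simp]: "length e = d" by (simp add: homogeneous_length)
  show "act \<tau> (act \<sigma> (pt w)) = act (\<sigma> \<circ> \<tau>) (pt w)"
    using w \<sigma> \<tau>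
    by (simp add: act_pt act_scale act_pt[OF homogeneous_permute_list] permute_sign_compose
        permutes_compose permute_list_compose)
qed (rule act_hom)

lemma act_tmul:
  assumes \<sigma>: "\<sigma> permutes {..<d}" and "x \<in> tensors" "y \<in> tensors"
  shows "act \<sigma> (tmul x y) = tmul (act \<sigma> x) (act \<sigma> y)"
proof (rule tensors_eqI[OF assms(2)])
  show "module_hom free_scale free_scale (\<lambda>x. act \<sigma> (tmul x y))"
       "module_hom free_scale free_scale (\<lambda>x. tmul (act \<sigma> x) (act \<sigma> y))"
    by (unfold_locales; simp add: act_add act_scale tmul_add_left tmul_scale_left)+
  fix e w assume w: "length w = d" "homogeneous e w"
  show "act \<sigma> (tmul (pt w) y) = tmul (act \<sigma> (pt w)) (act \<sigma> y)"
  proof (rule tensors_eqI[OF assms(3)])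
    show "module_hom free_scale free_scale (\<lambda>y. act \<sigma> (tmul (pt w) y))"
         "module_hom free_scale free_scale (\<lambda>y. tmul (act \<sigma> (pt w)) (act \<sigma> y))"
      by (unfold_locales; simp add: act_add act_scale tmul_add_right tmul_scale_right)+
    fix f z assume z: "length z = d" "homogeneous f z"
    have le: "length e = d" "length f = d" using w z by (simp_all add: homogeneous_length)
    have perm: "permute_list \<sigma> (map2 mul w z) = map2 mul (permute_list \<sigma> w) (permute_list \<sigma> z)"
      using \<sigma> w z by (simp add: permute_list_map permute_list_zip)
    have "act \<sigma> (tmul (pt w) (pt z)) = free_scale (koszul_sign e f * permute_sign \<sigma> (map2 (+) e f))
        (pt (map2 mul (permute_list \<sigma> w) (permute_list \<sigma> z)))"
      using w z \<sigma> act_pt[OF homogeneous_map2_mul[OF w(2) z(2)] _ \<sigma>]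
      by (simp add: tmul_pt[OF w(2) z(2)] act_scale perm)
    also have "koszul_sign e f * permute_sign \<sigma> (map2 (+) e f) =
        permute_sign \<sigma> e * permute_sign \<sigma> f * (koszul_sign (permute_list \<sigma> e) (permute_list \<sigma> f) :: 'k)"
      using permute_sign_add[of \<sigma> e f] \<sigma> le by (simp add: mult_ac)
    also have "free_scale \<dots> (pt (map2 mul (permute_list \<sigma> w) (permute_list \<sigma> z))) =
        tmul (act \<sigma> (pt w)) (act \<sigma> (pt z))"
      using w z \<sigma>
      by (simp add: act_pt[OF w(2)] act_pt[OF z(2)] tmul_scale_left tmul_scale_right
          tmul_pt[OF homogeneous_permute_list[OF w(2)] homogeneous_permute_list[OF z(2)]] mult_ac)
    finally show "act \<sigma> (tmul (pt w) (pt z)) = tmul (act \<sigma> (pt w)) (act \<sigma> (pt z))" .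
  qed
qed

lemma tmul_assoc:
  assumes "x \<in> tensors" "y \<in> tensors" "z \<in> tensors"
  shows "tmul (tmul x y) z = tmul x (tmul y z)"
proof (rule tensors_eqI[OF assms(1)])
  show "module_hom free_scale free_scale (\<lambda>x. tmul (tmul x y) z)"
       "module_hom free_scale free_scale (\<lambda>x. tmul x (tmul y z))"
    by (unfold_locales; simp add: tmul_add_left tmul_scale_left)+
  fix e w assume w: "length w = d" "homogeneous e w"
  show "tmul (tmul (pt w) y) z = tmul (pt w) (tmul y z)"
  proof (rule tensors_eqI[OF assms(2)])
    show "module_hom free_scale free_scale (\<lambda>y. tmul (tmul (pt w) y) z)"
         "module_hom free_scale free_scale (\<lambda>y. tmul (pt w) (tmul y z))"
      by (unfold_locales; simp add: tmul_add_left tmul_scale_left tmul_add_right tmul_scale_right)+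
    fix f v assume v: "length v = d" "homogeneous f v"
    show "tmul (tmul (pt w) (pt v)) z = tmul (pt w) (tmul (pt v) z)"
    proof (rule tensors_eqI[OF assms(3)])
      show "module_hom free_scale free_scale (\<lambda>z. tmul (tmul (pt w) (pt v)) z)"
           "module_hom free_scale free_scale (\<lambda>z. tmul (pt w) (tmul (pt v) z))"
        by (unfold_locales; simp add: tmul_add_right tmul_scale_right)+
      fix g t assume t: "length t = d" "homogeneous g t"
      have le: "length e = d" "length f = d" "length g = d"
        using w v t by (simp_all add: homogeneous_length)
      have assoc: "map2 mul (map2 mul w v) t = map2 mul w (map2 mul v t)"
        using w v t by (auto intro!: nth_equalityI simp: mul_assoc)
      \<comment> \<open>Both sides are the product of the Koszul signs of the three pairs
        \<open>(e, f)\<close>, \<open>(e, g)\<close> and \<open>(f, g)\<close>.\<close>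
      have sgn: "koszul_sign e f * koszul_sign (map2 (+) e f) g =
          koszul_sign f g * (koszul_sign e (map2 (+) f g) :: 'k)"
        using le by (simp add: koszul_sign_add_left koszul_sign_add_right)
      show "tmul (tmul (pt w) (pt v)) (pt t) = tmul (pt w) (tmul (pt v) (pt t))"
        using w v t sgn
        by (simp add: tmul_pt[OF w(2) v(2)] tmul_pt[OF v(2) t(2)] tmul_scale_left tmul_scale_right assoc
            tmul_pt[OF homogeneous_map2_mul[OF w(2) v(2)] t(2)] tmul_pt[OF w(2) homogeneous_map2_mul[OF v(2) t(2)]])
    qed
  qed
qed

lemma homogeneous_even: "set xs \<subseteq> gr 0 \<Longrightarrow> homogeneous (replicate (length xs) 0) xs"
  by (auto simp: homogeneous_def list_all2_conv_all_nth)

text \<open>An even left factor never produces a sign. So \<open>ys\<close> need not be homogeneous: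
  both sides are multilinear in it and agree on basis words.\<close>

lemma tmul_even_pt:
  assumes "set xs \<subseteq> gr 0" "length xs = d" "length ys = d"
  shows "tmul (pt xs) (pt ys) = pt (map2 mul xs ys)"
proof (rule multilinear_eqI[where f = "\<lambda>ys. tmul (pt xs) (pt ys)" and T = "\<lambda>_. basis", OF _ _ assms(3)])
  show "multilinear scl d (\<lambda>ys. tmul (pt xs) (pt ys))"
    by (rule multilinear_hom[OF tmul_hom_right pt_multilinear])
  show "multilinear scl d (\<lambda>ys. pt (map2 mul xs ys))"
    by (rule multilinear_map2[OF pt_multilinear module_hom_mul_left assms(2)])
  fix ys assume ys: "length ys = d" "\<And>i. i < d \<Longrightarrow> ys ! i \<in> basis"
  then obtain f where f: "homogeneous f ys" using basis_homogeneous by metis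
  have "koszul_sign (replicate d 0) f = (1::'k)"
    by (auto simp: koszul_sign_prod swap_sign_def pairs_def intro!: prod.neutral)
  then show "tmul (pt xs) (pt ys) = pt (map2 mul xs ys)"
    using tmul_pt[OF homogeneous_even[OF assms(1)] f] assms ys by simp
qed (simp add: spanning)

lemma koszul_sign_square: "koszul_sign e f * koszul_sign e f = (1::'k)"
  by (simp add: koszul_sign_def flip: power_add mult_2)

lemma unit_even: "unit \<in> gr 0"
  using unit_mem Va_even by blast

section \<open>Insertions of one element between units\<close>

definition ins :: "nat \<Rightarrow> 'v \<Rightarrow> ('v list \<Rightarrow>\<^sub>0 'k)" where
  "ins i v = pt ((replicate d unit)[i := v])"

lemma ins_tensors [simp]: "ins i v \<in> tensors"
  by (simp add: ins_def)

lemma ins_add: "i < d \<Longrightarrow> ins i (v + w) = ins i v + ins i w"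
  unfolding ins_def by (rule multilinear_update_add[OF pt_multilinear[of d]]) auto

lemma homogeneous_ins:
  "v \<in> gr a \<Longrightarrow> homogeneous ((replicate d 0)[i := a]) ((replicate d unit)[i := v])"
  unfolding homogeneous_def list_all2_conv_all_nth
proof (intro conjI allI impI)
  fix j assume "v \<in> gr a" "j < length ((replicate d 0)[i := a])"
  then show "(replicate d unit)[i := v] ! j \<in> gr ((replicate d 0)[i := a] ! j)"
    by (cases "j = i") (simp_all add: unit_even)
qed simp

text \<open>With at most one odd slot there is no pair of odd letters, hence no sign. As
  \<open>v\<close> need not be homogeneous, it is split into its two parts.\<close>

lemma act_ins:
  assumes \<sigma>: "\<sigma> permutes {..<d}" and i: "i < d"
  shows "act \<sigma> (ins i v) = ins (pinv \<sigma> i) v"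
proof -
  have i': "pinv \<sigma> i < d" using permutes_in_image[OF permutes_inv[OF \<sigma>], of i] i by simp
  have rep: "permute_list \<sigma> (replicate d unit) = replicate d unit"
  proof (rule nth_equalityI)
    fix j assume "j < length (permute_list \<sigma> (replicate d unit))"
    then show "permute_list \<sigma> (replicate d unit) ! j = replicate d unit ! j"
      using \<sigma> permutes_in_image[OF \<sigma>, of j] by (simp add: permute_list_nth)
  qed simp
  have hom: "act \<sigma> (ins i w) = ins (pinv \<sigma> i) w" if w: "w \<in> gr a" for a w
  proof -
    have "permute_sign \<sigma> ((replicate d 0)[i := a]) = (1::'k)"
      unfolding permute_sign_prod
    proof (rule prod.neutral, clarify)
      fix k l assume "(k, l) \<in> pairs (length ((replicate d (0::bit))[i := a]))"
      then have "k < d" "l < d" "k \<noteq> i \<or> l \<noteq> i" by (auto simp: pairs_def)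
      then have "(replicate d 0)[i := a] ! k = 0 \<or> (replicate d 0)[i := a] ! l = 0"
        by (elim disjE) (simp_all add: nth_list_update_neq[OF not_sym])
      then show "(if pinv \<sigma> l < pinv \<sigma> k then swap_sign ((replicate d 0)[i := a] ! k) ((replicate d 0)[i := a] ! l) else 1) = (1::'k)"
        by (auto simp: swap_sign_def)
    qed
    then show ?thesis
      unfolding ins_def
      using act_pt[OF homogeneous_ins[OF w, of i] _ \<sigma>] permute_list_update[of \<sigma> "replicate d unit" i w] \<sigma> i
      by (simp add: rep)
  qed
  have "act \<sigma> (ins i (homogeneous_part gr 0 v + homogeneous_part gr 1 v)) =
      ins (pinv \<sigma> i) (homogeneous_part gr 0 v + homogeneous_part gr 1 v)"
    using i i' by (simp add: ins_add act_add hom[OF homogeneous_part_mem(1)])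
  then show ?thesis by (simp only: homogeneous_part_sum)
qed

text \<open>Only the invertibility of the sign matters later, so it is recorded as a scalar
  \<open>c\<close> with \<open>c * c = 1\<close>.\<close>

lemma tmul_ins_pt:
  assumes "i < d" "length xs = d" "homogeneous e xs" "v \<in> gr a"
  obtains c where "c * c = 1" "tmul (ins i v) (pt xs) = free_scale c (pt (xs[i := mul v (xs ! i)]))"
proof -
  have "map2 mul ((replicate d unit)[i := v]) xs = xs[i := mul v (xs ! i)]"
    using assms(1,2) by (auto intro!: nth_equalityI simp: nth_list_update unit_mul)
  then show ?thesis
    using tmul_pt[OF homogeneous_ins[OF assms(4), of i] assms(3)] assms(2) that koszul_sign_square
    unfolding ins_def by (metis length_list_update length_replicate)
qed

section \<open>Invariants and transfer along the chain of symmetric groups\<close>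

definition invar :: "nat \<Rightarrow> ('v list \<Rightarrow>\<^sub>0 'k) \<Rightarrow> bool" where
  "invar m x \<longleftrightarrow> (\<forall>\<sigma>. \<sigma> permutes {..<m} \<longrightarrow> act \<sigma> x = x)"

lemma permutes_le: "\<sigma> permutes {..<m} \<Longrightarrow> m \<le> n \<Longrightarrow> \<sigma> permutes {..<(n::nat)}"
  by (erule permutes_subset) simp

lemma invar_mono: "m' \<le> m \<Longrightarrow> invar m x \<Longrightarrow> invar m' x"
  unfolding invar_def using permutes_le by blast

lemma invar_tmul:
  "m \<le> d \<Longrightarrow> x \<in> tensors \<Longrightarrow> y \<in> tensors \<Longrightarrow> invar m x \<Longrightarrow> invar m y \<Longrightarrow> invar m (tmul x y)"
  unfolding invar_def by (auto simp: act_tmul permutes_le)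

lemma subspace_invar: "free.subspace {x. invar m x}"
  by (rule free.subspaceI) (auto simp: invar_def act_add act_scale)

text \<open>The transfer from the symmetric group on the first \<open>m\<close> slots to the one on the first
  \<open>m + 1\<close> slots; the transpositions are coset representatives.\<close>

definition transfer1 :: "nat \<Rightarrow> ('v list \<Rightarrow>\<^sub>0 'k) \<Rightarrow> ('v list \<Rightarrow>\<^sub>0 'k)" where
  "transfer1 m x = (\<Sum>i\<le>m. act (Transposition.transpose i m) x)"

text \<open>Climbing the chain of symmetric groups one slot at a time builds the transitivity of the
  transfer into the definition, and coset representatives in the full group never have to be
  chosen.\<close>

definition transfer :: "nat \<Rightarrow> ('v list \<Rightarrow>\<^sub>0 'k) \<Rightarrow> ('v list \<Rightarrow>\<^sub>0 'k)" where
  "transfer m x = fold transfer1 [m..<d] x"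

lemma transfer_self [simp]: "transfer d x = x"
  by (simp add: transfer_def)

lemma transfer_Suc: "m < d \<Longrightarrow> transfer m x = transfer (Suc m) (transfer1 m x)"
  by (simp add: transfer_def upt_conv_Cons)

lemma transpose_permutes: "i \<le> m \<Longrightarrow> m < d \<Longrightarrow> Transposition.transpose i m permutes {..<Suc m}"
  by (rule permutes_swap_id) auto

lemma transpose_permutes_d: "i \<le> m \<Longrightarrow> m < d \<Longrightarrow> Transposition.transpose i m permutes {..<d}"
  by (rule permutes_swap_id) auto

lemma transfer1_hom: "module_hom free_scale free_scale (transfer1 m)"
  by unfold_locales (simp_all add: transfer1_def act_add act_scale sum.distrib free.scale_sum_right)

lemma transfer1_tensors: "m < d \<Longrightarrow> x \<in> tensors \<Longrightarrow> transfer1 m x \<in> tensors"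
  unfolding transfer1_def
  by (auto intro!: free.subspace_sum[OF subspace_tensors] act_tensors transpose_permutes_d)

lemma transfer_add: "transfer m (x + y) = transfer m x + transfer m y"
  and transfer_scale: "transfer m (free_scale c x) = free_scale c (transfer m x)"
proof -
  have "fold transfer1 ms (x + y) = fold transfer1 ms x + fold transfer1 ms y"
    "fold transfer1 ms (free_scale c x) = free_scale c (fold transfer1 ms x)" for ms
    by (induction ms arbitrary: x y)
       (simp_all add: module_hom.add[OF transfer1_hom] module_hom.scale[OF transfer1_hom])
  then show "transfer m (x + y) = transfer m x + transfer m y"
    "transfer m (free_scale c x) = free_scale c (transfer m x)" by (simp_all add: transfer_def)
qed

lemma transfer_hom: "module_hom free_scale free_scale (transfer m)"
  by unfold_locales (simp_all add: transfer_add transfer_scale)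

lemmas transfer_sum = module_hom.sum[OF transfer_hom]

lemma transfer_tensors: "m \<le> d \<Longrightarrow> x \<in> tensors \<Longrightarrow> transfer m x \<in> tensors"
proof (induction arbitrary: x rule: inc_induct)
  case (step m)
  then show ?case by (simp add: transfer_Suc transfer1_tensors)
qed simp

text \<open>Right multiplication by \<open>\<sigma>\<close> permutes the cosets of the smaller
  symmetric group in the larger one, so it permutes the summands of
  \<open>transfer1 m x\<close>.\<close>

lemma transfer1_invar:
  assumes m: "m < d" and x: "x \<in> tensors" "invar m x"
  shows "invar (Suc m) (transfer1 m x)"
  unfolding invar_def
proof (intro allI impI)
  fix \<sigma> assume \<sigma>: "\<sigma> permutes {..<Suc m}"
  let ?t = "\<lambda>i. Transposition.transpose i m"
  have \<sigma>d: "\<sigma> permutes {..<d}" using \<sigma> m by (rule_tac permutes_le) auto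
  have step: "act \<sigma> (act (?t i) x) = act (?t (pinv \<sigma> i)) x" if i: "i \<le> m" for i
  proof -
    \<comment> \<open>\<open>?\<rho>\<close> measures how far \<open>?t i \<circ> \<sigma>\<close>
      is from the representative of its coset. It fixes \<open>m\<close>, so it lies in the smaller
      group and leaves \<open>x\<close> unchanged.\<close>
    let ?i = "pinv \<sigma> i" and ?\<rho> = "?t i \<circ> \<sigma> \<circ> ?t (pinv \<sigma> i)"
    have i': "?i \<le> m" using permutes_in_image[OF permutes_inv[OF \<sigma>], of i] i by (simp add: less_Suc_eq_le)
    have "?\<rho> permutes {..<Suc m}"
      using i i' m by (intro permutes_compose \<sigma> transpose_permutes)
    moreover have "?\<rho> m = m" using permutes_inverses(1)[OF \<sigma>] by simp
    ultimately have "?\<rho> permutes {..<m}"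
      by (rule_tac permutes_superset[where S = "{..<Suc m}"]) (auto simp: less_Suc_eq)
    then have "act ?\<rho> x = x" and \<rho>: "?\<rho> permutes {..<d}"
      using x(2) m permutes_le[of _ m d] by (auto simp: invar_def)
    have "act \<sigma> (act (?t i) x) = act (?t i \<circ> \<sigma>) x"
      using i m \<sigma>d x by (intro act_act transpose_permutes_d)
    also have "?t i \<circ> \<sigma> = ?\<rho> \<circ> ?t ?i" by (simp add: comp_assoc)
    also have "act (?\<rho> \<circ> ?t ?i) x = act (?t ?i) (act ?\<rho> x)"
      using i' m \<rho> x by (intro act_act[symmetric] transpose_permutes_d)
    finally show ?thesis by (simp add: \<open>act ?\<rho> x = x\<close>)
  qed
  have "act \<sigma> (transfer1 m x) = (\<Sum>i\<le>m. act (?t (pinv \<sigma> i)) x)"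
    by (simp add: transfer1_def act_sum step)
  also have "\<dots> = (\<Sum>i\<le>m. act (?t i) x)"
    using sum.permute[OF permutes_inv[OF \<sigma>], of "\<lambda>i. act (?t i) x"]
    by (simp add: lessThan_Suc_atMost comp_def)
  finally show "act \<sigma> (transfer1 m x) = transfer1 m x" by (simp add: transfer1_def)
qed

lemma transfer_invar: "m \<le> d \<Longrightarrow> x \<in> tensors \<Longrightarrow> invar m x \<Longrightarrow> invar d (transfer m x)"
proof (induction arbitrary: x rule: inc_induct)
  case (step m)
  then show ?case by (simp add: transfer_Suc transfer1_tensors transfer1_invar)
qed simp

text \<open>The projection formula for transfers: every coset representative acts by an automorphism
  and fixes \<open>y\<close>, so \<open>y\<close> can be pulled out of the sum.\<close>

lemma tmul_transfer1:
  assumes m: "m < d" and "x \<in> tensors" "y \<in> tensors" "invar (Suc m) y"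
  shows "tmul y (transfer1 m x) = transfer1 m (tmul y x)" "tmul (transfer1 m x) y = transfer1 m (tmul x y)"
proof -
  have y: "act (Transposition.transpose i m) y = y" if "i \<le> m" for i
    using assms(4) transpose_permutes[OF that m] by (simp add: invar_def)
  show "tmul y (transfer1 m x) = transfer1 m (tmul y x)" "tmul (transfer1 m x) y = transfer1 m (tmul x y)"
    using assms by (simp_all add: transfer1_def tmul_sum_right tmul_sum_left act_tmul transpose_permutes_d y)
qed

lemma tmul_transfer:
  "m \<le> d \<Longrightarrow> x \<in> tensors \<Longrightarrow> y \<in> tensors \<Longrightarrow> invar d y \<Longrightarrow> tmul y (transfer m x) = transfer m (tmul y x)"
proof (induction arbitrary: x rule: inc_induct)
  case (step m)
  then have "invar (Suc m) y" using invar_mono[of "Suc m" d y] by simp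
  with step show ?case by (simp add: transfer_Suc transfer1_tensors tmul_transfer1)
qed simp

section \<open>Sums of insertions\<close>

definition inssum :: "'v \<Rightarrow> ('v list \<Rightarrow>\<^sub>0 'k)" where
  "inssum v = (\<Sum>i<d. ins i v)"

lemma inssum_tensors: "inssum v \<in> tensors"
  unfolding inssum_def by (rule free.subspace_sum[OF subspace_tensors]) simp

lemma inssum_invar: "invar d (inssum v)"
  unfolding invar_def
proof (intro allI impI)
  fix \<sigma> assume \<sigma>: "\<sigma> permutes {..<d}"
  have "act \<sigma> (inssum v) = (\<Sum>i<d. ins (pinv \<sigma> i) v)"
    using \<sigma> by (simp add: inssum_def act_sum act_ins)
  also have "\<dots> = inssum v"
    using sum.permute[OF permutes_inv[OF \<sigma>], of "\<lambda>i. ins i v"] by (simp add: inssum_def comp_def)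
  finally show "act \<sigma> (inssum v) = inssum v" .
qed

lemma ins_invar:
  assumes "m \<le> i" "i < d"
  shows "invar m (ins i v)"
  unfolding invar_def
proof (intro allI impI)
  fix \<sigma> assume \<sigma>: "\<sigma> permutes {..<m}"
  have "pinv \<sigma> i = i" using permutes_not_in[OF permutes_inv[OF \<sigma>], of i] assms by simp
  then show "act \<sigma> (ins i v) = ins i v"
    using act_ins[OF permutes_le[OF \<sigma>]] assms by simp
qed

text \<open>The transposition of \<open>i\<close> and \<open>m\<close> carries the insertion from
  slot \<open>m\<close> to slot \<open>i\<close>.\<close>

lemma transfer1_ins: "m < d \<Longrightarrow> transfer1 m (ins m v) = (\<Sum>i\<le>m. ins i v)"
  unfolding transfer1_def
  by (rule sum.cong) (simp_all add: act_ins transpose_permutes_d permutes_inv_eq[OF transpose_permutes_d] inv_unique_comp)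

text \<open>The insertions into the slots up to \<open>m\<close> together form one transfer, so by
  the projection formula their product with \<open>x\<close> is a transfer from one level below. The
  remaining insertions stay at the level of \<open>x\<close>.\<close>

lemma tmul_inssum:
  assumes m: "m < d" and x: "x \<in> tensors" "invar (Suc m) x"
  shows "tmul (inssum v) x = transfer1 m (tmul (ins m v) x) + (\<Sum>i=Suc m..<d. tmul (ins i v) x)"
proof -
  have "{..<d} = {..m} \<union> {Suc m..<d}" "{..m} \<inter> {Suc m..<d} = {}" using m by auto
  then have "inssum v = transfer1 m (ins m v) + (\<Sum>i=Suc m..<d. ins i v)"
    by (simp add: inssum_def sum.union_disjoint transfer1_ins m)
  then show ?thesis
    using tmul_transfer1(2)[OF m ins_tensors x] by (simp add: tmul_add_left tmul_sum_left)
qed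

text \<open>These are the modules \<open>U\<^sub>m\<close> of the overview; the slots from
  \<open>m\<close> on are neither restricted nor symmetrised.\<close>

definition prefix_inv :: "nat \<Rightarrow> ('v list \<Rightarrow>\<^sub>0 'k) set" where
  "prefix_inv m = {x \<in> prefix m. invar m x}"

lemma prefix_inv_tensors: "x \<in> prefix_inv m \<Longrightarrow> x \<in> tensors"
  using prefix_subset_tensors by (auto simp: prefix_inv_def)

lemma prefix_inv_mono: "m' \<le> m \<Longrightarrow> prefix_inv m \<subseteq> prefix_inv m'"
  unfolding prefix_inv_def using prefix_mono invar_mono by blast

lemma tmul_prefix:
  assumes x: "x \<in> prefix d" and y: "y \<in> prefix m"
  shows "tmul x y \<in> prefix m"
proof (rule prefix_induct[OF x, where P = "\<lambda>x. tmul x y \<in> prefix m"])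
  show "free.subspace {x. tmul x y \<in> prefix m}"
    by (rule module_hom.subspace_linear_preimage[OF tmul_hom_left subspace_prefix])
  fix w assume w: "length w = d" "\<And>i. i < d \<Longrightarrow> i < d \<Longrightarrow> w ! i \<in> Va"
  show "tmul (pt w) y \<in> prefix m"
  proof (rule prefix_induct[OF y, where P = "\<lambda>y. tmul (pt w) y \<in> prefix m"])
    show "free.subspace {y. tmul (pt w) y \<in> prefix m}"
      by (rule module_hom.subspace_linear_preimage[OF tmul_hom_right subspace_prefix])
    fix v assume v: "length v = d" "\<And>i. i < d \<Longrightarrow> i < m \<Longrightarrow> v ! i \<in> Va"
    have "set w \<subseteq> gr 0" using w Va_even by (metis in_set_conv_nth subset_iff)
    then have "tmul (pt w) (pt v) = pt (map2 mul w v)" using w v by (simp add: tmul_even_pt)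
    also have "\<dots> \<in> prefix m" using w v by (intro pt_prefix) (auto intro: Va_mul)
    finally show "tmul (pt w) (pt v) \<in> prefix m" .
  qed
qed

lemma tmul_prefix_inv: "m \<le> d \<Longrightarrow> x \<in> prefix_inv d \<Longrightarrow> y \<in> prefix_inv m \<Longrightarrow> tmul x y \<in> prefix_inv m"
  using prefix_inv_mono[of m d] by (auto simp: prefix_inv_def intro!: tmul_prefix invar_tmul dest: subsetD[OF prefix_subset_tensors])

lemma tmul_ins_prefix:
  assumes "m \<le> i" "i < d" "x \<in> prefix m"
  shows "tmul (ins i v) x \<in> prefix m"
proof -
  have hom: "tmul (ins i v) x \<in> prefix m" if v: "v \<in> gr a" for a v
  proof (rule prefix_induct[OF assms(3), where P = "\<lambda>x. tmul (ins i v) x \<in> prefix m"])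
    show "free.subspace {x. tmul (ins i v) x \<in> prefix m}"
      by (rule module_hom.subspace_linear_preimage[OF tmul_hom_right subspace_prefix])
    fix e w assume w: "length w = d" "homogeneous e w" "\<And>i. i < d \<Longrightarrow> i < m \<Longrightarrow> w ! i \<in> Va"
    obtain c where "tmul (ins i v) (pt w) = free_scale c (pt (w[i := mul v (w ! i)]))"
      using tmul_ins_pt[OF assms(2) w(1,2) v] by blast
    also have "\<dots> \<in> prefix m"
      using w assms(1) by (intro free.subspace_scale[OF subspace_prefix] pt_prefix) (auto simp: nth_list_update)
    finally show "tmul (ins i v) (pt w) \<in> prefix m" .
  qed
  have "tmul (ins i (homogeneous_part gr 0 v + homogeneous_part gr 1 v)) x \<in> prefix m"
    using assms(2) hom[OF homogeneous_part_mem(1)]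
    by (auto simp: ins_add tmul_add_left intro!: free.subspace_add[OF subspace_prefix])
  then show ?thesis by (simp only: homogeneous_part_sum)
qed

lemma tmul_ins_prefix_inv: "m \<le> i \<Longrightarrow> i < d \<Longrightarrow> x \<in> prefix_inv m \<Longrightarrow> tmul (ins i v) x \<in> prefix_inv m"
  by (auto simp: prefix_inv_def intro!: tmul_ins_prefix invar_tmul ins_invar dest: subsetD[OF prefix_subset_tensors])

definition transfers :: "('v list \<Rightarrow>\<^sub>0 'k) set" where
  "transfers = free.span (\<Union>m\<le>d. transfer m ` prefix_inv m)"

lemma subspace_transfers: "free.subspace transfers"
  by (simp add: transfers_def)

lemma transfer_transfers: "m \<le> d \<Longrightarrow> x \<in> prefix_inv m \<Longrightarrow> transfer m x \<in> transfers"
  unfolding transfers_def by (intro free.span_base) auto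

lemma transfers_tensors: "transfers \<subseteq> tensors"
  unfolding transfers_def
  by (rule free.span_minimal[OF _ subspace_tensors]) (auto intro: transfer_tensors prefix_inv_tensors)

lemma transfers_invar: "x \<in> transfers \<Longrightarrow> invar d x"
proof -
  assume "x \<in> transfers"
  moreover have "transfers \<subseteq> {x. invar d x}"
    unfolding transfers_def
    by (rule free.span_minimal[OF _ subspace_invar]) (auto intro!: transfer_invar intro: prefix_inv_tensors simp: prefix_inv_def)
  ultimately show ?thesis by blast
qed

lemma tmul_transfers:
  assumes y: "y \<in> prefix_inv d \<union> range inssum" and x: "x \<in> transfers"
  shows "tmul y x \<in> transfers"
proof -
  have "transfers \<subseteq> {x. tmul y x \<in> transfers}"
    unfolding transfers_def
  proof (rule free.span_minimal)
    show "free.subspace {x. tmul y x \<in> free.span (\<Union>m\<le>d. transfer m ` prefix_inv m)}"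
      by (rule module_hom.subspace_linear_preimage[OF tmul_hom_right free.subspace_span])
    have "tmul y (transfer m x) \<in> transfers" if m: "m \<le> d" and x: "x \<in> prefix_inv m" for m x
      using y
    proof
      assume y: "y \<in> prefix_inv d"
      then have "tmul y (transfer m x) = transfer m (tmul y x)"
        using m x by (intro tmul_transfer prefix_inv_tensors) (auto simp: prefix_inv_def)
      then show ?thesis using m x y by (simp add: tmul_prefix_inv transfer_transfers)
    next
      assume "y \<in> range inssum"
      then obtain v where v: "y = inssum v" by blast
      have eq: "tmul y (transfer m x) = transfer m (tmul y x)"
        using m x unfolding v by (intro tmul_transfer prefix_inv_tensors inssum_tensors inssum_invar) auto
      have high: "(\<Sum>i=m..<d. transfer m (tmul (ins i v) x)) \<in> transfers"
        using m x by (intro free.subspace_sum[OF subspace_transfers] transfer_transfers tmul_ins_prefix_inv) auto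
      show ?thesis
      proof (cases m)
        case 0
        have "tmul y (transfer m x) = (\<Sum>i=m..<d. transfer m (tmul (ins i v) x))"
          unfolding eq unfolding v inssum_def by (simp add: 0 tmul_sum_left transfer_sum lessThan_atLeast0)
        with high show ?thesis by simp
      next
        case (Suc k)
        have k: "k < d" using m Suc by simp
        have "tmul y x = transfer1 k (tmul (ins k v) x) + (\<Sum>i=m..<d. tmul (ins i v) x)"
          using tmul_inssum[OF k prefix_inv_tensors[OF x], of v] x by (simp add: v Suc prefix_inv_def)
        then have "tmul y (transfer m x) =
            transfer k (tmul (ins k v) x) + (\<Sum>i=m..<d. transfer m (tmul (ins i v) x))"
          by (simp add: eq transfer_add transfer_sum transfer_Suc[OF k] flip: Suc)
        \<comment> \<open>Insertion into slot \<open>k\<close> may leave \<open>Va\<close> there, so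
          the product is only known to lie at level \<open>k\<close>, one below \<open>m\<close>.
          This is why \<open>transfers\<close> has to collect all levels.\<close>
        moreover have "tmul (ins k v) x \<in> prefix_inv k"
          using x prefix_inv_mono[of k m] k Suc by (intro tmul_ins_prefix_inv) auto
        ultimately show ?thesis
          using high k by (auto intro!: free.subspace_add[OF subspace_transfers] transfer_transfers)
      qed
    qed
    then show "(\<Union>m\<le>d. transfer m ` prefix_inv m) \<subseteq> {x. tmul y x \<in> free.span (\<Union>m\<le>d. transfer m ` prefix_inv m)}"
      unfolding transfers_def by auto
  qed
  with x show ?thesis by blast
qed

end


section \<open>Generation\<close>

lemma permute_list_append_prefix:
  assumes "\<sigma> permutes {..<length xs}"
  shows "permute_list \<sigma> (xs @ ys) = permute_list \<sigma> xs @ ys"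
proof (rule nth_equalityI)
  fix i assume i: "i < length (permute_list \<sigma> (xs @ ys))"
  have \<sigma>: "\<sigma> permutes {..<length (xs @ ys)}" by (rule permutes_subset[OF assms]) auto
  show "permute_list \<sigma> (xs @ ys) ! i = (permute_list \<sigma> xs @ ys) ! i"
  proof (cases "i < length xs")
    case True
    then have "\<sigma> i < length xs" using permutes_in_image[OF assms, of i] by simp
    with True i show ?thesis by (simp add: permute_list_nth[OF \<sigma>] permute_list_nth[OF assms] nth_append)
  next
    case False
    then have "\<sigma> i = i" using permutes_not_in[OF assms, of i] by simp
    with False i show ?thesis by (simp add: permute_list_nth[OF \<sigma>] nth_append)
  qed
qed simp

lemma permute_list_permutations:
  assumes \<sigma>: "\<sigma> permutes {..<size M}"
  shows "bij_betw (permute_list \<sigma>) (permutations_of_multiset M) (permutations_of_multiset M)"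
proof (rule bij_betw_byWitness[where f' = "permute_list (pinv \<sigma>)"])
  have inv: "permute_list \<tau> (permute_list \<rho> w) = w"
    if "\<rho> \<circ> \<tau> = id" "\<tau> permutes {..<size M}" "w \<in> permutations_of_multiset M" for \<rho> \<tau> and w :: "'a list"
    using permute_list_compose[of \<tau> w \<rho>] that length_finite_permutations_of_multiset[of w M] by simp
  have mem: "permute_list \<tau> w \<in> permutations_of_multiset M"
    if "\<tau> permutes {..<size M}" "w \<in> permutations_of_multiset M" for \<tau> and w :: "'a list"
    using that by (auto simp: permutations_of_multiset_def)
  show "\<forall>w\<in>permutations_of_multiset M. permute_list (pinv \<sigma>) (permute_list \<sigma> w) = w"
    "\<forall>w\<in>permutations_of_multiset M. permute_list \<sigma> (permute_list (pinv \<sigma>) w) = w"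
    using inv[of \<sigma> "pinv \<sigma>"] inv[of "pinv \<sigma>" \<sigma>] permutes_inv_o[OF \<sigma>] permutes_inv[OF \<sigma>] \<sigma> by auto
  show "permute_list \<sigma> ` permutations_of_multiset M \<subseteq> permutations_of_multiset M"
    "permute_list (pinv \<sigma>) ` permutations_of_multiset M \<subseteq> permutations_of_multiset M"
    using mem \<sigma> permutes_inv[OF \<sigma>] by blast+
qed

text \<open>Cutting a rearrangement of \<open>N\<close> after \<open>m\<close> letters leaves as
  tail any word of length \<open>n\<close> whose letters are available in \<open>N\<close>, and as
  head any rearrangement of what remains. This is the coproduct of a product of divided powers,
  written out on words.\<close>

lemma sum_permutations_of_multiset_split:
  fixes N :: "'a multiset"
  assumes "size N = m + n"
  shows "(\<Sum>w\<in>permutations_of_multiset N. F (take m w) (drop m w)) =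
    (\<Sum>w2\<in>{w2. length w2 = n \<and> mset w2 \<subseteq># N}. \<Sum>w1\<in>permutations_of_multiset (N - mset w2). F w1 w2)"
proof -
  let ?L = "{w2. length w2 = n \<and> mset w2 \<subseteq># N}"
  have fin: "finite ?L"
    by (rule finite_subset[OF _ finite_lists_length_eq[of "set_mset N" n]])
       (auto dest: mset_subset_eqD)
  have "(\<Sum>w2\<in>?L. \<Sum>w1\<in>permutations_of_multiset (N - mset w2). F w1 w2) =
      (\<Sum>(w2, w1)\<in>(SIGMA w2:?L. permutations_of_multiset (N - mset w2)). F w1 w2)"
    using fin by (simp add: sum.Sigma)
  also have "\<dots> = (\<Sum>w\<in>permutations_of_multiset N. F (take m w) (drop m w))"
  proof (rule sum.reindex_bij_witness[where i = "\<lambda>w. (drop m w, take m w)" and j = "\<lambda>(w2, w1). w1 @ w2"])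
    fix p assume p: "p \<in> (SIGMA w2:?L. permutations_of_multiset (N - mset w2))"
    obtain w2 w1 where pp: "p = (w2, w1)" by (cases p)
    have w: "length w2 = n" "mset w2 \<subseteq># N" "mset w1 = N - mset w2"
      using p by (auto simp: pp permutations_of_multiset_def)
    have "length w1 = m" using w assms by (metis add_diff_cancel_right' size_Diff_submset size_mset)
    then show "(drop m (case p of (w2, w1) \<Rightarrow> w1 @ w2), take m (case p of (w2, w1) \<Rightarrow> w1 @ w2)) = p"
      "F (take m (case p of (w2, w1) \<Rightarrow> w1 @ w2)) (drop m (case p of (w2, w1) \<Rightarrow> w1 @ w2)) = (case p of (w2, w1) \<Rightarrow> F w1 w2)"
      by (simp_all add: pp)
    show "(case p of (w2, w1) \<Rightarrow> w1 @ w2) \<in> permutations_of_multiset N"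
      using w by (auto simp: pp permutations_of_multiset_def)
  next
    fix w assume w: "w \<in> permutations_of_multiset N"
    show "(case (drop m w, take m w) of (w2, w1) \<Rightarrow> w1 @ w2) = w" by simp
    have "mset (take m w) + mset (drop m w) = N" "length w = m + n"
      using w assms length_finite_permutations_of_multiset[OF w]
      by (auto simp: permutations_of_multiset_def simp flip: mset_append)
    then show "(drop m w, take m w) \<in> (SIGMA w2:?L. permutations_of_multiset (N - mset w2))"
      by (auto simp: permutations_of_multiset_def)
  qed
  finally show ?thesis by simp
qed

section \<open>Orbit sums of words with an even head\<close>

context based_superalgebra
begin

text \<open>A pair \<open>k < l\<close> reversed by \<open>\<sigma>\<close> must have
  \<open>k < m\<close>, because \<open>\<sigma>\<close> fixes all later slots. So one of its two
  letters is even and no sign arises.\<close>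

lemma permute_sign_even_prefix:
  assumes "\<sigma> permutes {..<m}" "\<And>i. i < m \<Longrightarrow> e ! i = 0"
  shows "permute_sign \<sigma> e = (1::'k)"
  unfolding permute_sign_prod
proof (rule prod.neutral, clarify)
  fix k l assume "(k, l) \<in> pairs (length e)"
  then have kl: "k < l" by (simp add: pairs_def)
  have "k < m" if "pinv \<sigma> l < pinv \<sigma> k"
  proof (rule ccontr)
    assume "\<not> k < m"
    then have "pinv \<sigma> k = k" "pinv \<sigma> l = l"
      using permutes_not_in[OF permutes_inv[OF assms(1)]] kl by auto
    with kl that show False by simp
  qed
  then show "(if pinv \<sigma> l < pinv \<sigma> k then swap_sign (e ! k) (e ! l) else 1) = (1::'k)"
    using assms(2) by (simp add: swap_sign_def)
qed

lemma act_even_prefix: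
  assumes \<sigma>: "\<sigma> permutes {..<m}" "m \<le> d" and xs: "length xs = d" "\<And>i. i < m \<Longrightarrow> xs ! i \<in> gr 0"
  shows "act \<sigma> (pt xs) = pt (permute_list \<sigma> xs)"
proof -
  let ?T = "\<lambda>i. if i < m then gr 0 else basis"
  have \<sigma>d: "\<sigma> permutes {..<d}" using permutes_le \<sigma> by blast
  show ?thesis
  proof (rule multilinear_eqI[where f = "\<lambda>xs. act \<sigma> (pt xs)" and T = ?T, OF _ _ xs(1)])
    show "multilinear scl d (\<lambda>xs. act \<sigma> (pt xs))" by (rule multilinear_hom[OF act_hom pt_multilinear])
    show "multilinear scl d (\<lambda>xs. pt (permute_list \<sigma> xs))" by (rule multilinear_permute_list[OF pt_multilinear \<sigma>d])
    show "xs ! i \<in> span (?T i)" if "i < d" for i using xs(2)[of i] by (auto simp: spanning intro: span_base)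
    fix ys assume ys: "length ys = d" "\<And>i. i < d \<Longrightarrow> ys ! i \<in> ?T i"
    let ?e = "map (\<lambda>x. if x \<in> gr 0 then 0 else 1) ys"
    have "ys ! i \<in> gr 0 \<or> ys ! i \<in> gr 1" if "i < d" for i
      using ys(2)[OF that] even odd by (auto split: if_splits)
    then have hom: "homogeneous ?e ys"
      unfolding homogeneous_def list_all2_conv_all_nth using ys(1) by fastforce
    have "?e ! i = 0" if "i < m" for i
      using ys(1) ys(2)[of i] that \<sigma>(2) by simp
    then have "permute_sign \<sigma> ?e = (1::'k)" by (rule permute_sign_even_prefix[OF \<sigma>(1)])
    then show "act \<sigma> (pt ys) = pt (permute_list \<sigma> ys)" using act_pt[OF hom ys(1) \<sigma>d] by simp
  qed
qed

text \<open>With \<open>f\<close> sending formal letters to \<open>V\<close>, this is the product of the divided powers of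
  the letters of \<open>M\<close> (in the shuffle algebra), followed by \<open>ys\<close>.\<close>

definition orb :: "('b \<Rightarrow> 'v) \<Rightarrow> 'b multiset \<Rightarrow> 'v list \<Rightarrow> ('v list \<Rightarrow>\<^sub>0 'k)" where
  "orb f M ys = (\<Sum>w\<in>permutations_of_multiset M. pt (map f w @ ys))"

text \<open>Letters from \<open>Va\<close> are even and are permuted without signs, so
  \<open>\<sigma>\<close> merely permutes the summands.\<close>

lemma orb_prefix_inv:
  assumes M: "\<And>x. x \<in># M \<Longrightarrow> f x \<in> Va" and len: "size M + length ys = d"
  shows "orb f M ys \<in> prefix_inv (size M)"
proof -
  have w: "length w = size M" "\<And>i. i < size M \<Longrightarrow> f (w ! i) \<in> Va" if "w \<in> permutations_of_multiset M" for w
  proof -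
    show l: "length w = size M" by (rule length_finite_permutations_of_multiset[OF that])
    have "set w = set_mset M" using that by (auto simp: permutations_of_multiset_def)
    then show "f (w ! i) \<in> Va" if "i < size M" for i using M l that by (metis nth_mem)
  qed
  have "orb f M ys \<in> prefix (size M)"
    unfolding orb_def using len
    by (intro free.subspace_sum[OF subspace_prefix] pt_prefix) (simp_all add: nth_append w)
  moreover have "invar (size M) (orb f M ys)"
    unfolding invar_def
  proof (intro allI impI)
    fix \<sigma> assume \<sigma>: "\<sigma> permutes {..<size M}"
    have "act \<sigma> (pt (map f v @ ys)) = pt (map f (permute_list \<sigma> v) @ ys)" if v: "v \<in> permutations_of_multiset M" for v
    proof -
      have "act \<sigma> (pt (map f v @ ys)) = pt (permute_list \<sigma> (map f v @ ys))"
        using len w[OF v] Va_even by (intro act_even_prefix[OF \<sigma>]) (auto simp: nth_append)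
      then show ?thesis
        using \<sigma> w(1)[OF v] by (simp add: permute_list_append_prefix permute_list_map)
    qed
    then have "act \<sigma> (orb f M ys) = (\<Sum>v\<in>permutations_of_multiset M. pt (map f (permute_list \<sigma> v) @ ys))"
      by (simp add: orb_def act_sum)
    also have "\<dots> = orb f M ys"
      unfolding orb_def by (rule sum.reindex_bij_betw[OF permute_list_permutations[OF \<sigma>]])
    finally show "act \<sigma> (orb f M ys) = orb f M ys" .
  qed
  ultimately show ?thesis by (simp add: prefix_inv_def)
qed

lemma pt_units_prefix_inv:
  assumes "length xs = d" "m \<le> d" "\<And>i. i < m \<Longrightarrow> xs ! i = unit"
  shows "pt xs \<in> prefix_inv m"
proof -
  have "act \<sigma> (pt xs) = pt xs" if \<sigma>: "\<sigma> permutes {..<m}" for \<sigma>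
  proof -
    have "permute_list \<sigma> xs = xs"
    proof (rule nth_equalityI)
      fix i assume "i < length (permute_list \<sigma> xs)"
      then show "permute_list \<sigma> xs ! i = xs ! i"
        using permutes_le[OF \<sigma> assms(2)] permutes_in_image[OF \<sigma>, of i] permutes_not_in[OF \<sigma>, of i] assms
        by (cases "i < m") (simp_all add: permute_list_nth)
    qed simp
    then show ?thesis using act_even_prefix[OF \<sigma> assms(2,1)] assms(3) unit_even by simp
  qed
  then show ?thesis using assms unit_mem by (simp add: prefix_inv_def invar_def pt_prefix)
qed

section \<open>Elements forced into a subalgebra by the generators\<close>

context
  fixes C :: "('v list \<Rightarrow>\<^sub>0 'k) set"
  assumes sub: "free.subspace C" and mult: "x \<in> C \<Longrightarrow> y \<in> C \<Longrightarrow> tmul x y \<in> C"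
    and prefix_inv_C: "prefix_inv d \<subseteq> C" and inssum_C: "inssum v \<in> C"
begin

text \<open>Downward induction on the number \<open>m\<close> of leading units, starting from the
  all-unit tensor, which lies in \<open>prefix_inv d\<close>. The letter wanted in slot
  \<open>m\<close> is first replaced by a unit and then put back by \<open>inssum\<close>.\<close>

lemma transfer_pt_units_mem:
  assumes "m \<le> d" "length xs = d" "\<And>i. i < m \<Longrightarrow> xs ! i = unit"
  shows "transfer m (pt xs) \<in> C"
  using assms
proof (induction arbitrary: xs rule: inc_induct)
  case base
  then show ?case using pt_units_prefix_inv[of xs d] prefix_inv_C by auto
next
  case (step m)
  \<comment> \<open>By multilinearity the letters after the units may be taken from the basis. They
    are then homogeneous, and inserting them costs only a sign.\<close>
  let ?T = "\<lambda>i. if i < m then {unit} else basis"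
  have *: "transfer m (pt xs) \<in> C" if xs: "length xs = d" "\<And>i. i < d \<Longrightarrow> xs ! i \<in> ?T i" for xs
  proof -
    define v X where "v = xs ! m" and "X = xs[m := unit]"
    have hom: "\<exists>a. x \<in> gr a" if "x \<in> insert unit basis" for x
      using that even odd unit_even by blast
    have xi: "xs ! i \<in> insert unit basis" if "i < d" for i using xs(2)[OF that] by (auto split: if_splits)
    have Xi: "X ! i \<in> insert unit basis" if "i < d" for i
      using xi[OF that] that xs(1) by (cases "i = m") (simp_all add: X_def)
    obtain a where a: "v \<in> gr a" using hom xi[OF step.hyps(2)] unfolding v_def by blast
    have X: "length X = d" by (simp add: X_def xs(1))
    have Xu: "X ! i = unit" if "i < Suc m" for i
      using xs(2)[of i] xs(1) that step.hyps(2) by (cases "i = m") (simp_all add: X_def)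
    obtain e where e: "homogeneous e X"
    proof -
      have "\<forall>i<d. \<exists>b. X ! i \<in> gr b" using hom Xi by blast
      then obtain b where "\<forall>i<d. X ! i \<in> gr (b i)" by metis
      then have "homogeneous (map b [0..<d]) X" using X by (simp add: homogeneous_def list_all2_conv_all_nth)
      then show thesis by (rule that)
    qed
    have prefix_inv: "pt X \<in> prefix_inv (Suc m)" using X Xu step.hyps by (intro pt_units_prefix_inv) auto
    \<comment> \<open>Insertion into a slot beyond \<open>m\<close> keeps the units in all slots up
      to \<open>m\<close>, so the induction hypothesis applies.\<close>
    have inC: "transfer (Suc m) (tmul (ins i v) (pt X)) \<in> C" if "i \<in> {Suc m..<d}" for i
    proof -
      have "i < d" using that by simp
      from tmul_ins_pt[OF this X e a]
      obtain c where "tmul (ins i v) (pt X) = free_scale c (pt (X[i := mul v (X ! i)]))" by blast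
      moreover have "transfer (Suc m) (pt (X[i := mul v (X ! i)])) \<in> C"
        using X Xu that by (intro step.IH) auto
      ultimately show ?thesis by (simp add: transfer_scale free.subspace_scale[OF sub])
    qed
    have "tmul (inssum v) (transfer (Suc m) (pt X)) \<in> C"
      using X Xu by (intro mult inssum_C step.IH) auto
    also have "tmul (inssum v) (transfer (Suc m) (pt X)) = transfer (Suc m) (tmul (inssum v) (pt X))"
      using step.hyps X by (intro tmul_transfer inssum_tensors inssum_invar pt_tensors) auto
    also have "tmul (inssum v) (pt X) = transfer1 m (tmul (ins m v) (pt X)) + (\<Sum>i=Suc m..<d. tmul (ins i v) (pt X))"
      using prefix_inv by (intro tmul_inssum[OF step.hyps(2)]) (auto simp: prefix_inv_def X)
    also have "transfer (Suc m) \<dots> = transfer m (tmul (ins m v) (pt X)) +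
        (\<Sum>i=Suc m..<d. transfer (Suc m) (tmul (ins i v) (pt X)))"
      by (simp add: transfer_add transfer_sum transfer_Suc[OF step.hyps(2)])
    finally have "transfer m (tmul (ins m v) (pt X)) + (\<Sum>i=Suc m..<d. transfer (Suc m) (tmul (ins i v) (pt X))) -
        (\<Sum>i=Suc m..<d. transfer (Suc m) (tmul (ins i v) (pt X))) \<in> C"
      by (intro free.subspace_diff[OF sub] free.subspace_sum[OF sub] inC)
    then have 1: "transfer m (tmul (ins m v) (pt X)) \<in> C" by simp
    obtain c where c: "c * c = 1" "tmul (ins m v) (pt X) = free_scale c (pt (X[m := mul v (X ! m)]))"
      using tmul_ins_pt[OF step.hyps(2) X e a] by blast
    have "X[m := mul v (X ! m)] = xs" using xs(1) step.hyps(2) by (simp add: X_def v_def unit_mul)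
    then have "transfer m (tmul (ins m v) (pt X)) = free_scale c (transfer m (pt xs))"
      by (simp add: c(2) transfer_scale)
    \<comment> \<open>The sign \<open>c\<close> is its own inverse, so scaling by it again removes
      it.\<close>
    with 1 have "free_scale c (free_scale c (transfer m (pt xs))) \<in> C"
      by (simp add: free.subspace_scale[OF sub] del: free.scale_scale)
    then show ?thesis by (simp add: c(1))
  qed
  have "transfer m (pt xs) \<in> free.span {transfer m (pt ys) |ys. length ys = d \<and> (\<forall>i<d. ys ! i \<in> ?T i)}"
    using step.prems
    by (intro multilinear_in_span[where f = "\<lambda>xs. transfer m (pt xs)"] multilinear_hom[OF transfer_hom pt_multilinear])
       (auto simp: spanning intro: span_base)
  also have "\<dots> \<subseteq> C" by (rule free.span_minimal[OF _ sub]) (use * in blast)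
  finally show ?case .
qed

text \<open>Filling \<open>M\<close> up with \<open>n\<close> formal units \<open>None\<close> gives
  an orbit sum over all \<open>d\<close> slots, an element of \<open>prefix_inv d\<close>. In its
  product with the transfer of leading units followed by \<open>ys\<close>, the letters meeting
  \<open>ys\<close> are any \<open>n\<close> letters of \<open>?N\<close>: if all are
  \<open>None\<close>, the wanted term arises; otherwise a genuine letter has left the head and the
  induction measure drops.\<close>

lemma transfer_orb_option_mem:
  fixes M :: "'v option multiset"
  assumes "\<And>x. x \<in># M \<Longrightarrow> case_option unit id x \<in> Va" "size M + length ys = d"
  shows "transfer (size M) (orb (case_option unit id) M ys) \<in> C"
  using assms
proof (induction "size (filter_mset (\<lambda>x. x \<noteq> None) M)" arbitrary: M ys rule: less_induct)
  case less
  define m n where "m = size M" and "n = d - m"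
  let ?f = "case_option unit id :: 'v option \<Rightarrow> 'v"
  let ?P = "filter_mset (\<lambda>x :: 'v option. x \<noteq> None)"
  let ?N = "M + replicate_mset n None"
  let ?L = "{w2. length w2 = n \<and> mset w2 \<subseteq># ?N}"
  let ?w = "replicate n None"
  have md: "m \<le> d" "length ys = n" "size ?N = m + n" "m + n = d"
    using less.prems(2) by (simp_all add: m_def n_def)
  have fin: "finite ?L"
    by (rule finite_subset[OF _ finite_lists_length_eq[of "set_mset ?N" n]])
       (auto dest: mset_subset_eqD)
  have N: "?f x \<in> Va" if "x \<in># ?N" for x
    using less.prems(1) that unit_mem by (auto split: if_splits)
  have Y: "orb ?f ?N [] \<in> prefix_inv d" using orb_prefix_inv[where M = ?N and f = ?f and ys = "[]"] N md by simp
  define us where "us = replicate m unit @ ys"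
  have us: "length us = d" using md by (simp add: us_def)
  have X: "transfer m (pt us) \<in> C"
    by (rule transfer_pt_units_mem[OF md(1) us]) (simp add: us_def nth_append)
  have "tmul (orb ?f ?N []) (transfer m (pt us)) = transfer m (tmul (orb ?f ?N []) (pt us))"
    using Y md us by (intro tmul_transfer pt_tensors prefix_inv_tensors[OF Y]) (simp_all add: prefix_inv_def)
  \<comment> \<open>All letters on the left are even, so the product is slotwise: the head of each
    rearrangement meets units, its tail meets \<open>ys\<close>.\<close>
  also have "tmul (orb ?f ?N []) (pt us) =
      (\<Sum>w\<in>permutations_of_multiset ?N. pt (map ?f (take m w) @ map2 mul (map ?f (drop m w)) ys))"
    unfolding orb_def tmul_sum_left
  proof (rule sum.cong[OF refl])
    fix w assume w: "w \<in> permutations_of_multiset ?N"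
    have lw: "length w = m + n" using length_finite_permutations_of_multiset[OF w] md by simp
    have "set w = set_mset ?N" using permutations_of_multisetD[OF w] by (metis set_mset_mset)
    then have "set (map ?f w) \<subseteq> Va" using N by (metis image_subsetI list.set_map)
    then have "set (map ?f w) \<subseteq> gr 0" using Va_even by (rule subset_trans)
    then have "tmul (pt (map ?f w @ [])) (pt us) = pt (map2 mul (map ?f w) us)"
      using us lw md by (simp add: tmul_even_pt)
    also have "map2 mul (map ?f w) us = map2 mul (map ?f (take m w @ drop m w)) us" by simp
    also have "\<dots> = map2 mul (map ?f (take m w)) (replicate m unit) @ map2 mul (map ?f (drop m w)) ys"
      unfolding us_def map_append using lw by (subst zip_append) simp_all
    also have "map2 mul (map ?f (take m w)) (replicate m unit) = map ?f (take m w)"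
      using lw by (auto intro!: nth_equalityI simp: unit_mul)
    finally show "tmul (pt (map ?f w @ [])) (pt us) = pt (map ?f (take m w) @ map2 mul (map ?f (drop m w)) ys)" .
  qed
  also have "\<dots> = (\<Sum>w2\<in>?L. orb ?f (?N - mset w2) (map2 mul (map ?f w2) ys))"
    unfolding orb_def by (rule sum_permutations_of_multiset_split[OF md(3)])
  \<comment> \<open>The tail made of formal units alone is split off: it leaves \<open>M\<close> as
    the head and does not change \<open>ys\<close>.\<close>
  also have "\<dots> = orb ?f (?N - mset ?w) (map2 mul (map ?f ?w) ys) +
      (\<Sum>w2\<in>?L - {?w}. orb ?f (?N - mset w2) (map2 mul (map ?f w2) ys))"
    by (rule sum.remove[OF fin]) simp
  also have "?N - mset ?w = M" by simp
  also have "map2 mul (map ?f ?w) ys = ys"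
    using md by (auto intro!: nth_equalityI simp: unit_mul)
  finally have eq: "transfer m (orb ?f M ys) = tmul (orb ?f ?N []) (transfer m (pt us)) -
      (\<Sum>w2\<in>?L - {?w}. transfer m (orb ?f (?N - mset w2) (map2 mul (map ?f w2) ys)))"
    by (simp add: transfer_add transfer_sum)
  have "transfer m (orb ?f (?N - mset w2) (map2 mul (map ?f w2) ys)) \<in> C" if w2: "w2 \<in> ?L - {?w}" for w2
  proof -
    have w2': "length w2 = n" "mset w2 \<subseteq># ?N" "w2 \<noteq> ?w" using w2 by auto
    have sz: "size (?N - mset w2) = m" using size_Diff_submset[OF w2'(2)] md w2'(1) by simp
    obtain x where "x \<in> set w2" "x \<noteq> None" using w2'(1,3) replicate_eqI[of w2 n None] by blast
    then have "x \<in># ?P (mset w2)" by simp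
    then have "?P (mset w2) \<noteq> {#}" by auto
    then have pos: "0 < size (?P (mset w2))" using nonempty_has_size by blast
    have "?P (replicate_mset k None) = {#}" for k by (induction k) auto
    then have PN: "?P ?N = ?P M" by simp
    have sub': "?P (mset w2) \<subseteq># ?P M"
      using multiset_filter_mono[OF w2'(2), of "\<lambda>x. x \<noteq> None"] unfolding PN .
    have "?P (?N - mset w2) = ?P M - ?P (mset w2)" unfolding filter_diff_mset PN ..
    then have "size (?P (?N - mset w2)) = size (?P M) - size (?P (mset w2))" "size (?P (mset w2)) \<le> size (?P M)"
      using size_Diff_submset[OF sub'] size_mset_mono[OF sub'] by simp_all
    then have "size (?P (?N - mset w2)) < size (?P M)" using pos by simp
    from less.hyps[OF this, of "map2 mul (map ?f w2) ys"] N[OF in_diffD] sz md w2'(1)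
    show ?thesis by (simp del: union_iff)
  qed
  then have "transfer m (orb ?f M ys) \<in> C"
    unfolding eq using X prefix_inv_C Y
    by (intro free.subspace_diff[OF sub] free.subspace_sum[OF sub] mult) auto
  then show ?case by (simp add: m_def)
qed

lemma transfer_orb_mem:
  assumes "set_mset M \<subseteq> Va" "size M + length ys = d"
  shows "transfer (size M) (orb (\<lambda>x. x) M ys) \<in> C"
proof -
  have "orb (case_option unit id) (image_mset Some M) ys = orb (\<lambda>x. x) M ys"
    by (simp add: orb_def permutations_of_multiset_image sum.reindex inj_on_def map_map comp_def)
  moreover have "transfer (size (image_mset Some M)) (orb (case_option unit id) (image_mset Some M) ys) \<in> C"
    using assms by (intro transfer_orb_option_mem) auto
  ultimately show ?thesis by simp
qed

end

end


section \<open>Symmetrised basis words\<close>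

definition count_fact :: "'a list \<Rightarrow> nat" where
  "count_fact w = (\<Prod>x\<in>set w. fact (count (mset w) x))"

lemma count_fact_pos: "count_fact w \<noteq> 0"
  by (simp add: count_fact_def)

lemma count_mset_card: "count (mset w) x = card {i. i < length w \<and> x = w ! i}"
  by (simp only: count_mset count_list_eq_length_filter length_filter_conv_card)

section \<open>Stabilisers and cosets for words\<close>

definition tuple_stabilizer :: "'a list \<Rightarrow> (nat \<Rightarrow> nat) set" where
  "tuple_stabilizer w = {\<tau>. \<tau> permutes {..<length w} \<and> permute_list \<tau> w = w}"

definition tuple_cosets :: "'a list \<Rightarrow> (nat \<Rightarrow> nat) set set" where
  "tuple_cosets w = {(\<lambda>\<tau>. \<tau> \<circ> \<sigma>) ` tuple_stabilizer w |\<sigma>. \<sigma> permutes {..<length w}}"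

lemma card_tuple_stabilizer: "card (tuple_stabilizer w) = count_fact w"
  unfolding tuple_stabilizer_def count_fact_def by (rule card_permute_list_fibre) simp

lemma tuple_stabilizer_compose:
  "\<rho> \<in> tuple_stabilizer w \<Longrightarrow> \<tau> \<in> tuple_stabilizer w \<Longrightarrow> \<rho> \<circ> \<tau> \<in> tuple_stabilizer w"
  by (auto simp: tuple_stabilizer_def permutes_compose permute_list_compose)

lemma tuple_stabilizer_inv: "\<tau> \<in> tuple_stabilizer w \<Longrightarrow> pinv \<tau> \<in> tuple_stabilizer w"
proof -
  assume \<tau>: "\<tau> \<in> tuple_stabilizer w"
  then have "permute_list (pinv \<tau>) (permute_list \<tau> w) = w"
    using permute_list_compose[of "pinv \<tau>" w \<tau>] permutes_inv_o[of \<tau> "{..<length w}"]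
    by (simp add: tuple_stabilizer_def permutes_inv)
  with \<tau> show ?thesis by (simp add: tuple_stabilizer_def permutes_inv)
qed

lemma tuple_coset_self: "\<sigma> \<in> (\<lambda>\<tau>. \<tau> \<circ> \<sigma>) ` tuple_stabilizer w"
  by (rule image_eqI[of _ _ id]) (simp_all add: tuple_stabilizer_def permutes_id)

lemma tuple_coset_eq:
  assumes "\<sigma> \<in> (\<lambda>\<tau>. \<tau> \<circ> \<sigma>') ` tuple_stabilizer w"
  shows "(\<lambda>\<tau>. \<tau> \<circ> \<sigma>) ` tuple_stabilizer w = (\<lambda>\<tau>. \<tau> \<circ> \<sigma>') ` tuple_stabilizer w"
proof -
  obtain \<tau> where \<tau>: "\<tau> \<in> tuple_stabilizer w" "\<sigma> = \<tau> \<circ> \<sigma>'" using assms by blast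
  have inv: "pinv \<tau> (\<tau> i) = i" for i
    using \<tau>(1) permutes_inverses(2) by (fastforce simp: tuple_stabilizer_def)
  have 1: "\<rho> \<circ> \<sigma> = (\<rho> \<circ> \<tau>) \<circ> \<sigma>'" for \<rho> :: "nat \<Rightarrow> nat"
    by (simp add: \<tau>(2) comp_assoc)
  have 2: "\<rho> \<circ> \<sigma>' = (\<rho> \<circ> pinv \<tau>) \<circ> \<sigma>" for \<rho> :: "nat \<Rightarrow> nat"
    by (simp add: \<tau>(2) fun_eq_iff inv)
  show ?thesis
  proof (intro equalityI image_subsetI)
    fix \<rho> assume "\<rho> \<in> tuple_stabilizer w"
    then show "\<rho> \<circ> \<sigma> \<in> (\<lambda>\<tau>. \<tau> \<circ> \<sigma>') ` tuple_stabilizer w"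
      unfolding 1 using \<tau>(1) by (intro imageI tuple_stabilizer_compose)
  next
    fix \<rho> assume "\<rho> \<in> tuple_stabilizer w"
    then show "\<rho> \<circ> \<sigma>' \<in> (\<lambda>\<tau>. \<tau> \<circ> \<sigma>) ` tuple_stabilizer w"
      unfolding 2 using \<tau>(1) by (intro imageI tuple_stabilizer_compose tuple_stabilizer_inv)
  qed
qed

text \<open>\<open>f\<close> is constant on each coset, and every coset has
  \<open>count_fact w\<close> elements. Thus the choice of representatives by \<open>SOME\<close>
  disappears, and up to an integer an orbit sum becomes a sum over the whole group.\<close>

lemma sum_tuple_cosets:
  fixes f :: "(nat \<Rightarrow> nat) \<Rightarrow> ('y \<Rightarrow>\<^sub>0 'k::comm_ring_1)"
  assumes f: "\<And>\<sigma> \<tau>. \<sigma> permutes {..<length w} \<Longrightarrow> \<tau> \<in> tuple_stabilizer w \<Longrightarrow> f (\<tau> \<circ> \<sigma>) = f \<sigma>"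
  shows "free_scale (of_nat (count_fact w)) (\<Sum>K\<in>tuple_cosets w. f (SOME \<sigma>. \<sigma> \<in> K)) =
    (\<Sum>\<sigma> | \<sigma> permutes {..<length w}. f \<sigma>)"
proof -
  let ?P = "{\<sigma>. \<sigma> permutes {..<length w}}"
  let ?g = "\<lambda>\<sigma>. (\<lambda>\<tau>. \<tau> \<circ> \<sigma>) ` tuple_stabilizer w"
  have cosets: "tuple_cosets w = ?g ` ?P" by (auto simp: tuple_cosets_def)
  have finP: "finite ?P" by (rule finite_permutations) simp
  have K: "(\<Sum>\<sigma>\<in>{\<sigma> \<in> ?P. ?g \<sigma> = K}. f \<sigma>) = free_scale (of_nat (count_fact w)) (f (SOME \<sigma>. \<sigma> \<in> K))"
    if "K \<in> ?g ` ?P" for K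
  proof -
    from that obtain \<pi> where "K = ?g \<pi>" "\<pi> \<in> ?P" by (rule imageE)
    then have \<pi>: "\<pi> permutes {..<length w}" "K = ?g \<pi>" by simp_all
    have sub: "K \<subseteq> ?P" using \<pi> by (auto simp: tuple_stabilizer_def intro: permutes_compose)
    have "{\<sigma> \<in> ?P. ?g \<sigma> = K} = K"
    proof (intro equalityI subsetI)
      fix \<sigma> assume "\<sigma> \<in> {\<sigma> \<in> ?P. ?g \<sigma> = K}"
      then have "?g \<sigma> = K" by simp
      then show "\<sigma> \<in> K" using tuple_coset_self[of \<sigma> w] by (rule subst)
    next
      fix \<sigma> assume \<sigma>: "\<sigma> \<in> K"
      then have "?g \<sigma> = K" unfolding \<pi>(2) by (rule tuple_coset_eq)
      moreover have "\<sigma> \<in> ?P" using sub \<sigma> by (rule subsetD)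
      ultimately show "\<sigma> \<in> {\<sigma> \<in> ?P. ?g \<sigma> = K}" by simp
    qed
    moreover have const: "f \<sigma> = f \<pi>" if "\<sigma> \<in> K" for \<sigma> using that \<pi> f by auto
    moreover have "(SOME \<sigma>. \<sigma> \<in> K) \<in> K" using tuple_coset_self \<pi>(2) by (metis someI)
    moreover have "card K = count_fact w"
      unfolding \<pi>(2) card_tuple_stabilizer[symmetric]
    proof (rule card_image, rule inj_onI)
      fix \<tau> \<rho> assume "\<tau> \<circ> \<pi> = \<rho> \<circ> \<pi>"
      then have "\<tau> \<circ> (\<pi> \<circ> pinv \<pi>) = \<rho> \<circ> (\<pi> \<circ> pinv \<pi>)" by (simp add: comp_assoc[symmetric])
      then show "\<tau> = \<rho>" using permutes_inv_o[OF \<pi>(1)] by simp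
    qed
    moreover have "(\<Sum>\<sigma>\<in>K. f \<sigma>) = (\<Sum>\<sigma>\<in>K. f \<pi>)" by (rule sum.cong) (simp_all add: const)
    ultimately show ?thesis by (simp add: free.sum_constant_scale)
  qed
  have "(\<Sum>\<sigma>\<in>?P. f \<sigma>) = (\<Sum>K\<in>?g ` ?P. \<Sum>\<sigma>\<in>{\<sigma> \<in> ?P. ?g \<sigma> = K}. f \<sigma>)"
    by (rule sum.group[symmetric]) (simp_all add: finP)
  also have "\<dots> = (\<Sum>K\<in>?g ` ?P. free_scale (of_nat (count_fact w)) (f (SOME \<sigma>. \<sigma> \<in> K)))"
    by (rule sum.cong[OF refl]) (rule K)
  finally show ?thesis by (simp add: cosets free.scale_sum_right)
qed

text \<open>Characteristic 0 enters here: a nonzero integer is a nonzero element of a domain and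
  cancels in every coordinate. Identities with divided factorials can therefore be proved after
  multiplication by them.\<close>

lemma torsion_free:
  fixes x :: "'y \<Rightarrow>\<^sub>0 'k::{idom,ring_char_0}"
  assumes "free_scale (of_nat n) x = free_scale (of_nat n) y" "n \<noteq> 0"
  shows "x = y"
proof (rule poly_mapping_eqI)
  fix k
  have "Poly_Mapping.lookup (free_scale (of_nat n) x) k = Poly_Mapping.lookup (free_scale (of_nat n) y) k"
    using assms(1) by simp
  then show "Poly_Mapping.lookup x k = Poly_Mapping.lookup y k" using assms(2) by simp
qed

definition part_fact :: "'a set \<Rightarrow> 'a list \<Rightarrow> nat" where
  "part_fact B w = (\<Prod>x\<in>B \<inter> set w. fact (count (mset w) x))"

lemma part_fact_pos: "part_fact B w \<noteq> 0"
  by (simp add: part_fact_def)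

section \<open>Full symmetrisations of words\<close>

context based_superalgebra
begin

definition symm :: "nat \<Rightarrow> ('v list \<Rightarrow>\<^sub>0 'k) \<Rightarrow> ('v list \<Rightarrow>\<^sub>0 'k)" where
  "symm m x = (\<Sum>\<sigma> | \<sigma> permutes {..<m}. act \<sigma> x)"

lemma symm_scale: "symm m (free_scale c x) = free_scale c (symm m x)"
  by (simp add: symm_def act_scale free.scale_sum_right)

lemma symm_Suc:
  assumes m: "m < d" and x: "x \<in> tensors"
  shows "symm (Suc m) x = transfer1 m (symm m x)"
proof -
  let ?t = "\<lambda>i. Transposition.transpose m i" and ?P = "{q. q permutes {..<m}}"
  have q: "q permutes {..<d}" if "q permutes {..<m}" for q using permutes_le[OF that, of d] m by simp
  have t: "?t i permutes {..<d}" if "i \<le> m" for i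
    using transpose_permutes_d[OF that m] by (simp add: transpose_commute)
  have "symm (Suc m) x = (\<Sum>p | p permutes insert m {..<m}. act p x)"
    by (simp add: symm_def lessThan_Suc)
  \<comment> \<open>The decomposition used next puts the transposition on the left. In a right
    action the factor acting last stands on the right, so inverses are taken first and undone
    afterwards.\<close>
  also have "\<dots> = (\<Sum>p | p permutes insert m {..<m}. act (pinv p) x)"
    by (rule sum_permutations_inverse)
  also have "\<dots> = (\<Sum>i\<in>insert m {..<m}. \<Sum>q\<in>?P. act (pinv (?t i \<circ> q)) x)"
    by (rule sum_over_permutations_insert) auto
  also have "\<dots> = (\<Sum>i\<le>m. \<Sum>q\<in>?P. act (?t i) (act q x))"
  proof (rule sum.cong)
    show "insert m {..<m} = {..m}" by auto
    fix i assume "i \<in> {..m}"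
    then have i: "i \<le> m" by simp
    have "(\<Sum>q\<in>?P. act (pinv (?t i \<circ> q)) x) = (\<Sum>q\<in>?P. act (?t i) (act (pinv q) x))"
    proof (rule sum.cong[OF refl])
      fix q' assume "q' \<in> ?P"
      then have q': "q' permutes {..<m}" by simp
      have "pinv (?t i \<circ> q') = pinv q' \<circ> ?t i"
        using permutes_bij[OF q'] permutes_bij[OF t[OF i]] by (simp add: o_inv_distrib)
      then show "act (pinv (?t i \<circ> q')) x = act (?t i) (act (pinv q') x)"
        using act_act[OF q[OF permutes_inv[OF q']] t[OF i] x] by simp
    qed
    also have "\<dots> = (\<Sum>q\<in>?P. act (?t i) (act q x))"
      by (rule sum_permutations_inverse[symmetric])
    finally show "(\<Sum>q\<in>?P. act (pinv (?t i \<circ> q)) x) = (\<Sum>q\<in>?P. act (?t i) (act q x))" .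
  qed
  also have "\<dots> = transfer1 m (symm m x)"
    by (simp add: transfer1_def symm_def act_sum transpose_commute[of m])
  finally show ?thesis .
qed

lemma transfer_symm: "m \<le> d \<Longrightarrow> x \<in> tensors \<Longrightarrow> transfer m (symm m x) = symm d x"
proof (induction rule: inc_induct)
  case (step m)
  then show ?case by (simp add: transfer_Suc symm_Suc)
qed simp

lemma symm_act:
  assumes \<pi>: "\<pi> permutes {..<d}" and x: "x \<in> tensors"
  shows "symm d (act \<pi> x) = symm d x"
proof -
  have "symm d (act \<pi> x) = (\<Sum>\<sigma> | \<sigma> permutes {..<d}. act (\<pi> \<circ> \<sigma>) x)"
    unfolding symm_def by (rule sum.cong) (simp_all add: act_act \<pi> x)
  also have "\<dots> = symm d x"
    unfolding symm_def by (rule setum_permutations_compose_left[symmetric]) (rule \<pi>)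
  finally show ?thesis .
qed

text \<open>The letters of \<open>w\<close> are even, so no signs arise, and every rearrangement of
  \<open>w\<close> comes from \<open>count_fact w\<close> permutations.\<close>

lemma symm_prefix:
  assumes len: "length w + length ys = d" and w: "set w \<subseteq> gr 0"
  shows "symm (length w) (pt (w @ ys)) = free_scale (of_nat (count_fact w)) (orb (\<lambda>x. x) (mset w) ys)"
proof -
  let ?P = "{\<sigma>. \<sigma> permutes {..<length w}}"
  have "symm (length w) (pt (w @ ys)) = (\<Sum>\<sigma>\<in>?P. pt (permute_list \<sigma> w @ ys))"
    unfolding symm_def
  proof (rule sum.cong[OF refl])
    fix \<sigma> assume "\<sigma> \<in> ?P"
    then have \<sigma>: "\<sigma> permutes {..<length w}" by simp
    have "(w @ ys) ! i \<in> gr 0" if "i < length w" for i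
      using w that nth_mem by (fastforce simp: nth_append)
    with act_even_prefix[OF \<sigma>, of "w @ ys"] len permute_list_append_prefix[OF \<sigma>]
    show "act \<sigma> (pt (w @ ys)) = pt (permute_list \<sigma> w @ ys)" by simp
  qed
  also have "\<dots> = (\<Sum>w'\<in>permutations_of_multiset (mset w). \<Sum>\<sigma>\<in>{\<sigma> \<in> ?P. permute_list \<sigma> w = w'}. pt (permute_list \<sigma> w @ ys))"
    by (rule sum.group[symmetric]) (auto intro: finite_permutations permutations_of_multisetI)
  also have "\<dots> = (\<Sum>w'\<in>permutations_of_multiset (mset w). free_scale (of_nat (count_fact w)) (pt (w' @ ys)))"
  proof (rule sum.cong[OF refl])
    fix w' assume "w' \<in> permutations_of_multiset (mset w)"
    then have "card {\<sigma>. \<sigma> permutes {..<length w} \<and> permute_list \<sigma> w = w'} = count_fact w"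
      unfolding count_fact_def by (intro card_permute_list_fibre permutations_of_multisetD)
    then show "(\<Sum>\<sigma>\<in>{\<sigma> \<in> ?P. permute_list \<sigma> w = w'}. pt (permute_list \<sigma> w @ ys)) =
        free_scale (of_nat (count_fact w)) (pt (w' @ ys))"
      by (simp add: free.sum_constant_scale)
  qed
  finally show ?thesis by (simp add: orb_def free.scale_sum_right)
qed

lemma transfer_orb:
  assumes "length w + length ys = d" "set w \<subseteq> gr 0"
  shows "free_scale (of_nat (count_fact w)) (transfer (length w) (orb (\<lambda>x. x) (mset w) ys)) = symm d (pt (w @ ys))"
  using transfer_symm[of "length w" "pt (w @ ys)"] symm_prefix[OF assms] assms(1)
  by (simp add: transfer_scale)

text \<open>The condition in \<open>Tri\<close>, expressed for the word of basis elements that a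
  triple determines.\<close>

definition tri :: "'v list \<Rightarrow> bool" where
  "tri w \<longleftrightarrow> length w = d \<and> set w \<subseteq> basis \<and> (\<forall>x\<in>set w. x \<notin> gr 0 \<longrightarrow> count (mset w) x = 1)"

definition parity :: "'v list \<Rightarrow> bit list" where
  "parity w = map (\<lambda>x. if x \<in> gr 0 then 0 else 1) w"

lemma homogeneous_parity:
  assumes "set w \<subseteq> basis"
  shows "homogeneous (parity w) w"
proof -
  have "w ! i \<in> gr 0 \<or> w ! i \<in> gr 1" if "i < length w" for i
    using assms even odd nth_mem[OF that] by blast
  then show ?thesis
    unfolding homogeneous_def parity_def list_all2_conv_all_nth by fastforce
qed

text \<open>Odd letters of \<open>w\<close> are pairwise distinct, so a permutation fixing the word
  fixes their slots. Hence no two odd letters change their order and the sign is 1.\<close>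

lemma act_stabilizer:
  assumes w: "tri w" and \<tau>: "\<tau> \<in> tuple_stabilizer w"
  shows "act \<tau> (pt w) = pt w"
proof -
  have len: "length w = d" and \<tau>': "\<tau> permutes {..<d}" "permute_list \<tau> w = w"
    using w \<tau> by (auto simp: tri_def tuple_stabilizer_def)
  have fixed: "pinv \<tau> k = k" if k: "k < d" "parity w ! k = 1" for k
  proof -
    have wk: "w ! k \<notin> gr 0" using k len by (auto simp: parity_def split: if_splits)
    have "\<tau> k < d" using permutes_in_image[OF \<tau>'(1), of k] k(1) by simp
    have "w ! \<tau> k = w ! k" using permute_list_nth[of \<tau> w k] \<tau>' len k(1) by simp
    moreover have "card {i. i < length w \<and> w ! k = w ! i} = 1"
    proof -
      have "count (mset w) (w ! k) = 1" using w wk len k(1) by (simp add: tri_def del: count_mset)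
      then show ?thesis by (simp only: count_mset_card)
    qed
    then obtain j where "{i. i < length w \<and> w ! k = w ! i} = {j}" by (metis card_1_singletonE)
    ultimately have "\<tau> k = k" using \<open>\<tau> k < d\<close> k(1) len by (metis (mono_tags, lifting) mem_Collect_eq singletonD)
    then show ?thesis using permutes_inv_eq[OF \<tau>'(1)] by blast
  qed
  have "permute_sign \<tau> (parity w) = (1::'k)"
    unfolding permute_sign_prod
  proof (rule prod.neutral, clarify)
    fix k l assume "(k, l) \<in> pairs (length (parity w))"
    then have kl: "k < l" "k < d" "l < d" using len by (auto simp: pairs_def parity_def)
    show "(if pinv \<tau> l < pinv \<tau> k then swap_sign (parity w ! k) (parity w ! l) else 1) = (1::'k)"
    proof (cases "parity w ! k = 1 \<and> parity w ! l = 1")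
      case True
      then show ?thesis using fixed[OF kl(2)] fixed[OF kl(3)] kl(1) by simp
    qed (auto simp: swap_sign_def)
  qed
  then show ?thesis
    using act_pt[OF homogeneous_parity len \<tau>'(1)] w \<tau>'(2) by (simp add: tri_def)
qed

section \<open>Orbit sums of basis words and the span of their multiples\<close>

definition xi :: "'v list \<Rightarrow> ('v list \<Rightarrow>\<^sub>0 'k)" where
  "xi w = (\<Sum>K\<in>tuple_cosets w. act (SOME \<sigma>. \<sigma> \<in> K) (pt w))"

lemma xi_symm:
  assumes w: "tri w"
  shows "free_scale (of_nat (count_fact w)) (xi w) = symm d (pt w)"
proof -
  have len: "length w = d" using w by (simp add: tri_def)
  have "act (\<tau> \<circ> \<sigma>) (pt w) = act \<sigma> (pt w)" if "\<sigma> permutes {..<length w}" "\<tau> \<in> tuple_stabilizer w" for \<sigma> \<tau>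
    using act_act[of \<tau> \<sigma> "pt w"] act_stabilizer[OF w that(2)] that len by (simp add: tuple_stabilizer_def)
  from sum_tuple_cosets[of w "\<lambda>\<sigma>. act \<sigma> (pt w)", OF this] show ?thesis
    by (simp add: xi_def symm_def len)
qed

definition eta :: "'v list \<Rightarrow> ('v list \<Rightarrow>\<^sub>0 'k)" where
  "eta w = free_scale (of_nat (part_fact Bc w)) (xi w)"

lemma zero_notin_basis: "0 \<notin> basis"
  by (rule notI, drule dependent_zero) (rule notE[OF independent])

lemma B1_not_even: "x \<in> B1 \<Longrightarrow> x \<notin> gr 0"
  using odd gr_0_Int_1 zero_notin_basis by blast

text \<open>The order of the stabiliser is the product of the factorials of all multiplicities. Odd
  letters contribute 1, and \<open>eta\<close> has absorbed the factorials for \<open>Bc\<close>, so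
  only those for \<open>Ba\<close> remain to be cleared.\<close>

lemma eta_symm:
  assumes w: "tri w"
  shows "free_scale (of_nat (part_fact Ba w)) (eta w) = symm d (pt w)"
proof -
  have sub: "set w \<subseteq> basis" using w by (simp add: tri_def)
  have "set w = (Ba \<inter> set w \<union> Bc \<inter> set w) \<union> B1 \<inter> set w" using sub by blast
  then have "count_fact w = (\<Prod>x\<in>(Ba \<inter> set w \<union> Bc \<inter> set w) \<union> B1 \<inter> set w. fact (count (mset w) x))"
    unfolding count_fact_def by simp
  also have "\<dots> = (\<Prod>x\<in>Ba \<inter> set w \<union> Bc \<inter> set w. fact (count (mset w) x)) * part_fact B1 w"
    unfolding part_fact_def using even B1_not_even by (intro prod.union_disjoint) auto
  also have "(\<Prod>x\<in>Ba \<inter> set w \<union> Bc \<inter> set w. fact (count (mset w) x)) = part_fact Ba w * part_fact Bc w"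
    unfolding part_fact_def using disjoint by (intro prod.union_disjoint) auto
  also have "part_fact B1 w = 1"
    unfolding part_fact_def using w B1_not_even by (intro prod.neutral) (auto simp: tri_def)
  finally show ?thesis
    using xi_symm[OF w] by (simp add: eta_def)
qed

lemma some_coset_permutes:
  assumes w: "tri w" and K: "K \<in> tuple_cosets w"
  shows "(SOME \<sigma>. \<sigma> \<in> K) permutes {..<d}"
proof -
  have len: "length w = d" using w by (simp add: tri_def)
  have "K \<subseteq> {\<sigma>. \<sigma> permutes {..<d}}" "K \<noteq> {}"
    using K len tuple_coset_self by (fastforce simp: tuple_cosets_def tuple_stabilizer_def intro: permutes_compose)+
  then show ?thesis by (metis mem_Collect_eq some_in_eq subsetD)
qed

lemma xi_tensors:
  assumes w: "tri w"
  shows "xi w \<in> tensors"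
  unfolding xi_def using w
  by (intro free.subspace_sum[OF subspace_tensors] act_tensors some_coset_permutes[OF w] pt_tensors) (simp_all add: tri_def)

lemma eta_tensors: "tri w \<Longrightarrow> eta w \<in> tensors"
  by (simp add: eta_def xi_tensors free.subspace_scale[OF subspace_tensors])

definition eta_span :: "('v list \<Rightarrow>\<^sub>0 'k) set" where
  "eta_span = free.span {eta w |w. tri w}"

text \<open>Bringing the letters of \<open>Ba\<close> to the front changes the symmetrisation by a
  sign, which becomes \<open>c\<close>. Multiplied by the factorials for \<open>Ba\<close>, both
  sides are full symmetrisations.\<close>

lemma eta_transfer:
  assumes w: "tri w"
  obtains c v ys where "set v \<subseteq> Ba" "length v + length ys = d"
    "eta w = free_scale c (transfer (length v) (orb (\<lambda>x. x) (mset v) ys))"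
proof -
  define v ys where "v = filter (\<lambda>x. x \<in> Ba) w" and "ys = filter (\<lambda>x. x \<notin> Ba) w"
  have len: "length w = d" and sub: "set w \<subseteq> basis" using w by (simp_all add: tri_def)
  have m: "mset (v @ ys) = mset w" by (simp add: v_def ys_def)
  then have l: "length v + length ys = d" using len by (metis length_append mset_eq_length)
  obtain \<pi> where \<pi>: "\<pi> permutes {..<d}" "permute_list \<pi> w = v @ ys"
    using mset_eq_permutation[OF m] len by auto
  let ?c = "permute_sign \<pi> (parity w)"
  have vBa: "set v \<subseteq> Ba" by (auto simp: v_def)
  have ve: "set v \<subseteq> gr 0" using vBa even by blast
  have "symm d (pt w) = symm d (act \<pi> (pt w))" using symm_act[OF \<pi>(1)] len by simp
  also have "\<dots> = free_scale ?c (symm d (pt (v @ ys)))"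
    using act_pt[OF homogeneous_parity[OF sub] len \<pi>(1)] \<pi>(2) by (simp add: symm_scale)
  also have "symm d (pt (v @ ys)) = free_scale (of_nat (count_fact v)) (transfer (length v) (orb (\<lambda>x. x) (mset v) ys))"
    by (rule transfer_orb[symmetric, OF l ve])
  also have "count_fact v = part_fact Ba w"
    unfolding count_fact_def part_fact_def v_def by (rule prod.cong) auto
  finally have "free_scale (of_nat (part_fact Ba w)) (eta w) =
      free_scale (of_nat (part_fact Ba w)) (free_scale ?c (transfer (length v) (orb (\<lambda>x. x) (mset v) ys)))"
    by (simp add: eta_symm[OF w] mult.commute)
  then have "eta w = free_scale ?c (transfer (length v) (orb (\<lambda>x. x) (mset v) ys))"
    by (rule torsion_free) (rule part_fact_pos)
  with vBa l that show thesis by blast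
qed

lemma subspace_eta_span: "free.subspace eta_span"
  by (simp add: eta_span_def)

lemma eta_span_subset:
  assumes C: "free.subspace C"
    and "\<And>v ys. set v \<subseteq> Va \<Longrightarrow> length v + length ys = d \<Longrightarrow> transfer (length v) (orb (\<lambda>x. x) (mset v) ys) \<in> C"
  shows "eta_span \<subseteq> C"
  unfolding eta_span_def
proof (rule free.span_minimal[OF _ C], clarify)
  fix w assume "tri w"
  then obtain c v ys where "set v \<subseteq> Ba" "length v + length ys = d"
    "eta w = free_scale c (transfer (length v) (orb (\<lambda>x. x) (mset v) ys))" by (rule eta_transfer)
  moreover from this have "set v \<subseteq> Va" using span_superset by blast
  ultimately show "eta w \<in> C" using assms by (simp add: free.subspace_scale[OF C])
qed

text \<open>\<open>C\<close> need not consist of invariants. The lemma serves twice: for the left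
  multipliers of \<open>eta_span\<close>, to prove closure under products, and for a given
  subalgebra, to prove minimality.\<close>

lemma eta_span_subset_subalgebra:
  assumes "free.subspace C" "\<And>x y. x \<in> C \<Longrightarrow> y \<in> C \<Longrightarrow> tmul x y \<in> C" "prefix_inv d \<subseteq> C" "\<And>v. inssum v \<in> C"
  shows "eta_span \<subseteq> C"
proof (rule eta_span_subset[OF assms(1)])
  fix v ys :: "'v list" assume "set v \<subseteq> Va" "length v + length ys = d"
  then show "transfer (length v) (orb (\<lambda>x. x) (mset v) ys) \<in> C"
    using transfer_orb_mem[OF assms, of "mset v" ys] by simp
qed

lemma eta_span_subset_transfers: "eta_span \<subseteq> transfers"
proof (rule eta_span_subset[OF subspace_transfers])
  fix v ys :: "'v list" assume *: "set v \<subseteq> Va" "length v + length ys = d"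
  then have "orb (\<lambda>x. x) (mset v) ys \<in> prefix_inv (length v)"
    using orb_prefix_inv[of "mset v" "\<lambda>x. x" ys] by auto
  then show "transfer (length v) (orb (\<lambda>x. x) (mset v) ys) \<in> transfers"
    using * by (intro transfer_transfers) auto
qed

text \<open>With the two equal odd letters moved to the first two slots, their transposition fixes
  the word but acts with sign -1. The symmetrisation thus equals its own negative, and 2 can be
  cancelled.\<close>

lemma symm_repeated:
  assumes len: "length w = d" and w: "set w \<subseteq> basis" and x: "x \<notin> gr 0" "2 \<le> count (mset w) x"
  shows "symm d (pt w) = 0"
proof -
  have "{#x, x#} \<subseteq># mset w"
    using x(2) by (intro mset_subset_eqI) auto
  then obtain R where R: "mset w = {#x, x#} + R" by (metis subset_mset.add_diff_inverse)
  obtain r where r: "mset r = R" using ex_mset by blast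
  let ?w = "x # x # r"
  have m: "mset ?w = mset w" by (simp add: R r)
  obtain \<pi> where \<pi>: "\<pi> permutes {..<d}" "permute_list \<pi> w = ?w"
    using mset_eq_permutation[OF m] len by auto
  have len': "length ?w = d" and w': "set ?w \<subseteq> basis" using m len w by (metis mset_eq_length, metis mset_eq_setD)
  have d: "2 \<le> d" using len' by simp
  let ?t = "Transposition.transpose 0 (1::nat)"
  have t: "?t permutes {..<d}" using d by (intro permutes_swap_id) auto
  have "permute_list ?t ?w = ?w"
  proof (rule nth_equalityI)
    fix i assume "i < length (permute_list ?t ?w)"
    then show "permute_list ?t ?w ! i = ?w ! i"
      using t len' by (auto simp: permute_list_nth Transposition.transpose_def)
  qed simp
  moreover have "permute_sign ?t (parity ?w) = (-1::'k)"
  proof -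
    have "permute_sign ?t (parity ?w) = (\<Prod>p\<in>pairs d. if p = (0, 1) then -1 else 1 :: 'k)"
      unfolding permute_sign_prod
    proof (rule prod.cong)
      show "pairs (length (parity ?w)) = pairs d" using len' by (simp add: parity_def)
      fix p assume "p \<in> pairs d"
      then obtain k l where p: "p = (k, l)" "k < l" by (auto simp: pairs_def)
      have "?t l < ?t k \<longleftrightarrow> k = 0 \<and> l = 1"
        using p(2) by (auto simp: Transposition.transpose_def split: if_splits)
      then show "(case p of (k, l) \<Rightarrow> if pinv ?t l < pinv ?t k then swap_sign (parity ?w ! k) (parity ?w ! l) else 1) =
          (if p = (0, 1) then -1 else 1 :: 'k)"
        using x(1) by (auto simp: p(1) parity_def swap_sign_def)
    qed
    also have "\<dots> = -1"
    proof -
      have "(0, 1) \<in> pairs d" using d by (simp add: pairs_def)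
      then show ?thesis by (simp add: prod.delta)
    qed
    finally show ?thesis .
  qed
  ultimately have "act ?t (pt ?w) = free_scale (-1) (pt ?w)"
    using act_pt[OF homogeneous_parity[OF w'] len' t] by simp
  then have "symm d (pt ?w) = free_scale (-1) (symm d (pt ?w))"
    using symm_act[OF t, of "pt ?w"] len' symm_scale[of d "-1" "pt ?w"] by (metis pt_tensors)
  then have "symm d (pt ?w) + symm d (pt ?w) = free_scale (-1) (symm d (pt ?w)) + symm d (pt ?w)" by (rule arg_cong)
  then have "symm d (pt ?w) + symm d (pt ?w) = 0" by simp
  then have "free_scale (of_nat 2) (symm d (pt ?w)) = free_scale (of_nat 2) 0"
    using free.scale_left_distrib[of 1 1 "symm d (pt ?w)"] by simp
  then have z: "symm d (pt ?w) = 0" by (rule torsion_free) simp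
  have "symm d (pt w) = symm d (act \<pi> (pt w))" using symm_act[OF \<pi>(1)] len by simp
  also have "\<dots> = 0"
    using act_pt[OF homogeneous_parity[OF w] len \<pi>(1)] \<pi>(2) z by (simp add: symm_scale)
  finally show ?thesis .
qed

text \<open>The tail \<open>ys\<close> may contain further letters of \<open>Ba\<close>; the element
  is then an integer multiple of \<open>eta\<close>, the integer being a quotient of products of
  factorials. If an odd letter repeats, there is no such \<open>eta\<close>, but the symmetrisation
  vanishes.\<close>

lemma transfer_orb_eta_span:
  assumes len: "length v + length ys = d" and v: "set v \<subseteq> Ba" and ys: "set ys \<subseteq> basis"
  shows "transfer (length v) (orb (\<lambda>x. x) (mset v) ys) \<in> eta_span"
proof -
  let ?x = "transfer (length v) (orb (\<lambda>x. x) (mset v) ys)" and ?w = "v @ ys"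
  have ve: "set v \<subseteq> gr 0" using v even by blast
  have sub: "set ?w \<subseteq> basis" using v ys by auto
  show ?thesis
  proof (cases "tri ?w")
    case True
    have "(\<Prod>x\<in>Ba \<inter> set ?w. fact (count (mset v) x)) = count_fact v"
      unfolding count_fact_def using v
    proof (intro prod.mono_neutral_right ballI)
      fix x assume "x \<in> Ba \<inter> set ?w - set v"
      then have "count (mset v) x = 0" by (simp only: count_eq_zero_iff set_mset_mset) blast
      then show "fact (count (mset v) x) = (1::nat)" by (simp only: fact_0)
    qed auto
    moreover have "(\<Prod>x\<in>Ba \<inter> set ?w. fact (count (mset v) x)) dvd part_fact Ba ?w"
      unfolding part_fact_def by (intro prod_dvd_prod fact_dvd) auto
    ultimately obtain q where q: "part_fact Ba ?w = count_fact v * q" by auto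
    have "free_scale (of_nat (count_fact v)) ?x = free_scale (of_nat (count_fact v)) (free_scale (of_nat q) (eta ?w))"
      using transfer_orb[OF len ve] eta_symm[OF True] by (simp add: q)
    then have "?x = free_scale (of_nat q) (eta ?w)" by (rule torsion_free) (rule count_fact_pos)
    also have "\<dots> \<in> eta_span" unfolding eta_span_def using True by (intro free.span_scale free.span_base) auto
    finally show ?thesis .
  next
    case False
    then obtain x where x: "x \<in> set ?w" "x \<notin> gr 0" "count (mset ?w) x \<noteq> 1"
      using sub len by (auto simp: tri_def)
    then have "2 \<le> count (mset ?w) x" using count_greater_zero_iff[of "mset ?w" x] unfolding set_mset_mset by linarith
    with x have "symm d (pt ?w) = 0" using len by (intro symm_repeated[OF _ sub]) auto
    then have "free_scale (of_nat (count_fact v)) ?x = free_scale (of_nat (count_fact v)) 0"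
      using transfer_orb[OF len ve] by simp
    then have "?x = 0" by (rule torsion_free) (rule count_fact_pos)
    then show ?thesis by (simp add: free.subspace_0[OF subspace_eta_span])
  qed
qed

end


section \<open>The span of the eta elements as a subalgebra\<close>

context based_superalgebra
begin

text \<open>The normal form of a basis word is that word with coefficient 1, so the restriction on
  the generators of the span is inherited by all words that occur.\<close>

lemma keys_prefix:
  assumes "x \<in> prefix m" "w \<in> Poly_Mapping.keys x"
  shows "length w = d" "\<And>i. i < d \<Longrightarrow> w ! i \<in> (if i < m then Ba else basis)"
proof -
  let ?K = "{w. length w = d \<and> (\<forall>i<d. w ! i \<in> (if i < m then Ba else basis))}"
  have "free.subspace {x :: 'v list \<Rightarrow>\<^sub>0 'k. Poly_Mapping.keys x \<subseteq> ?K}"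
  proof (rule free.subspaceI)
    fix x y :: "'v list \<Rightarrow>\<^sub>0 'k" and c
    assume "x \<in> {x. Poly_Mapping.keys x \<subseteq> ?K}" "y \<in> {x. Poly_Mapping.keys x \<subseteq> ?K}"
    then show "x + y \<in> {x. Poly_Mapping.keys x \<subseteq> ?K}"
      using Poly_Mapping.keys_add[of x y] by blast
  next
    fix x :: "'v list \<Rightarrow>\<^sub>0 'k" and c
    assume "x \<in> {x. Poly_Mapping.keys x \<subseteq> ?K}"
    moreover have "Poly_Mapping.keys (free_scale c x) \<subseteq> Poly_Mapping.keys x" by (auto simp: in_keys_iff)
    ultimately show "free_scale c x \<in> {x. Poly_Mapping.keys x \<subseteq> ?K}" by blast
  qed simp
  moreover have "{pt w |w. w \<in> ?K} \<subseteq> {x. Poly_Mapping.keys x \<subseteq> ?K}"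
  proof
    fix p assume "p \<in> {pt w |w. w \<in> ?K}"
    then obtain w where w: "p = pt w" "w \<in> ?K" by blast
    have "set w \<subseteq> basis"
    proof
      fix b assume "b \<in> set w"
      then obtain i where "i < length w" "w ! i = b" by (auto simp: in_set_conv_nth)
      then show "b \<in> basis" using w(2) by (auto split: if_splits)
    qed
    then show "p \<in> {x. Poly_Mapping.keys x \<subseteq> ?K}" using w by (simp add: pt_basis)
  qed
  ultimately have "prefix m \<subseteq> {x. Poly_Mapping.keys x \<subseteq> ?K}"
    unfolding prefix_basis using free.span_minimal[of "{pt w |w. w \<in> ?K}"] by simp
  then have "w \<in> ?K" using assms by blast
  then show "length w = d" "\<And>i. i < d \<Longrightarrow> w ! i \<in> (if i < m then Ba else basis)" by simp_all
qed

lemma pt_expansion: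
  assumes "x \<in> prefix m"
  shows "x = (\<Sum>w\<in>Poly_Mapping.keys x. free_scale (Poly_Mapping.lookup x w) (pt w))"
proof -
  have "pt w = Poly_Mapping.single w 1" if "w \<in> Poly_Mapping.keys x" for w
  proof (rule pt_basis, rule subsetI)
    fix b assume "b \<in> set w"
    then obtain i where i: "i < length w" "w ! i = b" by (auto simp: in_set_conv_nth)
    then show "b \<in> basis" using keys_prefix[OF assms that] by (metis UnI1)
  qed
  then show ?thesis using lin_ext_single_id[of x] unfolding lin_ext_def by simp
qed

text \<open>On words with an even head \<open>\<sigma>\<close> acts without signs, so invariance
  says that coefficients are constant along rearrangements of the head. This splits an invariant
  tensor into orbit sums.\<close>

lemma lookup_permute_prefix_inv:
  assumes m: "m \<le> d" and x: "x \<in> prefix_inv m" and \<sigma>: "\<sigma> permutes {..<m}" and w: "length w = d"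
  shows "Poly_Mapping.lookup x (permute_list \<sigma> w) = Poly_Mapping.lookup x w"
proof -
  let ?l = "Poly_Mapping.lookup x"
  have xW: "x \<in> prefix m" and inv: "act \<sigma> x = x" using x \<sigma> by (simp_all add: prefix_inv_def invar_def)
  have \<sigma>d: "\<sigma> permutes {..<d}" using permutes_le[OF \<sigma> m] .
  have inj: "permute_list \<sigma> v = permute_list \<sigma> w \<longleftrightarrow> v = w" if "length v = d" for v
  proof
    assume "permute_list \<sigma> v = permute_list \<sigma> w"
    then have "permute_list (\<sigma> \<circ> pinv \<sigma>) v = permute_list (\<sigma> \<circ> pinv \<sigma>) w"
      using that w by (simp add: permute_list_compose permutes_inv[OF \<sigma>d])
    then show "v = w" using permutes_inv_o(1)[OF \<sigma>] by simp
  qed simp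
  have act: "act \<sigma> (pt v) = Poly_Mapping.single (permute_list \<sigma> v) 1" if v: "v \<in> Poly_Mapping.keys x" for v
  proof -
    have len: "length v = d" using keys_prefix[OF xW v] by simp
    have "v ! i \<in> gr 0" if "i < m" for i
      using keys_prefix(2)[OF xW v, of i] that m even by auto
    then have "act \<sigma> (pt v) = pt (permute_list \<sigma> v)" by (rule act_even_prefix[OF \<sigma> m len])
    moreover have "set (permute_list \<sigma> v) \<subseteq> basis"
    proof -
      have "set v \<subseteq> basis" using keys_prefix[OF xW v] by (metis UnI1 in_set_conv_nth subsetI)
      then show ?thesis using \<sigma>d len by simp
    qed
    ultimately show ?thesis by (simp add: pt_basis)
  qed
  have "x = (\<Sum>v\<in>Poly_Mapping.keys x. free_scale (?l v) (Poly_Mapping.single (permute_list \<sigma> v) 1))"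
    using arg_cong[OF pt_expansion[OF xW], of "act \<sigma>"] unfolding inv by (simp add: act_sum act_scale act)
  then have "?l (permute_list \<sigma> w) =
      (\<Sum>v\<in>Poly_Mapping.keys x. ?l v * Poly_Mapping.lookup (Poly_Mapping.single (permute_list \<sigma> v) 1) (permute_list \<sigma> w))"
    by (metis (no_types, lifting) lookup_sum lookup_free_scale sum.cong)
  also have "\<dots> = (\<Sum>v\<in>Poly_Mapping.keys x. if v = w then ?l w else 0)"
    using keys_prefix(1)[OF xW] inj by (intro sum.cong) (auto simp: lookup_single when_def)
  also have "\<dots> = ?l w" by (simp add: in_keys_iff)
  finally show ?thesis .
qed

text \<open>Two basis words differ by a permutation of the first \<open>m\<close> slots exactly when
  their heads agree as multisets and their tails agree. Grouping the expansion of \<open>x\<close>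
  by these data \<open>?g\<close> leaves one multiple of an orbit sum per group.\<close>

lemma transfer_prefix_inv_eta_span:
  assumes m: "m \<le> d" and x: "x \<in> prefix_inv m"
  shows "transfer m x \<in> eta_span"
proof -
  let ?K = "Poly_Mapping.keys x" and ?l = "Poly_Mapping.lookup x"
  let ?g = "\<lambda>w. (mset (take m w), drop m w)"
  have xW: "x \<in> prefix m" using x by (simp add: prefix_inv_def)
  have fibre: "\<exists>c v ys. (\<Sum>w\<in>{w \<in> ?K. ?g w = q}. free_scale (?l w) (pt w)) = free_scale c (orb (\<lambda>x. x) (mset v) ys) \<and>
      length v = m \<and> length ys = d - m \<and> set v \<subseteq> Ba \<and> set ys \<subseteq> basis" if "q \<in> ?g ` ?K" for q
  proof -
    from that obtain w where w: "q = ?g w" "w \<in> ?K" by (rule imageE)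
    define v ys where "v = take m w" and "ys = drop m w"
    note wK = keys_prefix[OF xW w(2)]
    have len: "length v = m" "length ys = d - m" "w = v @ ys" using wK m by (simp_all add: v_def ys_def)
    have "set v \<subseteq> Ba"
    proof
      fix b assume "b \<in> set v"
      then obtain i where i: "i < m" "w ! i = b" using len by (auto simp: in_set_conv_nth nth_append)
      then show "b \<in> Ba" using wK(2)[of i] m by simp
    qed
    moreover have "set ys \<subseteq> basis"
      using wK by (metis Un_iff in_set_conv_nth in_set_dropD subsetI ys_def)
    moreover have "{w \<in> ?K. ?g w = q} = (\<lambda>v'. v' @ ys) ` permutations_of_multiset (mset v)"
      and const: "\<And>v'. v' \<in> permutations_of_multiset (mset v) \<Longrightarrow> ?l (v' @ ys) = ?l w"
    proof -
      show c: "?l (v' @ ys) = ?l w" if v': "v' \<in> permutations_of_multiset (mset v)" for v'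
      proof -
        obtain \<sigma> where \<sigma>: "\<sigma> permutes {..<length v}" "permute_list \<sigma> v = v'"
          using mset_eq_permutation[OF permutations_of_multisetD[OF v']] by blast
        have "?l (permute_list \<sigma> w) = ?l w"
          using \<sigma> len wK(1) by (intro lookup_permute_prefix_inv[OF m x]) auto
        then show ?thesis using \<sigma> by (simp add: len(3) permute_list_append_prefix)
      qed
      show "{w \<in> ?K. ?g w = q} = (\<lambda>v'. v' @ ys) ` permutations_of_multiset (mset v)"
      proof (intro equalityI subsetI)
        fix z assume z: "z \<in> {w \<in> ?K. ?g w = q}"
        then have "mset (take m z) = mset v" "drop m z = ys" by (simp_all add: w(1) v_def ys_def)
        then show "z \<in> (\<lambda>v'. v' @ ys) ` permutations_of_multiset (mset v)"
          by (intro image_eqI[of _ _ "take m z"]) (auto intro: permutations_of_multisetI)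
      next
        fix z assume "z \<in> (\<lambda>v'. v' @ ys) ` permutations_of_multiset (mset v)"
        then obtain v' where v': "z = v' @ ys" "v' \<in> permutations_of_multiset (mset v)" by blast
        have mv: "mset v' = mset v" using v'(2) by (rule permutations_of_multisetD)
        then have "length v' = m" using len(1) mset_eq_length by metis
        moreover have "z \<in> ?K" using c[OF v'(2)] w(2) by (simp add: v'(1) in_keys_iff)
        ultimately show "z \<in> {w \<in> ?K. ?g w = q}" using mv by (simp add: w(1) v'(1) v_def ys_def)
      qed
    qed
    ultimately have "(\<Sum>w\<in>{w \<in> ?K. ?g w = q}. free_scale (?l w) (pt w)) =
        free_scale (?l w) (orb (\<lambda>x. x) (mset v) ys)"
      by (simp add: orb_def sum.reindex inj_on_def free.scale_sum_right)
    with \<open>set v \<subseteq> Ba\<close> \<open>set ys \<subseteq> basis\<close> len show ?thesis by blast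
  qed
  have "x = (\<Sum>q\<in>?g ` ?K. \<Sum>w\<in>{w \<in> ?K. ?g w = q}. free_scale (?l w) (pt w))"
    by (subst sum.group) (simp_all flip: pt_expansion[OF xW])
  then have "transfer m x = (\<Sum>q\<in>?g ` ?K. transfer m (\<Sum>w\<in>{w \<in> ?K. ?g w = q}. free_scale (?l w) (pt w)))"
    by (metis (no_types, lifting) transfer_sum sum.cong)
  also have "\<dots> \<in> eta_span"
  proof (rule free.subspace_sum[OF subspace_eta_span])
    fix q assume "q \<in> ?g ` ?K"
    from fibre[OF this] obtain c v ys
      where *: "(\<Sum>w\<in>{w \<in> ?K. ?g w = q}. free_scale (?l w) (pt w)) = free_scale c (orb (\<lambda>x. x) (mset v) ys)"
        "length v = m" "length ys = d - m" "set v \<subseteq> Ba" "set ys \<subseteq> basis" by blast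
    then have "transfer (length v) (orb (\<lambda>x. x) (mset v) ys) \<in> eta_span" using m by (intro transfer_orb_eta_span) auto
    with * show "transfer m (\<Sum>w\<in>{w \<in> ?K. ?g w = q}. free_scale (?l w) (pt w)) \<in> eta_span"
      by (simp add: transfer_scale free.subspace_scale[OF subspace_eta_span])
  qed
  finally show ?thesis .
qed

lemma eta_span_eq_transfers: "eta_span = transfers"
proof
  show "transfers \<subseteq> eta_span"
    unfolding transfers_def by (rule free.span_minimal[OF _ subspace_eta_span]) (auto intro: transfer_prefix_inv_eta_span)
qed (rule eta_span_subset_transfers)

lemma eta_span_tensors: "eta_span \<subseteq> tensors" and eta_span_invar: "x \<in> eta_span \<Longrightarrow> invar d x"
  using transfers_tensors transfers_invar by (auto simp: eta_span_eq_transfers)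

lemma prefix_inv_eta_span: "prefix_inv d \<subseteq> eta_span"
  using transfer_prefix_inv_eta_span[of d] by auto

text \<open>The insertion into the last slot leaves units, hence elements of \<open>Va\<close>, in
  all others, and its transfer from level \<open>d - 1\<close> is the whole sum. For
  \<open>d = 0\<close> there is no last slot and the sum is empty.\<close>

lemma inssum_eta_span: "inssum v \<in> eta_span"
proof (cases "d = 0")
  case True
  then have "inssum v = 0" unfolding inssum_def by (intro sum.neutral) simp
  then show ?thesis by (simp only: free.subspace_0[OF subspace_eta_span])
next
  case False
  then have d: "d - 1 < d" "Suc (d - 1) = d" by simp_all
  have "pt (replicate d unit) \<in> prefix_inv (d - 1)"
    by (rule pt_units_prefix_inv) auto
  have "ins (d - 1) v \<in> prefix (d - 1)"
    unfolding ins_def using unit_mem by (intro pt_prefix) auto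
  then have "ins (d - 1) v \<in> prefix_inv (d - 1)"
    using ins_invar[of "d - 1" "d - 1"] d by (simp add: prefix_inv_def)
  then have "transfer (d - 1) (ins (d - 1) v) \<in> eta_span" using d by (intro transfer_prefix_inv_eta_span) auto
  also have "transfer (d - 1) (ins (d - 1) v) = (\<Sum>i\<le>d - 1. ins i v)"
    unfolding transfer_Suc[OF d(1)] d(2) transfer_self by (rule transfer1_ins[OF d(1)])
  also have "{..d - 1} = {..<d}" using d by auto
  finally show ?thesis by (simp add: inssum_def)
qed

text \<open>By associativity the left multipliers of \<open>eta_span\<close> form a submodule closed
  under products. It contains the generators by \<open>tmul_transfers\<close>, and therefore
  \<open>eta_span\<close>.\<close>

lemma tmul_eta_span: "x \<in> eta_span \<Longrightarrow> y \<in> eta_span \<Longrightarrow> tmul x y \<in> eta_span"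
proof -
  let ?C = "{x \<in> tensors. \<forall>t\<in>eta_span. tmul x t \<in> eta_span}"
  have gen: "x \<in> ?C" if "x \<in> prefix_inv d \<union> range inssum" for x
  proof -
    have "x \<in> tensors" using that by (auto intro: prefix_inv_tensors inssum_tensors)
    then show ?thesis using that tmul_transfers by (simp add: eta_span_eq_transfers)
  qed
  have "eta_span \<subseteq> ?C"
  proof (rule eta_span_subset_subalgebra)
    show "free.subspace ?C"
      by (rule free.subspaceI)
         (auto simp: tmul_add_left tmul_scale_left intro: free.subspace_0 free.subspace_add free.subspace_scale subspace_eta_span subspace_tensors)
    show "tmul x y \<in> ?C" if "x \<in> ?C" "y \<in> ?C" for x y
      using that eta_span_tensors by (auto simp: tmul_tensors tmul_assoc subset_iff)
    show "prefix_inv d \<subseteq> ?C" using gen by blast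
    show "inssum v \<in> ?C" for v using gen by blast
  qed
  then show "x \<in> eta_span \<Longrightarrow> y \<in> eta_span \<Longrightarrow> tmul x y \<in> eta_span" by blast
qed

section \<open>Return from normal forms to classes\<close>

abbreviation E :: "('k, ('v list \<Rightarrow>\<^sub>0 'k) set) module" where
  "E \<equiv> tensor_power scl mul unit gr d"

abbreviation cls :: "('v list \<Rightarrow>\<^sub>0 'k) \<Rightarrow> ('v list \<Rightarrow>\<^sub>0 'k) set" where
  "cls \<equiv> tensor_class scl d"

lemma mem_cls: "p \<in> free_tuples d \<Longrightarrow> q \<in> cls p \<longleftrightarrow> q \<in> free_tuples d \<and> nform q = nform p"
proof -
  assume p: "p \<in> free_tuples d"
  then have "q \<in> cls p \<longleftrightarrow> q \<in> free_tuples d \<and> p - q \<in> multilinear_relations scl d"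
    by (simp add: tensor_class_def tensor_rel_def)
  then show ?thesis using nform_eq_iff[OF p] by metis
qed

lemma cls_eq_iff:
  assumes "p \<in> free_tuples d" "q \<in> free_tuples d"
  shows "cls p = cls q \<longleftrightarrow> nform p = nform q"
proof
  assume "cls p = cls q"
  moreover have "p \<in> cls p" using assms by (simp add: mem_cls)
  ultimately show "nform p = nform q" using assms mem_cls by blast
qed (auto simp: mem_cls assms)

lemma cls_nform: "p \<in> free_tuples d \<Longrightarrow> cls (nform p) = cls p"
  by (simp add: cls_eq_iff nform_free_tuples nform_nform)

lemma tensors_tuples: "p \<in> tensors \<Longrightarrow> p \<in> free_tuples d"
  using tensors_free_tuples by blast

lemma inj_cls: "inj_on cls tensors"
  by (rule inj_onI) (simp add: cls_eq_iff tensors_tuples nform_id)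

lemma carrier_E: "carrier E = cls ` tensors"
proof -
  have "carrier E = cls ` free_tuples d"
    by (auto simp: tensor_power_def quotient_def tensor_class_def)
  also have "\<dots> = cls ` tensors"
  proof
    show "cls ` free_tuples d \<subseteq> cls ` tensors"
    proof (rule image_subsetI)
      fix p :: "'v list \<Rightarrow>\<^sub>0 'k" assume p: "p \<in> free_tuples d"
      then show "cls p \<in> cls ` tensors"
        using cls_nform[OF p] nform_tensors[OF p] by (metis imageI)
    qed
  qed (use tensors_free_tuples in blast)
  finally show ?thesis .
qed

text \<open>The operations of \<open>tensor_power\<close> are unions over all representatives. When
  each representative gives the same class, the union collapses to it.\<close>

lemma UN_cls:
  assumes p: "p \<in> free_tuples d" and "\<And>x. x \<in> free_tuples d \<Longrightarrow> nform x = nform p \<Longrightarrow> F x = F p"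
  shows "(\<Union>x\<in>cls p. F x) = F p"
proof -
  have "p \<in> cls p" using p by (simp add: mem_cls)
  moreover have "F x = F p" if "x \<in> cls p" for x
    using that assms(2)[of x] unfolding mem_cls[OF p] by blast
  ultimately show ?thesis by blast
qed

lemma free_tuples_add: "p \<in> free_tuples d \<Longrightarrow> q \<in> free_tuples d \<Longrightarrow> p + q \<in> (free_tuples d :: ('v list \<Rightarrow>\<^sub>0 'k) set)"
  by (rule free.subspace_add[OF subspace_free_tuples])

lemma free_tuples_scale: "p \<in> free_tuples d \<Longrightarrow> free_scale c p \<in> (free_tuples d :: ('v list \<Rightarrow>\<^sub>0 'k) set)"
  by (rule free.subspace_scale[OF subspace_free_tuples])

lemma add_E: "p \<in> free_tuples d \<Longrightarrow> q \<in> free_tuples d \<Longrightarrow> cls p \<oplus>\<^bsub>E\<^esub> cls q = cls (p + q)"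
proof -
  assume pq: "p \<in> free_tuples d" "q \<in> free_tuples d"
  have "cls p \<oplus>\<^bsub>E\<^esub> cls q = (\<Union>x\<in>cls p. \<Union>y\<in>cls q. cls (x + y))" by (simp add: tensor_power_def)
  also have "\<dots> = (\<Union>x\<in>cls p. cls (x + q))"
    using pq by (intro SUP_cong refl UN_cls) (auto simp: mem_cls cls_eq_iff free_tuples_add module_hom.add[OF nform_hom])
  also have "\<dots> = cls (p + q)"
    using pq by (intro UN_cls) (auto simp: cls_eq_iff free_tuples_add module_hom.add[OF nform_hom])
  finally show ?thesis .
qed

lemma smult_E: "p \<in> free_tuples d \<Longrightarrow> c \<odot>\<^bsub>E\<^esub> cls p = cls (free_scale c p)"
  unfolding tensor_power_def
  by (simp, intro UN_cls) (auto simp: cls_eq_iff free_tuples_scale module_hom.scale[OF nform_hom])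

lemma zero_E: "\<zero>\<^bsub>E\<^esub> = cls 0"
  by (simp add: tensor_power_def)

lemma lin_ext_free_tuples:
  "(\<And>x. x \<in> Poly_Mapping.keys p \<Longrightarrow> f x \<in> free_tuples d) \<Longrightarrow> lin_ext f p \<in> (free_tuples d :: ('v list \<Rightarrow>\<^sub>0 'k) set)"
  unfolding lin_ext_def
  by (intro free.subspace_sum[OF subspace_free_tuples] free_tuples_scale)

lemma tuple_mult_free_tuples:
  "length xs = d \<Longrightarrow> length ys = d \<Longrightarrow> tuple_mult mul gr xs ys \<in> (free_tuples d :: ('v list \<Rightarrow>\<^sub>0 'k) set)"
  unfolding tuple_mult_def
  by (intro free.subspace_sum[OF subspace_free_tuples] single_free_tuples) (simp add: homogeneous_parts_def)

lemma tuple_permute_free_tuples: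
  "length xs = d \<Longrightarrow> tuple_permute gr \<sigma> xs \<in> (free_tuples d :: ('v list \<Rightarrow>\<^sub>0 'k) set)"
  unfolding tuple_permute_def
  by (intro free.subspace_sum[OF subspace_free_tuples] single_free_tuples) (simp add: homogeneous_parts_def)

lemma mult_E:
  assumes "p \<in> free_tuples d" "q \<in> free_tuples d"
  shows "cls p \<otimes>\<^bsub>E\<^esub> cls q = cls (tmul p q)"
proof -
  let ?F = "\<lambda>x y. lin_ext (\<lambda>xs. lin_ext (tuple_mult mul gr xs) y) x"
  have F: "?F x y \<in> free_tuples d" if "x \<in> free_tuples d" "y \<in> free_tuples d" for x y :: "'v list \<Rightarrow>\<^sub>0 'k"
    using that by (intro lin_ext_free_tuples tuple_mult_free_tuples) (auto simp: free_tuples_def)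
  have eq: "cls (?F x y) = cls (tmul x y)" if "x \<in> free_tuples d" "y \<in> free_tuples d" for x y
    using cls_nform[OF F[OF that]] by (simp add: tmul_def)
  have "cls p \<otimes>\<^bsub>E\<^esub> cls q = (\<Union>x\<in>cls p. \<Union>y\<in>cls q. cls (?F x y))" by (simp add: tensor_power_def)
  also have "\<dots> = (\<Union>x\<in>cls p. cls (tmul x q))"
  proof (intro SUP_cong refl)
    fix x assume "x \<in> cls p"
    then have x: "x \<in> free_tuples d" using assms by (simp add: mem_cls)
    show "(\<Union>y\<in>cls q. cls (?F x y)) = cls (tmul x q)"
      unfolding eq[OF x assms(2), symmetric]
    proof (rule UN_cls[OF assms(2)])
      fix y assume y: "y \<in> free_tuples d" "nform y = nform q"
      then show "cls (?F x y) = cls (?F x q)"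
        using tmul_nform[OF x y(1)] tmul_nform[OF x assms(2)] by (simp add: eq x assms)
    qed
  qed
  also have "\<dots> = cls (tmul p q)"
  proof (rule UN_cls[OF assms(1)])
    fix x assume x: "x \<in> free_tuples d" "nform x = nform p"
    then show "cls (tmul x q) = cls (tmul p q)"
      using tmul_nform[OF x(1) assms(2)] tmul_nform[OF assms] by simp
  qed
  finally show ?thesis .
qed

lemma tensor_permute_cls:
  assumes p: "p \<in> free_tuples d" and \<sigma>: "\<sigma> permutes {..<d}"
  shows "tensor_permute scl gr d \<sigma> (cls p) = cls (act \<sigma> p)"
proof -
  have eq: "cls (lin_ext (tuple_permute gr \<sigma>) x) = cls (act \<sigma> x)" if "x \<in> free_tuples d" for x
    unfolding act_def using that
    by (intro cls_nform[symmetric] lin_ext_free_tuples tuple_permute_free_tuples) (auto simp: free_tuples_def)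
  show ?thesis
    unfolding tensor_permute_def eq[OF p, symmetric]
  proof (rule UN_cls[OF p])
    fix x assume x: "x \<in> free_tuples d" "nform x = nform p"
    then show "cls (lin_ext (tuple_permute gr \<sigma>) x) = cls (lin_ext (tuple_permute gr \<sigma>) p)"
      using act_nform[OF \<sigma> x(1)] act_nform[OF \<sigma> p] by (simp add: eq p)
  qed
qed

lemma pure_tensor_cls: "length vs = d \<Longrightarrow> pure_tensor scl vs = cls (pt vs)"
  using cls_nform[of "Poly_Mapping.single vs 1"] by (simp add: pure_tensor_def)

text \<open>The sums in \<open>\<xi>_elem\<close> and \<open>insertion_sum\<close> are formed with
  \<open>finsum\<close>, which can be expanded only once addition is known to be associative and
  commutative.\<close>

lemma abelian_monoid_E: "abelian_monoid E"
proof (rule abelian_monoidI)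
  fix x y z assume xyz: "x \<in> carrier E" "y \<in> carrier E" "z \<in> carrier E"
  then obtain p q r where "x = cls p" "y = cls q" "z = cls r" "p \<in> tensors" "q \<in> tensors" "r \<in> tensors"
    unfolding carrier_E by blast
  then show "x \<oplus>\<^bsub>E\<^esub> y \<oplus>\<^bsub>E\<^esub> z = x \<oplus>\<^bsub>E\<^esub> (y \<oplus>\<^bsub>E\<^esub> z)"
    by (simp add: add_E tensors_tuples free_tuples_add add.assoc)
next
  fix x y assume "x \<in> carrier E" "y \<in> carrier E"
  then obtain p q where pq: "x = cls p" "y = cls q" "p \<in> tensors" "q \<in> tensors"
    unfolding carrier_E by blast
  then show "x \<oplus>\<^bsub>E\<^esub> y = y \<oplus>\<^bsub>E\<^esub> x" by (simp add: add_E tensors_tuples add.commute)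
  show "x \<oplus>\<^bsub>E\<^esub> y \<in> carrier E"
    using pq by (auto simp: add_E tensors_tuples carrier_E intro!: imageI free.subspace_add[OF subspace_tensors])
next
  show "\<zero>\<^bsub>E\<^esub> \<in> carrier E" by (simp add: zero_E carrier_E free.subspace_0[OF subspace_tensors])
next
  fix x assume "x \<in> carrier E"
  then obtain p where p: "x = cls p" "p \<in> tensors" unfolding carrier_E by blast
  then show "\<zero>\<^bsub>E\<^esub> \<oplus>\<^bsub>E\<^esub> x = x"
    using add_E[of 0 p] by (simp add: zero_E tensors_tuples free.subspace_0[OF subspace_free_tuples])
qed

lemma finsum_E:
  assumes "finite I" "\<And>i. i \<in> I \<Longrightarrow> F i = cls (f i)" "\<And>i. i \<in> I \<Longrightarrow> f i \<in> tensors"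
  shows "finsum E F I = cls (\<Sum>i\<in>I. f i)"
  using assms
proof (induction I rule: finite_induct)
  case empty
  then show ?case using abelian_monoid.finsum_empty[OF abelian_monoid_E] by (simp add: zero_E)
next
  case (insert i I)
  have "finsum E F (insert i I) = F i \<oplus>\<^bsub>E\<^esub> finsum E F I"
    using insert by (intro abelian_monoid.finsum_insert[OF abelian_monoid_E]) (auto simp: carrier_E)
  also have "\<dots> = cls (f i) \<oplus>\<^bsub>E\<^esub> cls (\<Sum>i\<in>I. f i)" using insert by simp
  also have "\<dots> = cls (f i + (\<Sum>i\<in>I. f i))"
    using insert by (intro add_E tensors_tuples free.subspace_sum[OF subspace_tensors]) auto
  finally show ?case using insert by simp
qed

lemma is_submodule_cls:
  assumes "free.subspace C" "C \<subseteq> tensors"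
  shows "is_submodule E (cls ` C)"
  unfolding is_submodule_def
proof (intro conjI ballI allI)
  show "cls ` C \<subseteq> carrier E" using assms(2) by (auto simp: carrier_E)
  show "\<zero>\<^bsub>E\<^esub> \<in> cls ` C" by (simp add: zero_E free.subspace_0[OF assms(1)])
  fix x assume "x \<in> cls ` C"
  then obtain p where p: "x = cls p" "p \<in> C" by blast
  then have pt: "p \<in> free_tuples d" using assms(2) tensors_tuples by blast
  show "c \<odot>\<^bsub>E\<^esub> x \<in> cls ` C" for c
    using p pt by (simp add: smult_E free.subspace_scale[OF assms(1)])
  fix y assume "y \<in> cls ` C"
  then obtain q where q: "y = cls q" "q \<in> C" by blast
  then have "q \<in> free_tuples d" using assms(2) tensors_tuples by blast
  then show "x \<oplus>\<^bsub>E\<^esub> y \<in> cls ` C"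
    using p q pt by (simp add: add_E free.subspace_add[OF assms(1)])
qed

lemma subspace_submodule:
  assumes "is_submodule E C"
  shows "free.subspace {p \<in> tensors. cls p \<in> C}"
proof (rule free.subspaceI)
  show "0 \<in> {p \<in> tensors. cls p \<in> C}"
    using assms by (simp add: is_submodule_def zero_E free.subspace_0[OF subspace_tensors])
  fix p assume p: "p \<in> {p \<in> tensors. cls p \<in> C}"
  have "c \<odot>\<^bsub>E\<^esub> cls p \<in> C" for c using assms p by (simp add: is_submodule_def)
  then have "cls (free_scale c p) \<in> C" for c using p by (simp add: smult_E[symmetric] tensors_tuples)
  then show "free_scale c p \<in> {p \<in> tensors. cls p \<in> C}" for c
    using p by (simp add: free.subspace_scale[OF subspace_tensors])
  fix q assume q: "q \<in> {p \<in> tensors. cls p \<in> C}"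
  have "cls p \<oplus>\<^bsub>E\<^esub> cls q \<in> C" using assms p q by (simp add: is_submodule_def)
  then show "p + q \<in> {p \<in> tensors. cls p \<in> C}"
    using p q add_E[of p q] by (simp add: tensors_tuples free.subspace_add[OF subspace_tensors])
qed

lemma module_span_cls:
  assumes "X \<subseteq> tensors"
  shows "module_span E (cls ` X) = cls ` free.span X"
proof
  have "free.span X \<subseteq> tensors" using assms by (rule free.span_minimal[OF _ subspace_tensors])
  then have "is_submodule E (cls ` free.span X)" by (intro is_submodule_cls free.subspace_span)
  then show "module_span E (cls ` X) \<subseteq> cls ` free.span X"
    unfolding module_span_def using free.span_superset by blast
  show "cls ` free.span X \<subseteq> module_span E (cls ` X)"
    unfolding module_span_def
  proof (rule Inter_greatest)
    fix C assume "C \<in> {C. is_submodule E C \<and> cls ` X \<subseteq> C}"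
    then have C: "is_submodule E C" "cls ` X \<subseteq> C" by simp_all
    have "free.span X \<subseteq> {p \<in> tensors. cls p \<in> C}"
      using assms C by (intro free.span_minimal subspace_submodule) auto
    then show "cls ` free.span X \<subseteq> C" by blast
  qed
qed

text \<open>Restricting the carrier leaves the operations unchanged, so submodules of
  \<open>A\<close> are the submodules of \<open>E\<close> inside it, and they pull back to
  submodules of normal forms. There \<open>tmul_eta_span\<close> gives closure and
  \<open>eta_span_subset_subalgebra\<close> minimality.\<close>

theorem cls_eta_span_generated:
  assumes A: "A = E\<lparr>carrier := cls ` {x \<in> tensors. invar d x}\<rparr>"
    and G: "G = cls ` prefix_inv d \<union> range (\<lambda>v. cls (inssum v))"
  shows "G \<subseteq> carrier A \<and> cls ` eta_span = generated_subalgebra A G"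
proof
  have sub: "is_submodule A C \<longleftrightarrow> is_submodule E C \<and> C \<subseteq> carrier A" if "C \<subseteq> carrier E" for C
    using that by (auto simp: is_submodule_def A)
  have AE: "carrier A \<subseteq> carrier E" by (auto simp: A carrier_E)
  have "eta_span \<subseteq> {x \<in> tensors. invar d x}" using eta_span_tensors eta_span_invar by blast
  then show GA: "G \<subseteq> carrier A"
    using prefix_inv_eta_span inssum_eta_span by (auto simp: G A)
  show "cls ` eta_span = generated_subalgebra A G"
  proof
    have "cls ` eta_span \<subseteq> carrier A" using eta_span_tensors eta_span_invar by (auto simp: A)
    moreover have "is_submodule E (cls ` eta_span)" by (rule is_submodule_cls[OF subspace_eta_span eta_span_tensors])
    moreover have "x \<otimes>\<^bsub>A\<^esub> y \<in> cls ` eta_span" if "x \<in> cls ` eta_span" "y \<in> cls ` eta_span" for x y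
    proof -
      from that(1) obtain p where p: "x = cls p" "p \<in> eta_span" by (rule imageE)
      from that(2) obtain q where q: "y = cls q" "q \<in> eta_span" by (rule imageE)
      have "p \<in> free_tuples d" "q \<in> free_tuples d" using p(2) q(2) eta_span_tensors tensors_tuples by blast+
      then have "x \<otimes>\<^bsub>A\<^esub> y = cls (tmul p q)" by (simp add: A mult_E p(1) q(1))
      then show ?thesis using tmul_eta_span p(2) q(2) by simp
    qed
    ultimately have "is_subalgebra A (cls ` eta_span)"
      using AE sub[of "cls ` eta_span"] by (auto simp: is_subalgebra_def)
    moreover have "G \<subseteq> cls ` eta_span" using prefix_inv_eta_span inssum_eta_span by (auto simp: G)
    ultimately show "generated_subalgebra A G \<subseteq> cls ` eta_span"
      unfolding generated_subalgebra_def by blast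
    show "cls ` eta_span \<subseteq> generated_subalgebra A G"
      unfolding generated_subalgebra_def
    proof (rule Inter_greatest)
      fix C assume "C \<in> {C. is_subalgebra A C \<and> G \<subseteq> C}"
      then have C: "is_submodule A C" "\<And>x y. x \<in> C \<Longrightarrow> y \<in> C \<Longrightarrow> x \<otimes>\<^bsub>A\<^esub> y \<in> C" "G \<subseteq> C"
        by (auto simp: is_subalgebra_def)
      have CA: "C \<subseteq> carrier A" using C(1) by (simp add: is_submodule_def)
      then have E: "is_submodule E C" using sub[of C] AE C(1) by blast
      have "eta_span \<subseteq> {p \<in> tensors. cls p \<in> C}"
      proof (rule eta_span_subset_subalgebra[OF subspace_submodule[OF E]])
        fix p q assume pq: "p \<in> {p \<in> tensors. cls p \<in> C}" "q \<in> {p \<in> tensors. cls p \<in> C}"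
        then have "cls p \<otimes>\<^bsub>A\<^esub> cls q = cls (tmul p q)" by (simp add: A mult_E tensors_tuples)
        then show "tmul p q \<in> {p \<in> tensors. cls p \<in> C}" using C(2)[of "cls p" "cls q"] pq by (simp add: tmul_tensors)
      next
        show "prefix_inv d \<subseteq> {p \<in> tensors. cls p \<in> C}" using C(3) prefix_inv_tensors by (auto simp: G)
        show "inssum v \<in> {p \<in> tensors. cls p \<in> C}" for v using C(3) inssum_tensors by (auto simp: G)
      qed
      then show "cls ` eta_span \<subseteq> C" by blast
    qed
  qed
qed

end


section \<open>Matrices\<close>

lemma (in Modules.module) independent_Un:
  assumes "independent S" "independent S'" "span S \<inter> span S' \<subseteq> {0}"
  shows "independent (S \<union> S')"
  unfolding independent_explicit_module
proof (intro allI impI)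
  fix t u v assume t: "finite t" "t \<subseteq> S \<union> S'" "(\<Sum>v\<in>t. scale (u v) v) = 0" "v \<in> t"
  let ?a = "\<Sum>v\<in>t \<inter> S. scale (u v) v" and ?b = "\<Sum>v\<in>t - S. scale (u v) v"
  have "?a + ?b = 0"
    using t sum.Int_Diff[of t "\<lambda>v. scale (u v) v" S] by simp
  then have "?a = - ?b" by (rule eq_neg_iff_add_eq_0[THEN iffD2])
  moreover have "?a \<in> span S" by (intro span_sum span_scale span_base) auto
  moreover have b: "?b \<in> span S'" using t(2) by (intro span_sum span_scale span_base) auto
  then have "- ?b \<in> span S'" by (rule span_neg)
  ultimately have "?a = 0" "?b = 0" using assms(3) by auto
  then show "u v = 0"
    using independentD[OF assms(1), of "t \<inter> S" u v] independentD[OF assms(2), of "t - S" u v] t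
    by (cases "v \<in> S") auto
qed

lemma mat_scale_nth [simp]: "mat_scale scl c X $ r $ s = scl c (X $ r $ s)"
  by (simp add: mat_scale_def)

lemma mat_mul_nth [simp]: "mat_mul X Y $ r $ s = (\<Sum>t\<in>UNIV. X $ r $ t * Y $ t $ s)"
  by (simp add: mat_mul_def)

lemma \<xi>_unit_nth [simp]: "\<xi>_unit a r s $ i $ j = (if i = r \<and> j = s then a else 0)"
  by (simp add: \<xi>_unit_def)

lemma mat_eq_iff: "X = Y \<longleftrightarrow> (\<forall>r s. X $ r $ s = Y $ r $ s)"
  by (simp add: vec_eq_iff)

lemma \<xi>_unit_eq_iff: "b \<noteq> 0 \<Longrightarrow> \<xi>_unit b r s = \<xi>_unit b' r' s' \<longleftrightarrow> b = b' \<and> r = r' \<and> s = s'"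
  by (auto simp: mat_eq_iff split: if_splits)

lemma mat_mul_assoc: "mat_mul (mat_mul X Y) Z = mat_mul X (mat_mul Y Z)"
  by (simp add: mat_eq_iff sum_distrib_left sum_distrib_right mult.assoc) (subst sum.swap, rule allI, simp)

section \<open>Bases of matrix superalgebras\<close>

definition mat_basis :: "'a::zero set \<Rightarrow> ('a^'n^'n) set" where
  "mat_basis B = {\<xi>_unit b r s |b r s. b \<in> B}"

lemma mat_basis_Un: "mat_basis (B \<union> B') = mat_basis B \<union> mat_basis B'"
  by (auto simp: mat_basis_def)

lemma \<xi>_unit_mat_basis: "b \<in> B \<Longrightarrow> \<xi>_unit b r s \<in> mat_basis B"
  by (auto simp: mat_basis_def)

lemma mat_mul_one:
  fixes X :: "('a::{ring,monoid_mult})^'n^'n"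
  shows "mat_mul (mat 1) X = X" "mat_mul X (mat 1) = X"
  by (simp_all add: mat_eq_iff mat_def if_distrib[of "\<lambda>x. x * _"] if_distrib[of "\<lambda>x. _ * x"] cong: if_cong)

lemma module_mat_scale: "Modules.module scl \<Longrightarrow> Modules.module (mat_scale scl)"
  unfolding Modules.module_def by (simp add: mat_eq_iff)

context Modules.module
begin

lemma mat_over_subspace: "subspace U \<Longrightarrow> module.subspace (mat_scale scale) (mat_over U)"
  unfolding module.subspace_def[OF module_mat_scale[OF module_axioms]]
  by (auto simp: mat_over_def subspace_def)

lemma span_mat_basis:
  "module.span (mat_scale scale) (mat_basis B :: ('b^'n::finite^'n) set) = mat_over (span B)"
proof -
  interpret mat: Modules.module "mat_scale scale :: 'a \<Rightarrow> 'b^'n^'n \<Rightarrow> 'b^'n^'n"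
    by (rule module_mat_scale) (rule module_axioms)
  show ?thesis
  proof
    show "mat.span (mat_basis B) \<subseteq> mat_over (span B)"
      by (intro mat.span_minimal mat_over_subspace subspace_span)
         (auto simp: mat_over_def mat_basis_def span_zero intro: span_base)
    have unit: "\<xi>_unit x r s \<in> mat.span (mat_basis B)" if "x \<in> span B" for x and r s :: 'n
      using that
    proof (induction rule: span_induct_alt)
      case base
      have "\<xi>_unit (0 :: 'b) r s = 0" by (simp add: mat_eq_iff)
      then show ?case by (simp add: mat.span_zero)
    next
      case (step c x y)
      have "\<xi>_unit (scale c x + y) r s = mat_scale scale c (\<xi>_unit x r s) + \<xi>_unit y r s"
        by (simp add: mat_eq_iff)
      moreover have "\<xi>_unit x r s \<in> mat_basis B" using step(1) by (auto simp: mat_basis_def)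
      ultimately show ?case using step(2) by (simp add: mat.span_add mat.span_scale mat.span_base)
    qed
    show "mat_over (span B) \<subseteq> mat.span (mat_basis B)"
    proof
      fix X :: "'b^'n^'n" assume X: "X \<in> mat_over (span B)"
      have "X = (\<Sum>r\<in>UNIV. \<Sum>s\<in>UNIV. \<xi>_unit (X $ r $ s) r s)"
      proof -
        have "(\<Sum>r\<in>UNIV. \<Sum>s\<in>UNIV. \<xi>_unit (X $ r $ s) r s) $ i $ j = X $ i $ j" for i j
        proof -
          have "(\<Sum>r\<in>UNIV. \<Sum>s\<in>UNIV. \<xi>_unit (X $ r $ s) r s) $ i $ j =
              (\<Sum>r\<in>UNIV. \<Sum>s\<in>UNIV. \<xi>_unit (X $ r $ s) r s $ i $ j)"
            by (simp only: sum_component)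
          also have "\<dots> = (\<Sum>r\<in>UNIV. if r = i then X $ r $ j else 0)"
          proof (rule sum.cong[OF refl])
            fix r
            have "(\<Sum>s\<in>UNIV. \<xi>_unit (X $ r $ s) r s $ i $ j) = (\<Sum>s\<in>UNIV. if s = j then if r = i then X $ r $ s else 0 else 0)"
              by (rule sum.cong) auto
            then show "(\<Sum>s\<in>UNIV. \<xi>_unit (X $ r $ s) r s $ i $ j) = (if r = i then X $ r $ j else 0)"
              by simp
          qed
          finally show ?thesis by simp
        qed
        then show ?thesis by (simp add: mat_eq_iff)
      qed
      also have "\<dots> \<in> mat.span (mat_basis B)"
        using X by (intro mat.span_sum unit) (simp add: mat_over_def)
      finally show "X \<in> mat.span (mat_basis B)" .
    qed
  qed
qed

text \<open>Reading a vanishing combination at the entry \<open>(r, s)\<close> removes the matrix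
  units at all other positions and leaves a relation among elements of \<open>B\<close>.\<close>

lemma independent_mat_basis:
  assumes "independent B"
  shows "\<not> module.dependent (mat_scale scale) (mat_basis B :: ('b^'n::finite^'n) set)"
proof -
  interpret mat: Modules.module "mat_scale scale :: 'a \<Rightarrow> 'b^'n^'n \<Rightarrow> 'b^'n^'n"
    by (rule module_mat_scale) (rule module_axioms)
  show ?thesis
    unfolding mat.independent_explicit_module
  proof (intro allI impI)
    fix t u and v :: "'b^'n^'n"
    assume t: "finite t" "t \<subseteq> mat_basis B" "(\<Sum>v\<in>t. mat_scale scale (u v) v) = 0" "v \<in> t"
    then obtain b r s where v: "v = \<xi>_unit b r s" "b \<in> B" by (auto simp: mat_basis_def)
    let ?f = "\<lambda>b. \<xi>_unit b r s :: 'b^'n^'n"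
    have inj: "inj_on ?f A" for A by (rule inj_onI) (metis \<xi>_unit_nth)
    let ?t = "{b \<in> B. ?f b \<in> t}"
    have fin: "finite ?t"
      by (rule finite_imageD[OF finite_subset[OF _ t(1)] inj]) auto
    have z: "scale (u w) (w $ r $ s) = 0" if w: "w \<in> t - ?f ` ?t" for w
    proof -
      obtain b' r' s' where w': "w = \<xi>_unit b' r' s'" "b' \<in> B" using w t(2) by (auto simp: mat_basis_def)
      then have "\<not> (r = r' \<and> s = s')" using w by auto
      then show ?thesis by (auto simp: w')
    qed
    have "0 = (\<Sum>w\<in>t. mat_scale scale (u w) w) $ r $ s" using t(3) by simp
    also have "\<dots> = (\<Sum>w\<in>t. scale (u w) (w $ r $ s))" by (simp add: sum_component)
    also have "\<dots> = (\<Sum>w\<in>?f ` ?t. scale (u w) (w $ r $ s))"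
      using t(1) z by (intro sum.mono_neutral_right) auto
    also have "\<dots> = (\<Sum>b\<in>?t. scale (u (?f b)) b)" using inj by (subst sum.reindex) simp_all
    finally have "u (?f b) = 0"
      using t(4) v by (intro independentD[OF assms fin, where v = b and u = "\<lambda>b. u (?f b)"]) auto
    then show "u v = 0" by (simp add: v)
  qed
qed

end

lemma superalgebra_mat:
  fixes scl :: "'k::comm_ring_1 \<Rightarrow> 'a::ring \<Rightarrow> 'a"
  assumes "superalgebra scl (*) gr"
  shows "superalgebra (mat_scale scl :: 'k \<Rightarrow> 'a^'n::finite^'n \<Rightarrow> _) mat_mul (mat_gr gr)"
proof -
  interpret A: superalgebra scl "(*)" gr by fact
  interpret M: Modules.module "mat_scale scl :: 'k \<Rightarrow> 'a^'n^'n \<Rightarrow> 'a^'n^'n"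
    by (rule module_mat_scale) (rule A.module_axioms)
  show ?thesis
  proof
    fix X Y Z :: "'a^'n^'n" and c i j
    show "mat_mul (mat_mul X Y) Z = mat_mul X (mat_mul Y Z)" by (rule mat_mul_assoc)
    show "mat_mul (X + Y) Z = mat_mul X Z + mat_mul Y Z" "mat_mul X (Y + Z) = mat_mul X Y + mat_mul X Z"
      by (simp_all add: mat_eq_iff distrib_left distrib_right sum.distrib)
    show "mat_mul (mat_scale scl c X) Y = mat_scale scl c (mat_mul X Y)"
      "mat_mul X (mat_scale scl c Y) = mat_scale scl c (mat_mul X Y)"
      by (simp_all add: mat_eq_iff A.mul_scale_left A.mul_scale_right A.scale_sum_right)
    show "M.subspace (mat_gr gr i)"
      unfolding mat_gr_def by (rule A.mat_over_subspace) (rule A.gr_subspace)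
    show "X \<in> mat_gr gr i \<Longrightarrow> Y \<in> mat_gr gr j \<Longrightarrow> mat_mul X Y \<in> mat_gr gr (i + j)"
      by (auto simp: mat_gr_def mat_over_def intro!: A.subspace_sum[OF A.gr_subspace] A.gr_mul)
    show "\<exists>!p. fst p \<in> mat_gr gr 0 \<and> snd p \<in> mat_gr gr 1 \<and> X = fst p + snd p"
    proof (rule ex1I)
      let ?p = "(\<chi> r s. homogeneous_part gr 0 (X $ r $ s), \<chi> r s. homogeneous_part gr 1 (X $ r $ s))"
      show "fst ?p \<in> mat_gr gr 0 \<and> snd ?p \<in> mat_gr gr 1 \<and> X = fst ?p + snd ?p"
        by (simp add: mat_gr_def mat_over_def mat_eq_iff A.homogeneous_part_mem A.homogeneous_part_sum)
      fix p assume p: "fst p \<in> mat_gr gr 0 \<and> snd p \<in> mat_gr gr 1 \<and> X = fst p + snd p"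
      have "homogeneous_part gr 0 (X $ r $ s) = fst p $ r $ s" "homogeneous_part gr 1 (X $ r $ s) = snd p $ r $ s" for r s
        using p by (auto simp: mat_gr_def mat_over_def intro!: A.homogeneous_part_eqI)
      then show "p = ?p" by (auto simp: prod_eq_iff mat_eq_iff)
    qed
  qed
qed

lemma based_superalgebra_mat:
  fixes scl :: "'k::{idom,ring_char_0} \<Rightarrow> 'a::{ring,monoid_mult} \<Rightarrow> 'a"
  assumes "unital_good_pair scl gr \<aa>" and pair: "pair_basis scl gr \<aa> \<cc> Ba Bc B1"
  shows "based_superalgebra (mat_scale scl :: 'k \<Rightarrow> 'a^'n::finite^'n \<Rightarrow> _) mat_mul (mat_gr gr) (mat 1)
    (mat_basis Ba) (mat_basis Bc) (mat_basis B1)"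
proof -
  interpret A: unital_good_pair scl gr \<aa> by fact
  interpret M: superalgebra "mat_scale scl :: 'k \<Rightarrow> 'a^'n^'n \<Rightarrow> 'a^'n^'n" mat_mul "mat_gr gr"
    by (rule superalgebra_mat) (rule A.superalgebra_axioms)
  have span: "A.span Ba = \<aa>" "A.span Bc = \<cc>" "A.span B1 = gr 1"
    and ind: "A.independent Ba" "A.independent Bc" "A.independent B1"
    and ac: "\<aa> \<inter> \<cc> = {0}" "{x + y |x y. x \<in> \<aa> \<and> y \<in> \<cc>} = gr 0"
    using pair by (auto simp: pair_basis_def is_basis_def)
  \<comment> \<open>\<open>\<aa>\<close> and \<open>\<cc>\<close> together give the even part, and
    the even and odd parts give everything, so the three bases form one basis of the
    algebra.\<close>
  have gr0: "A.span (Ba \<union> Bc) = gr 0" unfolding A.span_Un span using ac(2) .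
  have "A.independent (Ba \<union> Bc)"
    by (rule A.independent_Un[OF ind(1,2)]) (simp add: span ac(1))
  then have ind_all: "A.independent (Ba \<union> Bc \<union> B1)"
    by (rule A.independent_Un[OF _ ind(3)]) (use A.gr_0_Int_1 in \<open>auto simp: span gr0\<close>)
  have "A.span (Ba \<union> Bc \<union> B1) = {x + y |x y. x \<in> gr 0 \<and> y \<in> gr 1}"
    unfolding A.span_Un[of "Ba \<union> Bc"] gr0 span by simp
  also have "\<dots> = UNIV"
    using A.homogeneous_part_sum[symmetric] A.homogeneous_part_mem(1) by blast
  finally have span_all: "A.span (Ba \<union> Bc \<union> B1) = UNIV" .
  have sub: "Ba \<union> Bc \<subseteq> gr 0" "B1 \<subseteq> gr 1"
    unfolding gr0[symmetric] span(3)[symmetric] by (rule A.span_superset)+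
  have nz: "0 \<notin> Ba" using ind(1) A.dependent_zero by blast
  have disj: "Ba \<inter> Bc = {}"
  proof (rule equals0I)
    fix x assume "x \<in> Ba \<inter> Bc"
    then have x: "x \<in> \<aa> \<inter> \<cc>" "x \<in> Ba"
      using A.span_superset[of Ba] A.span_superset[of Bc] unfolding span by auto
    from x(1) have "x = 0" unfolding ac(1) by simp
    with x(2) nz show False by simp
  qed
  show ?thesis
  proof
    fix X Y :: "'a^'n^'n"
    show "mat_mul (mat 1) X = X" "mat_mul X (mat 1) = X" by (rule mat_mul_one)+
    show "mat 1 \<in> M.span (mat_basis Ba)"
      using A.one_sub A.subspace_0[OF A.sub_subspace]
      by (simp add: A.span_mat_basis span mat_over_def mat_def)
    show "X \<in> M.span (mat_basis Ba) \<Longrightarrow> Y \<in> M.span (mat_basis Ba) \<Longrightarrow> mat_mul X Y \<in> M.span (mat_basis Ba)"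
      by (auto simp: A.span_mat_basis span mat_over_def intro!: A.subspace_sum[OF A.sub_subspace] A.sub_mult)
    show "mat_basis Ba \<union> mat_basis Bc \<subseteq> mat_gr gr 0" "mat_basis B1 \<subseteq> mat_gr gr 1"
      using sub by (auto simp: mat_basis_def mat_gr_def mat_over_def A.subspace_0[OF A.gr_subspace])
    show "mat_basis Ba \<inter> mat_basis Bc = ({} :: ('a^'n^'n) set)"
    proof (intro equals0I)
      fix v :: "'a^'n^'n" assume "v \<in> mat_basis Ba \<inter> mat_basis Bc"
      then have v: "v \<in> mat_basis Ba" "v \<in> mat_basis Bc" by simp_all
      from v(1) obtain b r s where "v = \<xi>_unit b r s" "b \<in> Ba" unfolding mat_basis_def by blast
      moreover from v(2) obtain b' r' s' where "v = \<xi>_unit b' r' s'" "b' \<in> Bc" unfolding mat_basis_def by blast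
      ultimately show False using \<xi>_unit_eq_iff[of b r s b' r' s'] nz disj by auto
    qed
    show "M.independent (mat_basis Ba \<union> mat_basis Bc \<union> mat_basis B1)"
      unfolding mat_basis_Un[symmetric] by (rule A.independent_mat_basis[OF ind_all])
    show "M.span (mat_basis Ba \<union> mat_basis Bc \<union> mat_basis B1) = UNIV"
      unfolding mat_basis_Un[symmetric] A.span_mat_basis span_all by (simp add: mat_over_def)
  qed
qed

text \<open>Translates a triple into a word for the abstract part. On triples of lists of equal
  length without zero entries no information is lost, because a nonzero matrix unit determines its
  entry and its position.\<close>

definition triple_word :: "'a::zero list \<Rightarrow> 'n list \<Rightarrow> 'n list \<Rightarrow> ('a^'n^'n) list" where
  "triple_word b r s = map (\<lambda>i. \<xi>_unit (b ! i) (r ! i) (s ! i)) [0..<length b]"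

lemma triple_word_nth [simp]:
  "length (triple_word b r s) = length b"
  "i < length b \<Longrightarrow> triple_word b r s ! i = \<xi>_unit (b ! i) (r ! i) (s ! i)"
  by (simp_all add: triple_word_def)

lemma tri_stabilizer_triple_word:
  assumes "length b = d" "length r = d" "length s = d" "0 \<notin> set b"
  shows "tri_stabilizer b r s d = tuple_stabilizer (triple_word b r s)"
proof -
  have "permute_list \<tau> (triple_word b r s) = triple_word b r s \<longleftrightarrow>
      permute_list \<tau> b = b \<and> permute_list \<tau> r = r \<and> permute_list \<tau> s = s" if \<tau>: "\<tau> permutes {..<d}" for \<tau>
  proof -
    have lt: "\<tau> i < d" if "i < d" for i using permutes_in_image[OF \<tau>, of i] that by simp
    have eq: "permute_list \<tau> xs = xs \<longleftrightarrow> (\<forall>i<d. xs ! \<tau> i = xs ! i)" if "length xs = d" for xs :: "'x list"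
      using that \<tau> by (auto simp: list_eq_iff_nth_eq permute_list_nth)
    have "\<xi>_unit (b ! \<tau> i) (r ! \<tau> i) (s ! \<tau> i) = \<xi>_unit (b ! i) (r ! i) (s ! i) \<longleftrightarrow>
        b ! \<tau> i = b ! i \<and> r ! \<tau> i = r ! i \<and> s ! \<tau> i = s ! i" if "i < d" for i
      using lt[OF that] assms by (intro \<xi>_unit_eq_iff) (metis nth_mem)
    then show ?thesis using assms lt by (auto simp: eq)
  qed
  then show ?thesis using assms by (auto simp: tri_stabilizer_def tuple_stabilizer_def)
qed

lemma count_triple_word:
  assumes "length b = d" "length r = d" "length s = d" "b' \<noteq> 0"
  shows "count (mset (triple_word b r s)) (\<xi>_unit b' r' s') = tri_count b r s b' r' s'"
proof -
  have "{i. i < length b \<and> \<xi>_unit b' r' s' = triple_word b r s ! i} =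
      {k. k < length b \<and> (b ! k, r ! k, s ! k) = (b', r', s')}"
    using assms by (auto simp: \<xi>_unit_eq_iff)
  then show ?thesis by (simp only: count_mset_card triple_word_nth tri_count_def)
qed

lemma part_fact_triple_word:
  fixes r s :: "'n::finite list"
  assumes len: "length b = d" "length r = d" "length s = d" and Bc: "0 \<notin> Bc"
  shows "part_fact (mat_basis Bc) (triple_word b r s) = tri_fact Bc b r s"
proof -
  let ?w = "triple_word b r s" and ?I = "(Bc \<inter> set b) \<times> (UNIV :: 'n set) \<times> (UNIV :: 'n set)"
  let ?f = "\<lambda>(b', r', s'). \<xi>_unit b' r' s' :: 'a^'n^'n"
  have inj: "inj_on ?f ?I"
  proof (rule inj_onI)
    fix x y assume xy: "x \<in> ?I" "y \<in> ?I" "?f x = ?f y"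
    obtain b1 r1 s1 b2 r2 s2 where "x = (b1, r1, s1)" "y = (b2, r2, s2)" by (metis prod_cases3)
    with xy Bc \<xi>_unit_eq_iff[of b1 r1 s1 b2 r2 s2] show "x = y" by auto
  qed
  have "tri_fact Bc b r s = (\<Prod>(b', r', s')\<in>?I. fact (tri_count b r s b' r' s'))"
    unfolding tri_fact_def by (simp add: prod.cartesian_product split_def)
  also have "\<dots> = (\<Prod>p\<in>?I. fact (count (mset ?w) (?f p)))"
  proof (rule prod.cong[OF refl])
    fix p assume "p \<in> ?I"
    then obtain b' r' s' where "p = (b', r', s')" "b' \<noteq> 0" using Bc by auto
    then show "(case p of (b', r', s') \<Rightarrow> fact (tri_count b r s b' r' s')) = (fact (count (mset ?w) (?f p)) :: nat)"
      by (simp add: count_triple_word[OF len])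
  qed
  also have "\<dots> = (\<Prod>x\<in>?f ` ?I. fact (count (mset ?w) x))"
    using inj by (simp add: prod.reindex)
  also have "\<dots> = (\<Prod>x\<in>mat_basis Bc \<inter> set ?w. fact (count (mset ?w) x))"
  \<comment> \<open>Index triples that do not occur in the word contribute
    \<open>0! = 1\<close>.\<close>
  proof (rule prod.mono_neutral_right)
    show "mat_basis Bc \<inter> set ?w \<subseteq> ?f ` ?I"
    proof
      fix x assume "x \<in> mat_basis Bc \<inter> set ?w"
      then obtain b' r' s' i where x: "x = \<xi>_unit b' r' s'" "b' \<in> Bc" "i < length b" "x = ?w ! i"
        by (auto simp: mat_basis_def in_set_conv_nth)
      then have "\<xi>_unit b' r' s' = (\<xi>_unit (b ! i) (r ! i) (s ! i) :: 'a^'n^'n)" "b' \<noteq> 0" using Bc by auto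
      then have "b' = b ! i" by (simp add: \<xi>_unit_eq_iff)
      then have "(b', r', s') \<in> ?I" using x by auto
      then show "x \<in> ?f ` ?I" using x(1) by (intro image_eqI[of _ _ "(b', r', s')"]) auto
    qed
    show "\<forall>x\<in>?f ` ?I - mat_basis Bc \<inter> set ?w. fact (count (mset ?w) x) = (1::nat)"
    proof
      fix x assume x: "x \<in> ?f ` ?I - mat_basis Bc \<inter> set ?w"
      then have "x \<in> mat_basis Bc" by (auto simp: mat_basis_def)
      with x have "x \<notin> set ?w" by blast
      then have "count (mset ?w) x = 0" by simp
      then show "fact (count (mset ?w) x) = (1::nat)" by (simp only: fact_0)
    qed
  qed simp
  finally show ?thesis by (simp add: part_fact_def)
qed

text \<open>Equality of letters is equality of the three data in a slot, and a matrix unit is even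
  exactly when its entry is, the other entries being 0. So the conditions by multiplicity and by
  pairs of slots agree.\<close>

lemma triple_word_tri_iff:
  assumes len: "length b = d" "length r = d" "length s = d" and b: "0 \<notin> set b" and "0 \<in> gr 0"
  shows "(\<forall>x\<in>set (triple_word b r s). x \<notin> mat_gr gr 0 \<longrightarrow> count (mset (triple_word b r s)) x = 1) \<longleftrightarrow>
    (\<forall>k<d. \<forall>l<d. k \<noteq> l \<and> (b ! k, r ! k, s ! k) = (b ! l, r ! l, s ! l) \<longrightarrow> b ! k \<in> gr 0)"
proof -
  let ?w = "triple_word b r s"
  have nz: "b ! k \<noteq> 0" if "k < d" for k using b len that by (metis nth_mem)
  have gr: "?w ! k \<in> mat_gr gr 0 \<longleftrightarrow> b ! k \<in> gr 0" if "k < d" for k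
    using that len \<open>0 \<in> gr 0\<close> by (auto simp: mat_gr_def mat_over_def)
  have eq: "?w ! k = ?w ! l \<longleftrightarrow> (b ! k, r ! k, s ! k) = (b ! l, r ! l, s ! l)" if "k < d" "l < d" for k l
    using that len nz by (simp add: \<xi>_unit_eq_iff)
  have card: "count (mset ?w) (?w ! k) = 1 \<longleftrightarrow> (\<forall>l<d. ?w ! k = ?w ! l \<longrightarrow> l = k)" if k: "k < d" for k
  proof -
    let ?S = "{i. i < d \<and> ?w ! k = ?w ! i}"
    have c: "count (mset ?w) (?w ! k) = card ?S" by (simp only: count_mset_card triple_word_nth len)
    have fin: "finite ?S" and mem: "k \<in> ?S" using k by simp_all
    show ?thesis
    proof
      assume "count (mset ?w) (?w ! k) = 1"
      then obtain j where j: "?S = {j}" unfolding c by (rule card_1_singletonE)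
      show "\<forall>l<d. ?w ! k = ?w ! l \<longrightarrow> l = k"
      proof (intro allI impI)
        fix l assume "l < d" "?w ! k = ?w ! l"
        then have "l \<in> ?S" by (intro CollectI conjI)
        with mem show "l = k" unfolding j by simp
      qed
    next
      assume "\<forall>l<d. ?w ! k = ?w ! l \<longrightarrow> l = k"
      then have "?S \<subseteq> {k}" by (intro subsetI) simp
      with mem have "?S = {k}" by (intro equalityI) (simp_all only: empty_subsetI insert_subset)
      then show "count (mset ?w) (?w ! k) = 1" unfolding c by simp
    qed
  qed
  have "(\<forall>x\<in>set ?w. x \<notin> mat_gr gr 0 \<longrightarrow> count (mset ?w) x = 1) \<longleftrightarrow>
      (\<forall>k<d. ?w ! k \<notin> mat_gr gr 0 \<longrightarrow> count (mset ?w) (?w ! k) = 1)"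
    unfolding all_set_conv_all_nth triple_word_nth(1) len ..
  also have "\<dots> \<longleftrightarrow> (\<forall>k<d. b ! k \<notin> gr 0 \<longrightarrow> (\<forall>l<d. (b ! k, r ! k, s ! k) = (b ! l, r ! l, s ! l) \<longrightarrow> l = k))"
  proof -
    have "(?w ! k \<notin> mat_gr gr 0 \<longrightarrow> count (mset ?w) (?w ! k) = 1) \<longleftrightarrow>
        (b ! k \<notin> gr 0 \<longrightarrow> (\<forall>l<d. (b ! k, r ! k, s ! k) = (b ! l, r ! l, s ! l) \<longrightarrow> l = k))" if k: "k < d" for k
      unfolding gr[OF k] card[OF k] using eq[OF k] by blast
    then show ?thesis by blast
  qed
  finally show ?thesis by blast
qed

theorem theorem2:
  fixes scl :: "'k::{idom,ring_char_0} \<Rightarrow> 'a::{ring,monoid_mult} \<Rightarrow> 'a"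
    and gr :: "bit \<Rightarrow> 'a set"
    and \<aa> \<cc> Ba Bc B1 :: "'a set"
    and d :: nat
    and S :: "('k, (('a^'n::finite^'n) list \<Rightarrow>\<^sub>0 'k) set) module"
    and G :: "(('a^'n^'n) list \<Rightarrow>\<^sub>0 'k) set set"
  assumes "unital_good_pair scl gr \<aa>"
    and "pair_basis scl gr \<aa> \<cc> Ba Bc B1"
  defines "S \<equiv> S_alg scl gr d"
    and "G \<equiv> S_sub scl gr \<aa> d \<union> range (insertion_sum scl gr d)"
  shows "G \<subseteq> carrier S \<and> T_alg scl gr Ba Bc B1 d = generated_subalgebra S G"
proof -
  interpret A: unital_good_pair scl gr \<aa> by fact
  interpret M: based_superalgebra "mat_scale scl :: 'k \<Rightarrow> 'a^'n^'n \<Rightarrow> 'a^'n^'n" mat_mul "mat_gr gr" "mat 1"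
    "mat_basis Ba" "mat_basis Bc" "mat_basis B1" d
    by (rule based_superalgebra_mat) fact+
  have span_Ba: "A.span Ba = \<aa>" and ind: "A.independent Ba" "A.independent Bc" "A.independent B1"
    using assms(2) by (auto simp: pair_basis_def is_basis_def)
  have nz: "0 \<notin> Ba" "0 \<notin> Bc" "0 \<notin> B1" using ind A.dependent_zero by blast+
  have E: "mat_tensor scl gr d = M.E" by (simp add: mat_tensor_def)
  have Va: "M.Va = mat_over \<aa>" by (simp add: A.span_mat_basis span_Ba)
  have inv: "invariants scl gr d = M.cls ` {x \<in> M.tensors. M.invar d x}"
  proof -
    \<comment> \<open>Different normal forms have different classes, so a class is invariant exactly
      when its normal form is.\<close>
    have "tensor_permute (mat_scale scl) (mat_gr gr) d \<sigma> (M.cls p) = M.cls p \<longleftrightarrow> M.act \<sigma> p = p"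
      if "p \<in> M.tensors" "\<sigma> permutes {..<d}" for p \<sigma>
      using that M.act_tensors M.inj_cls by (simp add: M.tensor_permute_cls M.tensors_tuples inj_on_eq_iff)
    then show ?thesis
      unfolding invariants_def E M.carrier_E M.invar_def by auto
  qed
  have U: "S_sub scl gr \<aa> d = M.cls ` M.prefix_inv d"
  proof -
    have "{pure_tensor (mat_scale scl) vs |vs. length vs = d \<and> set vs \<subseteq> mat_over \<aa>} =
        M.cls ` {M.pt vs |vs. length vs = d \<and> (\<forall>i<d. i < d \<longrightarrow> vs ! i \<in> M.Va)}" (is "?L = M.cls ` ?R")
    proof -
      have "set vs \<subseteq> mat_over \<aa> \<longleftrightarrow> (\<forall>i<d. i < d \<longrightarrow> vs ! i \<in> M.Va)" if "length vs = d" for vs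
        unfolding Va subset_eq all_set_conv_all_nth that by simp
      then have "{vs. length vs = d \<and> set vs \<subseteq> mat_over \<aa>} = {vs. length vs = d \<and> (\<forall>i<d. i < d \<longrightarrow> vs ! i \<in> M.Va)}"
        by (intro Collect_cong conj_cong refl)
      moreover have "?L = (\<lambda>vs. M.cls (M.pt vs)) ` {vs. length vs = d \<and> set vs \<subseteq> mat_over \<aa>}"
        unfolding setcompr_eq_image by (rule image_cong) (simp_all add: M.pure_tensor_cls)
      ultimately have "?L = (\<lambda>vs. M.cls (M.pt vs)) ` {vs. length vs = d \<and> (\<forall>i<d. i < d \<longrightarrow> vs ! i \<in> M.Va)}"
        by (simp only:)
      then show ?thesis by (simp only: setcompr_eq_image image_image)
    qed
    then have "module_span M.E {pure_tensor (mat_scale scl) vs |vs. length vs = d \<and> set vs \<subseteq> mat_over \<aa>} = M.cls ` M.prefix d"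
      unfolding M.prefix_def by (simp only:) (rule M.module_span_cls, use M.pt_tensors in blast)
    then have "S_sub scl gr \<aa> d = M.cls ` {x \<in> M.tensors. M.invar d x} \<inter> M.cls ` M.prefix d"
      unfolding S_sub_def inv E by simp
    also have "\<dots> = M.cls ` ({x \<in> M.tensors. M.invar d x} \<inter> M.prefix d)"
      using M.prefix_subset_tensors by (intro inj_on_image_Int[OF M.inj_cls, symmetric]) auto
    also have "{x \<in> M.tensors. M.invar d x} \<inter> M.prefix d = M.prefix_inv d"
      using M.prefix_subset_tensors by (auto simp: M.prefix_inv_def)
    finally show ?thesis .
  qed
  have ins: "insertion_sum scl gr d X = M.cls (M.inssum X)" for X
  proof -
    \<comment> \<open>With \<open>e\<close> units behind it, \<open>X\<close> stands in slot
      \<open>d - Suc e\<close>; reversing the order of summation then gives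
      \<open>inssum\<close>.\<close>
    have "pure_tensor (mat_scale scl) (replicate (d - 1 - e) (mat 1) @ [X] @ replicate e (mat 1)) =
        M.cls (M.ins (d - Suc e) X)" if "e < d" for e
    proof -
      have "replicate (d - 1 - e) (mat 1) @ [X] @ replicate e (mat 1) = (replicate d (mat 1))[d - Suc e := X]"
        using that by (auto intro!: nth_equalityI simp: nth_append nth_list_update nth_Cons')
      then show ?thesis by (simp add: M.ins_def M.pure_tensor_cls)
    qed
    then have "insertion_sum scl gr d X = M.cls (\<Sum>e<d. M.ins (d - Suc e) X)"
      unfolding insertion_sum_def E by (intro M.finsum_E) auto
    then show ?thesis unfolding M.inssum_def by (simp only: sum.nat_diff_reindex[of "\<lambda>i. M.ins i X"])
  qed
  have tri: "M.tri (triple_word b r s) \<and> \<eta>_elem scl gr Bc d b r s = M.cls (M.eta (triple_word b r s))"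
    if "(b, r, s) \<in> Tri gr (Ba \<union> Bc \<union> B1) d" for b and r s :: "'n list"
  proof -
    let ?w = "triple_word b r s"
    have len: "length b = d" "length r = d" "length s = d" and b: "set b \<subseteq> Ba \<union> Bc \<union> B1"
      using that by (auto simp: Tri_def)
    have b0: "0 \<notin> set b" using b nz by blast
    have "set ?w \<subseteq> M.basis"
    proof
      fix x assume "x \<in> set ?w"
      then obtain i where "i < length b" "x = \<xi>_unit (b ! i) (r ! i) (s ! i)" by (auto simp: triple_word_def)
      moreover from this have "b ! i \<in> Ba \<union> Bc \<union> B1" using b nth_mem by blast
      ultimately show "x \<in> M.basis" unfolding mat_basis_Un[symmetric] by (simp only: \<xi>_unit_mat_basis)
    qed
    then have t: "M.tri ?w"
      using that len triple_word_tri_iff[OF len b0 A.subspace_0[OF A.gr_subspace]]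
      by (simp add: M.tri_def Tri_def)
    \<comment> \<open>The stabilisers agree, hence so do the cosets, and with them the
      representatives chosen by \<open>SOME\<close>.\<close>
    have cosets: "tri_cosets b r s d = tuple_cosets ?w"
      unfolding tri_cosets_def tuple_cosets_def tri_stabilizer_triple_word[OF len b0] by (simp add: len)
    have perm: "(SOME \<sigma>. \<sigma> \<in> K) permutes {..<d}" if "K \<in> tuple_cosets ?w" for K
      using M.some_coset_permutes[OF t that] .
    have fin: "finite (tuple_cosets ?w)"
      unfolding tuple_cosets_def by (simp add: setcompr_eq_image finite_permutations)
    have "map (\<lambda>i. \<xi>_unit (b ! i) (r ! i) (s ! i)) [0..<d] = ?w" by (simp add: triple_word_def len)
    then have "\<xi>_elem scl gr d b r s = M.cls (M.xi ?w)"
      unfolding \<xi>_elem_def E cosets M.xi_def using fin perm len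
      by (intro M.finsum_E) (simp_all add: M.pure_tensor_cls M.tensor_permute_cls M.tensors_tuples M.act_tensors)
    moreover have "tri_fact Bc b r s = part_fact (mat_basis Bc) ?w"
      using part_fact_triple_word[OF len nz(2)] by simp
    ultimately have "\<eta>_elem scl gr Bc d b r s = M.cls (M.eta ?w)"
      unfolding \<eta>_elem_def E M.eta_def using M.xi_tensors[OF t] by (simp add: M.smult_E M.tensors_tuples)
    with t show ?thesis ..
  qed
  \<comment> \<open>Conversely, every admissible word comes from a triple: the entry and position of
    its matrix units are chosen slot by slot.\<close>
  have tri': "\<exists>b r s. (b, r, s) \<in> Tri gr (Ba \<union> Bc \<union> B1) d \<and> w = triple_word b r s" if w: "M.tri w" for w
  proof -
    have len: "length w = d" and "set w \<subseteq> M.basis" using w by (simp_all add: M.tri_def)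
    then have "\<forall>i<d. w ! i \<in> mat_basis (Ba \<union> Bc \<union> B1)" unfolding mat_basis_Un by (metis nth_mem subsetD)
    then have "\<forall>i<d. \<exists>b r s. w ! i = \<xi>_unit b r s \<and> b \<in> Ba \<union> Bc \<union> B1"
      unfolding mat_basis_def by blast
    then obtain fb fr fs where f: "\<And>i. i < d \<Longrightarrow> w ! i = \<xi>_unit (fb i) (fr i) (fs i) \<and> fb i \<in> Ba \<union> Bc \<union> B1"
      by metis
    define b r s where "b = map fb [0..<d]" and "r = map fr [0..<d]" and "s = map fs [0..<d]"
    have lens: "length b = d" "length r = d" "length s = d" by (simp_all add: b_def r_def s_def)
    have wt: "w = triple_word b r s"
      using len f by (auto intro!: nth_equalityI simp: lens) (simp add: b_def r_def s_def)
    have b: "set b \<subseteq> Ba \<union> Bc \<union> B1" 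
    proof
      fix x assume "x \<in> set b"
      then obtain i where "i < d" "x = fb i" by (auto simp: b_def)
      with f show "x \<in> Ba \<union> Bc \<union> B1" by blast
    qed
    then have "0 \<notin> set b" using nz by blast
    then have "(b, r, s) \<in> Tri gr (Ba \<union> Bc \<union> B1) d"
      using w lens b triple_word_tri_iff[OF lens _ A.subspace_0[OF A.gr_subspace]]
      by (simp add: M.tri_def Tri_def wt)
    with wt show ?thesis by blast
  qed
  have "{\<eta>_elem scl gr Bc d b r s |b r s. (b, r, s) \<in> Tri gr (Ba \<union> Bc \<union> B1) d} = M.cls ` {M.eta w |w. M.tri w}"
    (is "?L = ?R")
  proof
    show "?L \<subseteq> ?R"
    proof
      fix x assume "x \<in> ?L"
      then obtain b r s where x: "x = \<eta>_elem scl gr Bc d b r s" "(b, r, s) \<in> Tri gr (Ba \<union> Bc \<union> B1) d" by blast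
      with tri[OF x(2)] show "x \<in> ?R" by (intro image_eqI) auto
    qed
    show "?R \<subseteq> ?L"
    proof
      fix x assume "x \<in> ?R"
      then obtain w where x: "x = M.cls (M.eta w)" "M.tri w" by auto
      from tri'[OF x(2)] obtain b r s where w: "(b, r, s) \<in> Tri gr (Ba \<union> Bc \<union> B1) d" "w = triple_word b r s" by blast
      with tri[OF w(1)] x show "x \<in> ?L" by auto
    qed
  qed
  moreover have "{M.eta w |w. M.tri w} \<subseteq> M.tensors" using M.eta_tensors by auto
  ultimately have T: "T_alg scl gr Ba Bc B1 d = M.cls ` M.eta_span"
    unfolding T_alg_def E M.eta_span_def by (simp only: M.module_span_cls)
  show ?thesis
    unfolding T
  proof (rule M.cls_eta_span_generated)
    show "S = M.E\<lparr>carrier := M.cls ` {x \<in> M.tensors. M.invar d x}\<rparr>"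
      by (simp add: S_def S_alg_def inv E)
    show "G = M.cls ` M.prefix_inv d \<union> range (\<lambda>v. M.cls (M.inssum v))"
      by (simp add: G_def U ins)
  qed
qed

end
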